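(* Let $\langle\mathcal{X},\mathcal{Y},\alpha,\varphi\rangle$ be a constrained $\mathsf{LTL_f}[\mathcal{F}]$ synthesis problem with $\alpha=\alpha_s\wedge\alpha_c$, where $\alpha_s$ is a safe and $\alpha_c$ a co-safe $\mathsf{LTL}$ formula over $\mathcal{X}\cup\mathcal{Y}$, and $\varphi$ an $\mathsf{LTL_f}[\mathcal{F}]$ formula over $\mathcal{X}\cup\mathcal{Y}$. Then a bgv-optimal strategy with respect to $(\alpha,\varphi)$ can be constructed in doubly exponential time.
   Context: $\mathsf{LTL}$ formulas are built from $\top,\bot,p,\neg,\wedge,\vee,\mathsf{X},\mathsf{U},\mathsf{R}$ and interpreted on infinite traces as usual. Safe formulas: $\psi::=\top\mid\bot\mid p\mid\neg p\mid\psi\wedge\psi\mid\psi\vee\psi\mid\mathsf{X}\psi\mid\psi\mathsf{R}\psi$; co-safe: same with $\mathsf{U}$ in place of $\mathsf{R}$. $\mathsf{LTL_f}[\mathcal{F}]$: given a set $\mathcal{F}$ of functions $f:[0,1]^k\to[0,1]$, formulas are built from $\top,\bot,p,\neg,\wedge,\mathsf{X},\mathsf{U}$ and $f(\varphi_1,\dots,\varphi_k)$ for $f\in\mathcal{F}$. The value on a finite trace $\pi$ (finite word over $2^{\mathcal{P}}$) at position $1\le i\le|\pi|$: $[\![\pi,\top]\!]_i=1$, $[\![\pi,\bot]\!]_i=0$, $[\![\pi,p]\!]_i=1$ if $p\in\pi(i)$ else $0$; $[\![\pi,\neg\psi]\!]_i=1-[\![\pi,\psi]\!]_i$; $[\![\pi,\psi_1\wedge\psi_2]\!]_i=\min$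 of the two; $[\![\pi,\mathsf{X}\psi]\!]_i=[\![\pi,\psi]\!]_{i+1}$; $[\![\pi,f(\psi_1,\dots,\psi_k)]\!]_i=f([\![\pi,\psi_1]\!]_i,\dots)$; $[\![\pi,\psi_1\mathsf{U}\psi_2]\!]_i=\max_{i\le i'\le|\pi|}\min\{[\![\pi,\psi_2]\!]_{i'},\min_{i\le j<i'}[\![\pi,\psi_1]\!]_j\}$. $[\![\pi,\varphi]\!]:=[\![\pi,\varphi]\!]_1$. Strategies ($\mathcal{X},\mathcal{Y}$ disjoint): $\sigma:(2^{\mathcal{X}})^*\to2^{\mathcal{Y}\cup\{\mathsf{end}\}}$ such that for every infinite $\mathbf{X}=X_1X_2\dots$ of subsets of $\mathcal{X}$ there is at most one $n=n_{\sigma,\mathbf{X}}$ with $\mathsf{end}\in\sigma(X_1\cdots X_n)$ ($\infty$ if none). Induced infinite trace $(X_1\cup\sigma(X_1))(X_2\cup\sigma(X_1X_2))\cdots$; if $n<\infty$, induced finite trace $(X_1\cup\sigma(X_1))\cdots(X_n\cup\sigma(X_1\cdots X_n))$ with $\mathsf{end}$ removed; $\mathrm{Tr}(\sigma)$ is the set of induced finite traces. $\sigma$ is an $\alpha$-strategy if for every $\mathbf{X}$, $n_{\sigma,\mathbf{X}}<\infty$ or the induced infinite trace falsifies $\alpha$. The best guaranteed value $\mathrm{bgv}(\sigma)$ is $\min\{[\![\pi,\varphi]\!]:\pi\in\mathrm{Tr}(\sigma)\}$ (0 if $\mathrm{Tr}(\sigma)=\emptyset$). $\sigma$ is bgv-optimal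 w.r.t. $(\alpha,\varphi)$ if it is an $\alpha$-strategy and no $\alpha$-strategy $\sigma'$ has $\mathrm{bgv}(\sigma')>\mathrm{bgv}(\sigma)$. Complexity is in $|\alpha_s|+|\alpha_c|+|\varphi|$. *)

theory Defs
  imports
    Complex_Main
    "HOL-Library.Omega_Words_Fun"
    "HOL-Computational_Algebra.Polynomial"
begin

section \<open>LTL on infinite traces\<close>

datatype ltl =
    TT | FF | Prop nat | Neg ltl | And ltl ltl | Or ltl ltl
  | Next ltl | Until ltl ltl | Release ltl ltl

text \<open>Positions of (finite and infinite) traces are counted from 0.\<close>

fun ltl_sem :: "nat set word \<Rightarrow> nat \<Rightarrow> ltl \<Rightarrow> bool" where
  "ltl_sem \<pi> i TT \<longleftrightarrow> True"
| "ltl_sem \<pi> i FF \<longleftrightarrow> False"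
| "ltl_sem \<pi> i (Prop p) \<longleftrightarrow> p \<in> \<pi> i"
| "ltl_sem \<pi> i (Neg \<psi>) \<longleftrightarrow> \<not> ltl_sem \<pi> i \<psi>"
| "ltl_sem \<pi> i (And \<psi>\<^sub>1 \<psi>\<^sub>2) \<longleftrightarrow> ltl_sem \<pi> i \<psi>\<^sub>1 \<and> ltl_sem \<pi> i \<psi>\<^sub>2"
| "ltl_sem \<pi> i (Or \<psi>\<^sub>1 \<psi>\<^sub>2) \<longleftrightarrow> ltl_sem \<pi> i \<psi>\<^sub>1 \<or> ltl_sem \<pi> i \<psi>\<^sub>2"
| "ltl_sem \<pi> i (Next \<psi>) \<longleftrightarrow> ltl_sem \<pi> (Suc i) \<psi>"
| "ltl_sem \<pi> i (Until \<psi>\<^sub>1 \<psi>\<^sub>2) \<longleftrightarrow>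
     (\<exists>k\<ge>i. ltl_sem \<pi> k \<psi>\<^sub>2 \<and> (\<forall>j\<in>{i..<k}. ltl_sem \<pi> j \<psi>\<^sub>1))"
| "ltl_sem \<pi> i (Release \<psi>\<^sub>1 \<psi>\<^sub>2) \<longleftrightarrow>
     (\<forall>k\<ge>i. ltl_sem \<pi> k \<psi>\<^sub>2 \<or> (\<exists>j\<in>{i..<k}. ltl_sem \<pi> j \<psi>\<^sub>1))"

inductive safe :: "ltl \<Rightarrow> bool" where
  "safe TT"
| "safe FF"
| "safe (Prop p)"
| "safe (Neg (Prop p))"
| "safe \<psi>\<^sub>1 \<Longrightarrow> safe \<psi>\<^sub>2 \<Longrightarrow> safe (And \<psi>\<^sub>1 \<psi>\<^sub>2)"
| "safe \<psi>\<^sub>1 \<Longrightarrow> safe \<psi>\<^sub>2 \<Longrightarrow> safe (Or \<psi>\<^sub>1 \<psi>\<^sub>2)"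
| "safe \<psi> \<Longrightarrow> safe (Next \<psi>)"
| "safe \<psi>\<^sub>1 \<Longrightarrow> safe \<psi>\<^sub>2 \<Longrightarrow> safe (Release \<psi>\<^sub>1 \<psi>\<^sub>2)"

inductive cosafe :: "ltl \<Rightarrow> bool" where
  "cosafe TT"
| "cosafe FF"
| "cosafe (Prop p)"
| "cosafe (Neg (Prop p))"
| "cosafe \<psi>\<^sub>1 \<Longrightarrow> cosafe \<psi>\<^sub>2 \<Longrightarrow> cosafe (And \<psi>\<^sub>1 \<psi>\<^sub>2)"
| "cosafe \<psi>\<^sub>1 \<Longrightarrow> cosafe \<psi>\<^sub>2 \<Longrightarrow> cosafe (Or \<psi>\<^sub>1 \<psi>\<^sub>2)"
| "cosafe \<psi> \<Longrightarrow> cosafe (Next \<psi>)"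
| "cosafe \<psi>\<^sub>1 \<Longrightarrow> cosafe \<psi>\<^sub>2 \<Longrightarrow> cosafe (Until \<psi>\<^sub>1 \<psi>\<^sub>2)"

fun ltl_props :: "ltl \<Rightarrow> nat set" where
  "ltl_props TT = {}"
| "ltl_props FF = {}"
| "ltl_props (Prop p) = {p}"
| "ltl_props (Neg \<psi>) = ltl_props \<psi>"
| "ltl_props (And \<psi>\<^sub>1 \<psi>\<^sub>2) = ltl_props \<psi>\<^sub>1 \<union> ltl_props \<psi>\<^sub>2"
| "ltl_props (Or \<psi>\<^sub>1 \<psi>\<^sub>2) = ltl_props \<psi>\<^sub>1 \<union> ltl_props \<psi>\<^sub>2"
| "ltl_props (Next \<psi>) = ltl_props \<psi>"
| "ltl_props (Until \<psi>\<^sub>1 \<psi>\<^sub>2) = ltl_props \<psi>\<^sub>1 \<union> ltl_props \<psi>\<^sub>2"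
| "ltl_props (Release \<psi>\<^sub>1 \<psi>\<^sub>2) = ltl_props \<psi>\<^sub>1 \<union> ltl_props \<psi>\<^sub>2"

fun ltl_length :: "ltl \<Rightarrow> nat" where
  "ltl_length TT = 1"
| "ltl_length FF = 1"
| "ltl_length (Prop p) = 1"
| "ltl_length (Neg \<psi>) = 1 + ltl_length \<psi>"
| "ltl_length (And \<psi>\<^sub>1 \<psi>\<^sub>2) = 1 + ltl_length \<psi>\<^sub>1 + ltl_length \<psi>\<^sub>2"
| "ltl_length (Or \<psi>\<^sub>1 \<psi>\<^sub>2) = 1 + ltl_length \<psi>\<^sub>1 + ltl_length \<psi>\<^sub>2"
| "ltl_length (Next \<psi>) = 1 + ltl_length \<psi>"
| "ltl_length (Until \<psi>\<^sub>1 \<psi>\<^sub>2) = 1 + ltl_length \<psi>\<^sub>1 + ltl_length \<psi>\<^sub>2"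
| "ltl_length (Release \<psi>\<^sub>1 \<psi>\<^sub>2) = 1 + ltl_length \<psi>\<^sub>1 + ltl_length \<psi>\<^sub>2"


section \<open>Quantitative LTL on finite traces\<close>

text \<open>
  A set \<open>F\<close> of functions \<open>f : [0,1]\<^sup>k \<rightarrow> [0,1]\<close> is given as a set of pairs \<open>(k, f)\<close>,
  where \<open>f\<close> is applied to argument lists of length \<open>k\<close>.
\<close>

definition unit_functions :: "(nat \<times> (real list \<Rightarrow> real)) set \<Rightarrow> bool" where
  "unit_functions F \<longleftrightarrow>
     (\<forall>(k, f)\<in>F. \<forall>rs. length rs = k \<and> set rs \<subseteq> {0..1} \<longrightarrow> f rs \<in> {0..1})"

datatype qltl =
    QTT | QFF | QProp nat | QNeg qltl | QAnd qltl qltl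
  | QNext qltl | QUntil qltl qltl | QFun "real list \<Rightarrow> real" "qltl list"

fun qltl_over :: "(nat \<times> (real list \<Rightarrow> real)) set \<Rightarrow> qltl \<Rightarrow> bool" where
  "qltl_over F QTT \<longleftrightarrow> True"
| "qltl_over F QFF \<longleftrightarrow> True"
| "qltl_over F (QProp p) \<longleftrightarrow> True"
| "qltl_over F (QNeg \<psi>) \<longleftrightarrow> qltl_over F \<psi>"
| "qltl_over F (QAnd \<psi>\<^sub>1 \<psi>\<^sub>2) \<longleftrightarrow> qltl_over F \<psi>\<^sub>1 \<and> qltl_over F \<psi>\<^sub>2"
| "qltl_over F (QNext \<psi>) \<longleftrightarrow> qltl_over F \<psi>"
| "qltl_over F (QUntil \<psi>\<^sub>1 \<psi>\<^sub>2) \<longleftrightarrow> qltl_over F \<psi>\<^sub>1 \<and> qltl_over F \<psi>\<^sub>2"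
| "qltl_over F (QFun f \<psi>s) \<longleftrightarrow> (length \<psi>s, f) \<in> F \<and> (\<forall>\<psi>\<in>set \<psi>s. qltl_over F \<psi>)"

text \<open>
  The next operator is the strong one: \<open>QNext \<psi>\<close> has value 0 at the last position.
  The inner minimum in the until clause ranges over the empty set if \<open>k = i\<close>, so both minima
  are taken as one.
\<close>

fun qltl_val :: "nat set list \<Rightarrow> nat \<Rightarrow> qltl \<Rightarrow> real" where
  "qltl_val \<pi> i QTT = 1"
| "qltl_val \<pi> i QFF = 0"
| "qltl_val \<pi> i (QProp p) = (if p \<in> \<pi> ! i then 1 else 0)"
| "qltl_val \<pi> i (QNeg \<psi>) = 1 - qltl_val \<pi> i \<psi>"
| "qltl_val \<pi> i (QAnd \<psi>\<^sub>1 \<psi>\<^sub>2) = min (qltl_val \<pi> i \<psi>\<^sub>1) (qltl_val \<pi> i \<psi>\<^sub>2)"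
| "qltl_val \<pi> i (QNext \<psi>) = (if Suc i < length \<pi> then qltl_val \<pi> (Suc i) \<psi> else 0)"
| "qltl_val \<pi> i (QUntil \<psi>\<^sub>1 \<psi>\<^sub>2) =
     (MAX k\<in>{i..<length \<pi>}.
        Min (insert (qltl_val \<pi> k \<psi>\<^sub>2) ((\<lambda>j. qltl_val \<pi> j \<psi>\<^sub>1) ` {i..<k})))"
| "qltl_val \<pi> i (QFun f \<psi>s) = f (map (qltl_val \<pi> i) \<psi>s)"

fun qltl_props :: "qltl \<Rightarrow> nat set" where
  "qltl_props QTT = {}"
| "qltl_props QFF = {}"
| "qltl_props (QProp p) = {p}"
| "qltl_props (QNeg \<psi>) = qltl_props \<psi>"
| "qltl_props (QAnd \<psi>\<^sub>1 \<psi>\<^sub>2) = qltl_props \<psi>\<^sub>1 \<union> qltl_props \<psi>\<^sub>2"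
| "qltl_props (QNext \<psi>) = qltl_props \<psi>"
| "qltl_props (QUntil \<psi>\<^sub>1 \<psi>\<^sub>2) = qltl_props \<psi>\<^sub>1 \<union> qltl_props \<psi>\<^sub>2"
| "qltl_props (QFun f \<psi>s) = (\<Union>\<psi>\<in>set \<psi>s. qltl_props \<psi>)"

fun qltl_length :: "qltl \<Rightarrow> nat" where
  "qltl_length QTT = 1"
| "qltl_length QFF = 1"
| "qltl_length (QProp p) = 1"
| "qltl_length (QNeg \<psi>) = 1 + qltl_length \<psi>"
| "qltl_length (QAnd \<psi>\<^sub>1 \<psi>\<^sub>2) = 1 + qltl_length \<psi>\<^sub>1 + qltl_length \<psi>\<^sub>2"
| "qltl_length (QNext \<psi>) = 1 + qltl_length \<psi>"
| "qltl_length (QUntil \<psi>\<^sub>1 \<psi>\<^sub>2) = 1 + qltl_length \<psi>\<^sub>1 + qltl_length \<psi>\<^sub>2"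
| "qltl_length (QFun f \<psi>s) = 1 + sum_list (map qltl_length \<psi>s)"

lemma finite_qltl_values: "finite {qltl_val \<pi> i \<phi> | \<pi> i. True}"
proof (induction \<phi>)
  case (QProp p)
  have "{qltl_val \<pi> i (QProp p) | \<pi> i. True} \<subseteq> {0, 1}" by auto
  then show ?case by (rule finite_subset) simp
next
  case (QNeg \<psi>)
  have "{qltl_val \<pi> i (QNeg \<psi>) | \<pi> i. True} \<subseteq> (\<lambda>x. 1 - x) ` {qltl_val \<pi> i \<psi> | \<pi> i. True}"
    by auto
  then show ?case by (rule finite_subset) (intro finite_imageI finite_UnI finite.insertI QNeg)
next
  case (QAnd \<psi>\<^sub>1 \<psi>\<^sub>2)
  have "{qltl_val \<pi> i (QAnd \<psi>\<^sub>1 \<psi>\<^sub>2) | \<pi> i. True} \<subseteq>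
      {qltl_val \<pi> i \<psi>\<^sub>1 | \<pi> i. True} \<union> {qltl_val \<pi> i \<psi>\<^sub>2 | \<pi> i. True}"
    by (auto simp: min_def)
  then show ?case by (rule finite_subset) (intro finite_imageI finite_UnI finite.insertI QAnd)
next
  case (QNext \<psi>)
  have "{qltl_val \<pi> i (QNext \<psi>) | \<pi> i. True} \<subseteq> insert 0 {qltl_val \<pi> i \<psi> | \<pi> i. True}"
    by auto
  then show ?case by (rule finite_subset) (intro finite_imageI finite_UnI finite.insertI QNext)
next
  case (QUntil \<psi>\<^sub>1 \<psi>\<^sub>2)
  let ?V = "{qltl_val \<pi> i \<psi>\<^sub>1 | \<pi> i. True} \<union> {qltl_val \<pi> i \<psi>\<^sub>2 | \<pi> i. True}"
  have "qltl_val \<pi> i (QUntil \<psi>\<^sub>1 \<psi>\<^sub>2) \<in> insert (Max {}) ?V" for \<pi> i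
  proof (cases "i < length \<pi>")
    case True
    let ?m = "\<lambda>k. Min (insert (qltl_val \<pi> k \<psi>\<^sub>2) ((\<lambda>j. qltl_val \<pi> j \<psi>\<^sub>1) ` {i..<k}))"
    have m: "?m k \<in> ?V" for k
    proof -
      have "?m k \<in> insert (qltl_val \<pi> k \<psi>\<^sub>2) ((\<lambda>j. qltl_val \<pi> j \<psi>\<^sub>1) ` {i..<k})"
        by (rule Min_in) auto
      then show ?thesis by blast
    qed
    have "Max (?m ` {i..<length \<pi>}) \<in> ?m ` {i..<length \<pi>}"
      using True by (intro Max_in) auto
    moreover have "?m ` {i..<length \<pi>} \<subseteq> ?V" using m by blast
    ultimately have "Max (?m ` {i..<length \<pi>}) \<in> ?V" by (rule rev_subsetD)
    then show ?thesis unfolding qltl_val.simps by (rule insertI2)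
  qed auto
  then have "{qltl_val \<pi> i (QUntil \<psi>\<^sub>1 \<psi>\<^sub>2) | \<pi> i. True} \<subseteq> insert (Max {}) ?V" by blast
  then show ?case by (rule finite_subset) (intro finite_imageI finite_UnI finite.insertI QUntil)
next
  case (QFun f \<psi>s)
  let ?V = "\<Union>\<psi>\<in>set \<psi>s. {qltl_val \<pi> i \<psi> | \<pi> i. True}"
  have "{qltl_val \<pi> i (QFun f \<psi>s) | \<pi> i. True} \<subseteq>
      f ` {xs. set xs \<subseteq> ?V \<and> length xs = length \<psi>s}"
    by (auto intro!: imageI) blast
  moreover have "finite ?V" using QFun by blast
  ultimately show ?case
    by (rule finite_subset[OF _ finite_imageI[OF finite_lists_length_eq]])
qed auto


section \<open>Strategies\<close>

text \<open>
  A set of propositions from \<open>\<Y> \<union> {end}\<close> is given as a pair of a set of propositions from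
  \<open>\<Y>\<close> and a flag for \<open>end\<close>. The value of a strategy on the empty word plays no role.
\<close>

type_synonym strategy = "nat set list \<Rightarrow> nat set \<times> bool"

definition env_words :: "nat set \<Rightarrow> nat set word set" where
  "env_words X = {w. \<forall>i. w i \<subseteq> X}"

definition ends_at :: "strategy \<Rightarrow> nat set word \<Rightarrow> nat \<Rightarrow> bool" where
  "ends_at \<sigma> w n \<longleftrightarrow> n \<ge> 1 \<and> snd (\<sigma> (prefix n w))"

definition is_strategy :: "nat set \<Rightarrow> nat set \<Rightarrow> strategy \<Rightarrow> bool" where
  "is_strategy X Y \<sigma> \<longleftrightarrow>
     (\<forall>u. set u \<subseteq> Pow X \<longrightarrow> fst (\<sigma> u) \<subseteq> Y) \<and>
     (\<forall>w\<in>env_words X. \<exists>\<^sub>\<le>\<^sub>1 n. ends_at \<sigma> w n)"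

definition inf_trace :: "strategy \<Rightarrow> nat set word \<Rightarrow> nat set word" where
  "inf_trace \<sigma> w = (\<lambda>i. w i \<union> fst (\<sigma> (prefix (Suc i) w)))"

definition fin_traces :: "nat set \<Rightarrow> strategy \<Rightarrow> nat set list set" where
  "fin_traces X \<sigma> = {prefix n (inf_trace \<sigma> w) | w n. w \<in> env_words X \<and> ends_at \<sigma> w n}"

definition constrained_strategy :: "nat set \<Rightarrow> nat set \<Rightarrow> ltl \<Rightarrow> strategy \<Rightarrow> bool" where
  "constrained_strategy X Y \<alpha> \<sigma> \<longleftrightarrow> is_strategy X Y \<sigma> \<and>
     (\<forall>w\<in>env_words X. (\<exists>n. ends_at \<sigma> w n) \<or> \<not> ltl_sem (inf_trace \<sigma> w) 0 \<alpha>)"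

text \<open>The minimum exists by \<open>finite_qltl_values\<close>.\<close>

definition bgv :: "nat set \<Rightarrow> qltl \<Rightarrow> strategy \<Rightarrow> real" where
  "bgv X \<phi> \<sigma> =
     (if fin_traces X \<sigma> = {} then 0 else (MIN \<pi>\<in>fin_traces X \<sigma>. qltl_val \<pi> 0 \<phi>))"

definition bgv_optimal :: "nat set \<Rightarrow> nat set \<Rightarrow> ltl \<Rightarrow> qltl \<Rightarrow> strategy \<Rightarrow> bool" where
  "bgv_optimal X Y \<alpha> \<phi> \<sigma> \<longleftrightarrow> constrained_strategy X Y \<alpha> \<sigma> \<and>
     \<not> (\<exists>\<sigma>'. constrained_strategy X Y \<alpha> \<sigma>' \<and> bgv X \<phi> \<sigma>' > bgv X \<phi> \<sigma>)"


section \<open>Finite-state strategies\<close>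

text \<open>
  A transducer reads an environment move through the finite set of propositions it observes.
  An entry \<open>(q, A, B, e, q')\<close> says: in state \<open>q\<close>, on a move whose observed part is \<open>A\<close>, output \<open>B\<close>,
  together with \<open>end\<close> iff \<open>e\<close>, and move to \<open>q'\<close>. If the table has no matching entry, the output
  is empty and the state does not change.
\<close>

datatype 'q transducer = Transducer
  (initial: 'q)
  (observed: "nat list")
  (table: "('q \<times> nat list \<times> nat list \<times> bool \<times> 'q) list")

definition transducer_step ::
    "'q transducer \<Rightarrow> 'q \<Rightarrow> nat set \<Rightarrow> (nat set \<times> bool) \<times> 'q" where
  "transducer_step M q a =
     (case find (\<lambda>(p, A, _). p = q \<and> set A = a \<inter> set (observed M)) (table M) of
        None \<Rightarrow> (({}, False), q)
      | Some (_, _, B, e, q') \<Rightarrow> ((set B, e), q'))"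

definition strategy_of :: "'q transducer \<Rightarrow> strategy" where
  "strategy_of M u =
     (if u = [] then ({}, False)
      else fst (transducer_step M
             (foldl (\<lambda>q a. snd (transducer_step M q a)) (initial M) (butlast u)) (last u)))"


section \<open>Computation model\<close>

text \<open>
  Programs of a first-order Lisp. Data are binary trees over symbols, real numbers
  (truth values of formulas) and functions (the members of \<open>F\<close>).
  Symbols can only be tested for equality, numbers can only be compared, complemented
  (\<open>1 - x\<close>) and used as arguments of functions, and functions can only be applied. The only
  constants a program may contain are symbols and the number 1, so that functions, and numbers
  other than those generated from 1, enter a computation through its input only.
  Every operation has unit cost, a function application costing one further unit for each
  argument.
\<close>

datatype sexp =
    Sym nat | Num real | Fn "real list \<Rightarrow> real" | Pair sexp sexp

fun sexp_list :: "sexp list \<Rightarrow> sexp" where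
  "sexp_list [] = Sym 0"
| "sexp_list (x # xs) = Pair x (sexp_list xs)"

definition sexp_bool :: "bool \<Rightarrow> sexp" where
  "sexp_bool b = Sym (if b then 1 else 0)"

datatype expr =
    EVar nat | ESym nat | EOne
  | ECons expr expr | EFst expr | ESnd expr | EIsPair expr | ESymEq expr expr
  | ELeq expr expr | ECompl expr | EApply expr expr
  | EIf expr expr expr | ELet expr expr | ECall nat "expr list"

text \<open>
  \<open>eval P \<rho> e v t\<close>: in the environment \<open>\<rho>\<close>, the expression \<open>e\<close> evaluates to \<open>v\<close> at cost \<open>t\<close>,
  where \<open>P\<close> lists the bodies of the (mutually recursive) procedures. Variables are de Bruijn
  indices into \<open>\<rho>\<close>. Evaluation is call-by-value.
\<close>

inductive eval :: "expr list \<Rightarrow> sexp list \<Rightarrow> expr \<Rightarrow> sexp \<Rightarrow> nat \<Rightarrow> bool"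
  and evals :: "expr list \<Rightarrow> sexp list \<Rightarrow> expr list \<Rightarrow> sexp list \<Rightarrow> nat \<Rightarrow> bool"
  for P :: "expr list" where
  Var: "i < length \<rho> \<Longrightarrow> eval P \<rho> (EVar i) (\<rho> ! i) 1"
| Sym: "eval P \<rho> (ESym n) (Sym n) 1"
| One: "eval P \<rho> EOne (Num 1) 1"
| Cons: "eval P \<rho> e\<^sub>1 v\<^sub>1 t\<^sub>1 \<Longrightarrow> eval P \<rho> e\<^sub>2 v\<^sub>2 t\<^sub>2 \<Longrightarrow>
    eval P \<rho> (ECons e\<^sub>1 e\<^sub>2) (Pair v\<^sub>1 v\<^sub>2) (t\<^sub>1 + t\<^sub>2 + 1)"
| Fst: "eval P \<rho> e (Pair v\<^sub>1 v\<^sub>2) t \<Longrightarrow> eval P \<rho> (EFst e) v\<^sub>1 (t + 1)"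
| Snd: "eval P \<rho> e (Pair v\<^sub>1 v\<^sub>2) t \<Longrightarrow> eval P \<rho> (ESnd e) v\<^sub>2 (t + 1)"
| IsPair: "eval P \<rho> e v t \<Longrightarrow>
    eval P \<rho> (EIsPair e) (sexp_bool (\<exists>v\<^sub>1 v\<^sub>2. v = Pair v\<^sub>1 v\<^sub>2)) (t + 1)"
| SymEq: "eval P \<rho> e\<^sub>1 v\<^sub>1 t\<^sub>1 \<Longrightarrow> eval P \<rho> e\<^sub>2 v\<^sub>2 t\<^sub>2 \<Longrightarrow>
    eval P \<rho> (ESymEq e\<^sub>1 e\<^sub>2) (sexp_bool (\<exists>n. v\<^sub>1 = Sym n \<and> v\<^sub>2 = Sym n)) (t\<^sub>1 + t\<^sub>2 + 1)"
| Leq: "eval P \<rho> e\<^sub>1 (Num r\<^sub>1) t\<^sub>1 \<Longrightarrow> eval P \<rho> e\<^sub>2 (Num r\<^sub>2) t\<^sub>2 \<Longrightarrow>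
    eval P \<rho> (ELeq e\<^sub>1 e\<^sub>2) (sexp_bool (r\<^sub>1 \<le> r\<^sub>2)) (t\<^sub>1 + t\<^sub>2 + 1)"
| Compl: "eval P \<rho> e (Num r) t \<Longrightarrow> eval P \<rho> (ECompl e) (Num (1 - r)) (t + 1)"
| Apply: "eval P \<rho> e\<^sub>1 (Fn f) t\<^sub>1 \<Longrightarrow> eval P \<rho> e\<^sub>2 v t\<^sub>2 \<Longrightarrow> v = sexp_list (map Num rs) \<Longrightarrow>
    eval P \<rho> (EApply e\<^sub>1 e\<^sub>2) (Num (f rs)) (t\<^sub>1 + t\<^sub>2 + length rs + 1)"
| If_true: "eval P \<rho> e\<^sub>1 v\<^sub>1 t\<^sub>1 \<Longrightarrow> v\<^sub>1 \<noteq> Sym 0 \<Longrightarrow> eval P \<rho> e\<^sub>2 v t\<^sub>2 \<Longrightarrow>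
    eval P \<rho> (EIf e\<^sub>1 e\<^sub>2 e\<^sub>3) v (t\<^sub>1 + t\<^sub>2 + 1)"
| If_false: "eval P \<rho> e\<^sub>1 v\<^sub>1 t\<^sub>1 \<Longrightarrow> v\<^sub>1 = Sym 0 \<Longrightarrow> eval P \<rho> e\<^sub>3 v t\<^sub>2 \<Longrightarrow>
    eval P \<rho> (EIf e\<^sub>1 e\<^sub>2 e\<^sub>3) v (t\<^sub>1 + t\<^sub>2 + 1)"
| Let: "eval P \<rho> e\<^sub>1 v\<^sub>1 t\<^sub>1 \<Longrightarrow> eval P (v\<^sub>1 # \<rho>) e\<^sub>2 v t\<^sub>2 \<Longrightarrow>
    eval P \<rho> (ELet e\<^sub>1 e\<^sub>2) v (t\<^sub>1 + t\<^sub>2 + 1)"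
| Call: "evals P \<rho> es vs t\<^sub>1 \<Longrightarrow> g < length P \<Longrightarrow> eval P vs (P ! g) v t\<^sub>2 \<Longrightarrow>
    eval P \<rho> (ECall g es) v (t\<^sub>1 + t\<^sub>2 + 1)"
| Nil: "evals P \<rho> [] [] 0"
| Args: "eval P \<rho> e v t\<^sub>1 \<Longrightarrow> evals P \<rho> es vs t\<^sub>2 \<Longrightarrow>
    evals P \<rho> (e # es) (v # vs) (t\<^sub>1 + t\<^sub>2)"

lemma sexp_list_Num_inject:
  "sexp_list (map Num rs) = sexp_list (map Num ss) \<Longrightarrow> rs = ss"
proof (induction rs arbitrary: ss)
  case Nil
  then show ?case by (cases ss) auto
next
  case (Cons r rs)
  then show ?case by (cases ss) auto
qed

inductive_cases eval_cases:
  "eval P \<rho> (EVar i) v t" "eval P \<rho> (ESym n) v t" "eval P \<rho> EOne v t"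
  "eval P \<rho> (ECons e\<^sub>1 e\<^sub>2) v t" "eval P \<rho> (EFst e) v t" "eval P \<rho> (ESnd e) v t"
  "eval P \<rho> (EIsPair e) v t" "eval P \<rho> (ESymEq e\<^sub>1 e\<^sub>2) v t" "eval P \<rho> (ELeq e\<^sub>1 e\<^sub>2) v t"
  "eval P \<rho> (ECompl e) v t" "eval P \<rho> (EApply e\<^sub>1 e\<^sub>2) v t" "eval P \<rho> (EIf e\<^sub>1 e\<^sub>2 e\<^sub>3) v t"
  "eval P \<rho> (ELet e\<^sub>1 e\<^sub>2) v t" "eval P \<rho> (ECall g es) v t"
  "evals P \<rho> [] vs t" "evals P \<rho> (e # es) vs t"

lemma eval_deterministic:
  "eval P \<rho> e v t \<Longrightarrow> (\<And>v' t'. eval P \<rho> e v' t' \<Longrightarrow> v' = v \<and> t' = t)"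
  "evals P \<rho> es vs t \<Longrightarrow> (\<And>vs' t'. evals P \<rho> es vs' t' \<Longrightarrow> vs' = vs \<and> t' = t)"
proof (induction rule: eval_evals.inducts)
  case Var then show ?case by (auto elim: eval_cases(1)) next
  case Sym then show ?case by (auto elim: eval_cases(2)) next
  case One then show ?case by (auto elim: eval_cases(3)) next
  case Cons from Cons.prems show ?case by (rule eval_cases(4)) (auto dest!: Cons.IH(2,4)) next
  case Fst from Fst.prems show ?case by (rule eval_cases(5)) (auto dest!: Fst.IH(2)) next
  case Snd from Snd.prems show ?case by (rule eval_cases(6)) (auto dest!: Snd.IH(2)) next
  case IsPair from IsPair.prems show ?case by (rule eval_cases(7)) (auto dest!: IsPair.IH(2)) next
  case SymEq from SymEq.prems show ?case by (rule eval_cases(8)) (auto dest!: SymEq.IH(2,4)) next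
  case Leq from Leq.prems show ?case by (rule eval_cases(9)) (auto dest!: Leq.IH(2,4)) next
  case Compl from Compl.prems show ?case by (rule eval_cases(10)) (auto dest!: Compl.IH(2)) next
  case Apply from Apply.prems show ?case
    by (rule eval_cases(11)) (use Apply.hyps in \<open>auto dest!: Apply.IH(2,4) sexp_list_Num_inject\<close>) next
  case If_true from If_true.prems show ?case
    by (rule eval_cases(12)) (use If_true.hyps in \<open>auto dest!: If_true.IH(2,4)\<close>) next
  case If_false from If_false.prems show ?case
    by (rule eval_cases(12)) (use If_false.hyps in \<open>auto dest!: If_false.IH(2,4)\<close>) next
  case Let from Let.prems show ?case
    by (rule eval_cases(13)) (auto dest!: Let.IH(2) dest: Let.IH(4)) next
  case Call from Call.prems show ?case
    by (rule eval_cases(14)) (auto dest!: Call.IH(2) dest: Call.IH(5)) next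
  case Nil then show ?case by (auto elim: eval_cases(15)) next
  case Args from Args.prems show ?case by (rule eval_cases(16)) (auto dest!: Args.IH(2,4))
qed

text \<open>
  Procedure 0 is the main one. Since subtrees may be shared during a computation, the
  running time includes the size of the output written out as a tree.
\<close>

definition computes_in_time :: "expr list \<Rightarrow> sexp \<Rightarrow> sexp \<Rightarrow> nat \<Rightarrow> bool" where
  "computes_in_time P x y T \<longleftrightarrow>
     (\<exists>t. eval P [x] (ECall 0 [EVar 0]) y t \<and> t + size y \<le> T)"


section \<open>Encoding of inputs and outputs\<close>

text \<open>
  The occurrence of a proposition records whether it belongs to the environment. Thus the
  encoding of the formulas contains all the information on \<open>\<X>\<close> and \<open>\<Y>\<close> that matters.
\<close>

definition encode_prop :: "nat set \<Rightarrow> nat \<Rightarrow> sexp" where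
  "encode_prop X p = Pair (sexp_bool (p \<in> X)) (Sym p)"

fun encode_ltl :: "nat set \<Rightarrow> ltl \<Rightarrow> sexp" where
  "encode_ltl X TT = sexp_list [Sym 0]"
| "encode_ltl X FF = sexp_list [Sym 1]"
| "encode_ltl X (Prop p) = sexp_list [Sym 2, encode_prop X p]"
| "encode_ltl X (Neg \<psi>) = sexp_list [Sym 3, encode_ltl X \<psi>]"
| "encode_ltl X (And \<psi>\<^sub>1 \<psi>\<^sub>2) = sexp_list [Sym 4, encode_ltl X \<psi>\<^sub>1, encode_ltl X \<psi>\<^sub>2]"
| "encode_ltl X (Or \<psi>\<^sub>1 \<psi>\<^sub>2) = sexp_list [Sym 5, encode_ltl X \<psi>\<^sub>1, encode_ltl X \<psi>\<^sub>2]"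
| "encode_ltl X (Next \<psi>) = sexp_list [Sym 6, encode_ltl X \<psi>]"
| "encode_ltl X (Until \<psi>\<^sub>1 \<psi>\<^sub>2) = sexp_list [Sym 7, encode_ltl X \<psi>\<^sub>1, encode_ltl X \<psi>\<^sub>2]"
| "encode_ltl X (Release \<psi>\<^sub>1 \<psi>\<^sub>2) = sexp_list [Sym 8, encode_ltl X \<psi>\<^sub>1, encode_ltl X \<psi>\<^sub>2]"

fun encode_qltl :: "nat set \<Rightarrow> qltl \<Rightarrow> sexp" where
  "encode_qltl X QTT = sexp_list [Sym 0]"
| "encode_qltl X QFF = sexp_list [Sym 1]"
| "encode_qltl X (QProp p) = sexp_list [Sym 2, encode_prop X p]"
| "encode_qltl X (QNeg \<psi>) = sexp_list [Sym 3, encode_qltl X \<psi>]"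
| "encode_qltl X (QAnd \<psi>\<^sub>1 \<psi>\<^sub>2) = sexp_list [Sym 4, encode_qltl X \<psi>\<^sub>1, encode_qltl X \<psi>\<^sub>2]"
| "encode_qltl X (QNext \<psi>) = sexp_list [Sym 6, encode_qltl X \<psi>]"
| "encode_qltl X (QUntil \<psi>\<^sub>1 \<psi>\<^sub>2) = sexp_list [Sym 7, encode_qltl X \<psi>\<^sub>1, encode_qltl X \<psi>\<^sub>2]"
| "encode_qltl X (QFun f \<psi>s) =
     sexp_list [Sym 9, Fn f, sexp_list (map (encode_qltl X) \<psi>s)]"

definition encode_problem :: "nat set \<Rightarrow> ltl \<Rightarrow> ltl \<Rightarrow> qltl \<Rightarrow> sexp" where
  "encode_problem X \<alpha>\<^sub>s \<alpha>\<^sub>c \<phi> =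
     sexp_list [encode_ltl X \<alpha>\<^sub>s, encode_ltl X \<alpha>\<^sub>c, encode_qltl X \<phi>]"

text \<open>States of an output transducer are themselves data, so no names have to be invented for them.\<close>

definition encode_transducer :: "sexp transducer \<Rightarrow> sexp" where
  "encode_transducer M = sexp_list
     [initial M,
      sexp_list (map Sym (observed M)),
      sexp_list (map (\<lambda>(q, A, B, e, q').
         sexp_list [q, sexp_list (map Sym A), sexp_list (map Sym B), sexp_bool e, q']) (table M))]"

end

theory Submission
  imports Defs
begin

text \<open>
  Reading a trace backwards, the values of all subformulas at a position are a function of the
  current letter and of the values at the next position, so there are at most exponentially many
  vectors of values. The map from the vector after a finite trace to the vector before it is a
  forward state of a deterministic automaton with at most doubly exponentially many states. The
  safe formula is violated as soon as its value with weak semantics at the end of the trace drops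
  to 0, and the co-safe one is satisfied as soon as its value with strong semantics reaches 1.

  For a threshold \<open>b\<close> the agent has to end with value at least \<open>b\<close>, to violate the safe formula,
  or to avoid satisfying the co-safe one forever. This is a reachability game followed by a safety
  game on the automaton. Because a strategy without finite traces has value 0, there must moreover
  be a play that stays in the winning region and ends; the strategy follows such plays for as long
  as the environment cooperates. The optimal value is the largest threshold for which all this is
  possible.
\<close>


section \<open>Evaluation with bounded calls\<close>

text \<open>Optimisation over arbitrary strategies reduces to finitely many threshold games. A
  guaranteed value is attained by some finite trace, so it is the value of a state, and only these
  values have to be tried; the strategy that ends after one letter shows that some threshold
  succeeds. Since the functions in \<open>F\<close> are arbitrary, finiteness comes from counting
  alone: a formula of length n takes at most 2^n values, there are at most N = 2^(n*n) vectors of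
  value trees, and at most N^N maps between them. A letter appended to the trace is the first one
  that a backward evaluation reads, so it acts on such a map by precomposition; this is what makes
  the automaton a forward one. The second half proves that a concrete program carries out the
  construction within the cost model. There \<open>B\<close> exceeds N^N and \<open>M\<close> is
  about n times N. Both \<open>M\<close> and the logarithm of \<open>B\<close> are singly
  exponential, so even \<open>B ^ M\<close> is doubly exponential. This slack allows costs to be
  tracked as integer exponents of \<open>B\<close> instead of exact running times.\<close>

definition cal :: "expr list \<Rightarrow> nat \<Rightarrow> nat \<Rightarrow> sexp list \<Rightarrow> sexp option" where
  "cal P C g vs =
     (if g < length P \<and> (\<exists>v. \<exists>t\<le>C. eval P vs (P ! g) v t)
      then Some (THE v. \<exists>t\<le>C. eval P vs (P ! g) v t) else None)"

text \<open>Determinism of \<open>eval\<close> makes the description in \<open>cal\<close> unique.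
  Calls thus become a partial function to rewrite with, and their cost survives only as an upper
  bound.\<close>

lemma cal_eq_Some:
  "cal P C g vs = Some v \<longleftrightarrow> g < length P \<and> (\<exists>t\<le>C. eval P vs (P ! g) v t)"
proof -
  have *: "(THE v. \<exists>t\<le>C. eval P vs (P ! g) v t) = v" if "\<exists>t\<le>C. eval P vs (P ! g) v t" for v
    using that by (intro the_equality) (auto dest: eval_deterministic)
  then show ?thesis
    unfolding cal_def by (auto dest: *)
qed

lemma cal_mono: "cal P C g vs = Some v \<Longrightarrow> C \<le> C' \<Longrightarrow> cal P C' g vs = Some v"
  unfolding cal_eq_Some using le_trans by blast

definition is_pair :: "sexp \<Rightarrow> bool" where
  "is_pair v \<longleftrightarrow> (\<exists>a b. v = Pair a b)"

text \<open>An application is charged one unit per argument; bounding the argument list keeps this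
  charge below the same \<open>C\<close> that bounds a call.\<close>

definition apply_fn :: "nat \<Rightarrow> (real list \<Rightarrow> real) \<Rightarrow> sexp \<Rightarrow> sexp option" where
  "apply_fn C f v =
     (if \<exists>rs. v = sexp_list (map Num rs) \<and> length rs \<le> C
      then Some (Num (f (THE rs. v = sexp_list (map Num rs)))) else None)"

lemma apply_fn_list: "length rs \<le> C \<Longrightarrow> apply_fn C f (sexp_list (map Num rs)) = Some (Num (f rs))"
proof -
  assume "length rs \<le> C"
  moreover have "(THE rs'. sexp_list (map Num rs) = sexp_list (map Num rs')) = rs"
    by (rule the_equality) (auto dest: sexp_list_Num_inject)
  ultimately show ?thesis unfolding apply_fn_def by auto
qed

text \<open>
  The value of an expression whose calls are answered by an oracle. Evaluating a procedure
  body becomes rewriting, and the cost is bounded through the number of nodes of the body.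
\<close>

fun den :: "(nat \<Rightarrow> sexp list \<Rightarrow> sexp option) \<Rightarrow> nat \<Rightarrow> sexp list \<Rightarrow> expr \<Rightarrow> sexp option" where
  "den c C \<rho> (EVar i) = (if i < length \<rho> then Some (\<rho> ! i) else None)"
| "den c C \<rho> (ESym n) = Some (Sym n)"
| "den c C \<rho> EOne = Some (Num 1)"
| "den c C \<rho> (ECons a b) =
     Option.bind (den c C \<rho> a) (\<lambda>x. Option.bind (den c C \<rho> b) (\<lambda>y. Some (Pair x y)))"
| "den c C \<rho> (EFst a) =
     Option.bind (den c C \<rho> a) (\<lambda>v. case v of Pair x y \<Rightarrow> Some x | _ \<Rightarrow> None)"
| "den c C \<rho> (ESnd a) =
     Option.bind (den c C \<rho> a) (\<lambda>v. case v of Pair x y \<Rightarrow> Some y | _ \<Rightarrow> None)"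
| "den c C \<rho> (EIsPair a) = Option.bind (den c C \<rho> a) (\<lambda>v. Some (sexp_bool (is_pair v)))"
| "den c C \<rho> (ESymEq a b) =
     Option.bind (den c C \<rho> a) (\<lambda>x. Option.bind (den c C \<rho> b)
       (\<lambda>y. Some (sexp_bool (\<exists>n. x = Sym n \<and> y = Sym n))))"
| "den c C \<rho> (ELeq a b) =
     Option.bind (den c C \<rho> a) (\<lambda>x. Option.bind (den c C \<rho> b)
       (\<lambda>y. case x of Num r \<Rightarrow> (case y of Num s \<Rightarrow> Some (sexp_bool (r \<le> s)) | _ \<Rightarrow> None)
            | _ \<Rightarrow> None))"
| "den c C \<rho> (ECompl a) =
     Option.bind (den c C \<rho> a) (\<lambda>v. case v of Num r \<Rightarrow> Some (Num (1 - r)) | _ \<Rightarrow> None)"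
| "den c C \<rho> (EApply a b) =
     Option.bind (den c C \<rho> a) (\<lambda>x. Option.bind (den c C \<rho> b)
       (\<lambda>y. case x of Fn f \<Rightarrow> apply_fn C f y | _ \<Rightarrow> None))"
| "den c C \<rho> (EIf a b d) =
     Option.bind (den c C \<rho> a) (\<lambda>v. if v = Sym 0 then den c C \<rho> d else den c C \<rho> b)"
| "den c C \<rho> (ELet a b) = Option.bind (den c C \<rho> a) (\<lambda>v. den c C (v # \<rho>) b)"
| "den c C \<rho> (ECall g es) = Option.bind (those (map (den c C \<rho>) es)) (c g)"

fun nodes :: "expr \<Rightarrow> nat" where
  "nodes (EVar i) = 1"
| "nodes (ESym n) = 1"
| "nodes EOne = 1"
| "nodes (ECons a b) = nodes a + nodes b + 1"
| "nodes (EFst a) = nodes a + 1"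
| "nodes (ESnd a) = nodes a + 1"
| "nodes (EIsPair a) = nodes a + 1"
| "nodes (ESymEq a b) = nodes a + nodes b + 1"
| "nodes (ELeq a b) = nodes a + nodes b + 1"
| "nodes (ECompl a) = nodes a + 1"
| "nodes (EApply a b) = nodes a + nodes b + 1"
| "nodes (EIf a b d) = nodes a + nodes b + nodes d + 1"
| "nodes (ELet a b) = nodes a + nodes b + 1"
| "nodes (ECall g es) = sum_list (map nodes es) + 1"

lemma case_sexp_eq_Some:
  "(case v of Pair x y \<Rightarrow> Some x | _ \<Rightarrow> None) = Some z \<longleftrightarrow> (\<exists>y. v = Pair z y)"
  "(case v of Pair x y \<Rightarrow> Some y | _ \<Rightarrow> None) = Some z \<longleftrightarrow> (\<exists>x. v = Pair x z)"
  "(case v of Num r \<Rightarrow> G r | _ \<Rightarrow> None) = Some z \<longleftrightarrow> (\<exists>r. v = Num r \<and> G r = Some z)"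
  "(case v of Fn f \<Rightarrow> H f | _ \<Rightarrow> None) = Some z \<longleftrightarrow> (\<exists>f. v = Fn f \<and> H f = Some z)"
  by (cases v; auto)+

lemma evals_those:
  assumes "\<And>e v. e \<in> set es \<Longrightarrow> d e = Some v \<Longrightarrow> \<exists>t\<le>nodes e * Suc C. eval P \<rho> e v t"
    and "those (map d es) = Some vs"
  shows "\<exists>t\<le>sum_list (map nodes es) * Suc C. evals P \<rho> es vs t"
  using assms
proof (induction es arbitrary: vs)
  case Nil
  then show ?case by (auto intro: eval_evals.Nil)
next
  case (Cons e es)
  from Cons.prems(2) obtain v ws where v: "d e = Some v" "those (map d es) = Some ws" "vs = v # ws"
    by (auto split: option.splits)
  from Cons.prems(1)[OF _ v(1)] obtain t where t: "t \<le> nodes e * Suc C" "eval P \<rho> e v t" by auto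
  from Cons.IH[OF _ v(2)] Cons.prems(1)
  obtain u where u: "u \<le> sum_list (map nodes es) * Suc C" "evals P \<rho> es ws u" by auto
  show ?case
    by (rule exI[of _ "t + u"]) (use t u v(3) in \<open>auto intro: eval_evals.Args simp: algebra_simps\<close>)
qed

text \<open>Each node of the expression is evaluated at most once. It pays one unit for itself and
  at most \<open>C\<close> for the call it makes or for the arguments of the function it
  applies.\<close>

lemma den_sound:
  "den (cal P C) C \<rho> e = Some v \<Longrightarrow> \<exists>t\<le>nodes e * Suc C. eval P \<rho> e v t"
proof (induction e arbitrary: \<rho> v)
  case (EVar i)
  then show ?case by (auto intro!: exI[of _ 1] eval_evals.Var split: if_splits)
next
  case (ESym n)
  then show ?case by (auto intro!: exI[of _ 1] eval_evals.Sym)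
next
  case EOne
  then show ?case by (auto intro!: exI[of _ 1] eval_evals.One)
next
  case (ECons a b)
  from ECons.prems obtain x y where "den (cal P C) C \<rho> a = Some x" "den (cal P C) C \<rho> b = Some y"
    and v: "v = Pair x y" by (auto simp: bind_eq_Some_conv)
  with ECons.IH obtain t u where "t \<le> nodes a * Suc C" "eval P \<rho> a x t"
    "u \<le> nodes b * Suc C" "eval P \<rho> b y u" by meson
  then show ?case unfolding v
    by (intro exI[of _ "t + u + 1"] conjI eval_evals.Cons) (auto simp: algebra_simps)
next
  case (EFst a)
  from EFst.prems obtain y where "den (cal P C) C \<rho> a = Some (Pair v y)"
    by (auto simp: bind_eq_Some_conv case_sexp_eq_Some)
  with EFst.IH obtain t where "t \<le> nodes a * Suc C" "eval P \<rho> a (Pair v y) t" by meson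
  then show ?case
    by (intro exI[of _ "t + 1"] conjI, simp add: algebra_simps) (rule eval_evals.Fst)
next
  case (ESnd a)
  from ESnd.prems obtain y where "den (cal P C) C \<rho> a = Some (Pair y v)"
    by (auto simp: bind_eq_Some_conv case_sexp_eq_Some)
  with ESnd.IH obtain t where "t \<le> nodes a * Suc C" "eval P \<rho> a (Pair y v) t" by meson
  then show ?case
    by (intro exI[of _ "t + 1"] conjI, simp add: algebra_simps) (rule eval_evals.Snd)
next
  case (EIsPair a)
  from EIsPair.prems obtain x where "den (cal P C) C \<rho> a = Some x" and v: "v = sexp_bool (is_pair x)"
    by (auto simp: bind_eq_Some_conv)
  with EIsPair.IH obtain t where "t \<le> nodes a * Suc C" "eval P \<rho> a x t" by meson
  then show ?case unfolding v is_pair_def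
    by (intro exI[of _ "t + 1"] conjI eval_evals.IsPair) (auto simp: algebra_simps)
next
  case (ESymEq a b)
  from ESymEq.prems obtain x y where "den (cal P C) C \<rho> a = Some x" "den (cal P C) C \<rho> b = Some y"
    and v: "v = sexp_bool (\<exists>n. x = Sym n \<and> y = Sym n)" by (auto simp: bind_eq_Some_conv)
  with ESymEq.IH obtain t u where "t \<le> nodes a * Suc C" "eval P \<rho> a x t"
    "u \<le> nodes b * Suc C" "eval P \<rho> b y u" by meson
  then show ?case unfolding v
    by (intro exI[of _ "t + u + 1"] conjI eval_evals.SymEq) (auto simp: algebra_simps)
next
  case (ELeq a b)
  from ELeq.prems obtain x y where "den (cal P C) C \<rho> a = Some (Num x)"
    "den (cal P C) C \<rho> b = Some (Num y)" and v: "v = sexp_bool (x \<le> y)"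
    by (auto simp: bind_eq_Some_conv case_sexp_eq_Some)
  with ELeq.IH obtain t u where "t \<le> nodes a * Suc C" "eval P \<rho> a (Num x) t"
    "u \<le> nodes b * Suc C" "eval P \<rho> b (Num y) u" by meson
  then show ?case unfolding v
    by (intro exI[of _ "t + u + 1"] conjI eval_evals.Leq) (auto simp: algebra_simps)
next
  case (ECompl a)
  from ECompl.prems obtain x where "den (cal P C) C \<rho> a = Some (Num x)" and v: "v = Num (1 - x)"
    by (auto simp: bind_eq_Some_conv case_sexp_eq_Some)
  with ECompl.IH obtain t where "t \<le> nodes a * Suc C" "eval P \<rho> a (Num x) t" by meson
  then show ?case unfolding v
    by (intro exI[of _ "t + 1"] conjI eval_evals.Compl) (auto simp: algebra_simps)
next
  case (EApply a b)
  from EApply.prems obtain f y where "den (cal P C) C \<rho> a = Some (Fn f)"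
    "den (cal P C) C \<rho> b = Some y" and *: "apply_fn C f y = Some v"
    by (auto simp: bind_eq_Some_conv case_sexp_eq_Some)
  with EApply.IH obtain t u where tu: "t \<le> nodes a * Suc C" "eval P \<rho> a (Fn f) t"
    "u \<le> nodes b * Suc C" "eval P \<rho> b y u" by meson
  from * obtain rs where rs: "y = sexp_list (map Num rs)" "length rs \<le> C"
    by (auto simp: apply_fn_def split: if_splits)
  with * have v: "v = Num (f rs)" by (simp add: apply_fn_list)
  show ?case unfolding v
    by (intro exI[of _ "t + u + length rs + 1"] conjI eval_evals.Apply[OF tu(2,4) rs(1)])
      (use tu rs in \<open>auto simp: algebra_simps\<close>)
next
  case (EIf a b d)
  from EIf.prems obtain x where x: "den (cal P C) C \<rho> a = Some x"
    and v: "(if x = Sym 0 then den (cal P C) C \<rho> d else den (cal P C) C \<rho> b) = Some v"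
    by (auto simp: bind_eq_Some_conv)
  from EIf.IH(1)[OF x] obtain t where t: "t \<le> nodes a * Suc C" "eval P \<rho> a x t" by blast
  show ?case
  proof (cases "x = Sym 0")
    case True
    with v EIf.IH(3) obtain u where "u \<le> nodes d * Suc C" "eval P \<rho> d v u" by fastforce
    with t True show ?thesis
      by (intro exI[of _ "t + u + 1"] conjI eval_evals.If_false[OF t(2)]) (auto simp: algebra_simps)
  next
    case False
    with v EIf.IH(2) obtain u where "u \<le> nodes b * Suc C" "eval P \<rho> b v u" by fastforce
    with t False show ?thesis
      by (intro exI[of _ "t + u + 1"] conjI eval_evals.If_true[OF t(2)]) (auto simp: algebra_simps)
  qed
next
  case (ELet a b)
  from ELet.prems obtain x where "den (cal P C) C \<rho> a = Some x" "den (cal P C) C (x # \<rho>) b = Some v"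
    by (auto simp: bind_eq_Some_conv)
  with ELet.IH obtain t u where "t \<le> nodes a * Suc C" "eval P \<rho> a x t"
    "u \<le> nodes b * Suc C" "eval P (x # \<rho>) b v u" by meson
  then show ?case
    by (intro exI[of _ "t + u + 1"] conjI, simp add: algebra_simps) (rule eval_evals.Let)
next
  case (ECall g es)
  from ECall.prems obtain vs where vs: "those (map (den (cal P C) C \<rho>) es) = Some vs"
    and "cal P C g vs = Some v"
    by (auto simp: bind_eq_Some_conv)
  then obtain u where u: "g < length P" "u \<le> C" "eval P vs (P ! g) v u" by (auto simp: cal_eq_Some)
  from evals_those[OF _ vs] ECall.IH
  obtain t where "t \<le> sum_list (map nodes es) * Suc C" "evals P \<rho> es vs t" by blast
  with u show ?case
    by (intro exI[of _ "t + u + 1"] conjI, simp add: algebra_simps) (rule eval_evals.Call)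
qed

lemma cal_body:
  "den (cal P C) C vs (P ! g) = Some v \<Longrightarrow> g < length P \<Longrightarrow> cal P (nodes (P ! g) * Suc C) g vs = Some v"
  unfolding cal_eq_Some using den_sound by blast

text \<open>The language is first-order, so a loop is a procedure \<open>h\<close> tied to one fixed
  step procedure \<open>g\<close>, and what a closure would capture travels in the first argument.
  The tail is processed before the head, hence the match with \<open>foldr\<close>.\<close>

definition fold_body :: "nat \<Rightarrow> nat \<Rightarrow> expr" where
  "fold_body h g = EIf (EIsPair (EVar 1))
     (ECall g [EVar 0, EFst (EVar 1), ECall h [EVar 0, ESnd (EVar 1), EVar 2]]) (EVar 2)"

text \<open>Iteration costs are added, not nested. 12 is the cost of one iteration apart from the
  step and the recursive call, 4 the cost of the empty list. The step is assumed only at splits of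
  the list, so that membership of \<open>x\<close> and the form of the accumulator are available
  when it is proved.\<close>

lemma cal_foldr:
  assumes P: "h < length P" "P ! h = fold_body h g"
    and step: "\<And>ys x zs. xs = ys @ x # zs \<Longrightarrow>
      cal P C g [env, ex x, ea (foldr f zs a)] = Some (ea (f x (foldr f zs a)))"
  shows "cal P (length xs * (C + 12) + 4) h [env, sexp_list (map ex xs), ea a] = Some (ea (foldr f xs a))"
  using step
proof (induction xs)
  case Nil
  let ?\<rho> = "[env, Sym 0, ea a]"
  have "eval P ?\<rho> (EVar 1) (?\<rho> ! 1) 1" "eval P ?\<rho> (EVar 2) (?\<rho> ! 2) 1"
    by (rule eval_evals.Var; simp)+
  from eval_evals.If_false[OF eval_evals.IsPair[OF this(1)] _ this(2)]
  show ?case using P unfolding cal_eq_Some fold_body_def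
    by (auto simp: sexp_bool_def intro!: exI[of _ 4] simp: numeral_eq_Suc)
next
  case (Cons x xs)
  have IH: "cal P (length xs * (C + 12) + 4) h [env, sexp_list (map ex xs), ea a] = Some (ea (foldr f xs a))"
    by (rule Cons.IH) (use Cons.prems[of "x # _"] in auto)
  from Cons.prems[of "[]"] have g: "cal P C g [env, ex x, ea (foldr f xs a)] = Some (ea (f x (foldr f xs a)))"
    by auto
  let ?\<rho> = "[env, Pair (ex x) (sexp_list (map ex xs)), ea a]"
  from IH obtain t where t: "t \<le> length xs * (C + 12) + 4"
    "eval P [env, sexp_list (map ex xs), ea a] (P ! h) (ea (foldr f xs a)) t"
    by (auto simp: cal_eq_Some)
  from g obtain u where u: "u \<le> C" "g < length P"
    "eval P [env, ex x, ea (foldr f xs a)] (P ! g) (ea (f x (foldr f xs a))) u"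
    by (auto simp: cal_eq_Some)
  have v: "eval P ?\<rho> (EVar 0) env 1" "eval P ?\<rho> (EVar 2) (ea a) 1"
    "eval P ?\<rho> (EVar 1) (Pair (ex x) (sexp_list (map ex xs))) 1"
    using eval_evals.Var[of 0 ?\<rho> P] eval_evals.Var[of 1 ?\<rho> P] eval_evals.Var[of 2 ?\<rho> P] by simp_all
  have h: "eval P ?\<rho> (ECall h [EVar 0, ESnd (EVar 1), EVar 2]) (ea (foldr f xs a))
      (1 + ((1 + 1) + (1 + 0)) + t + 1)"
    by (rule eval_evals.Call[OF _ P(1) t(2)])
      (intro eval_evals.Args eval_evals.Nil eval_evals.Snd[OF v(3)] v)
  have "eval P ?\<rho> (ECall g [EVar 0, EFst (EVar 1), ECall h [EVar 0, ESnd (EVar 1), EVar 2]])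
      (ea (f x (foldr f xs a))) (1 + ((1 + 1) + ((1 + ((1 + 1) + (1 + 0)) + t + 1) + 0)) + u + 1)"
    by (rule eval_evals.Call[OF _ u(2,3)])
      (intro eval_evals.Args eval_evals.Nil eval_evals.Fst[OF v(3)] h v)
  from eval_evals.If_true[OF eval_evals.IsPair[OF v(3)] _ this, of "EVar 2"]
  have "eval P ?\<rho> (P ! h) (ea (f x (foldr f xs a))) (1 + 1 + (1 + ((1 + 1) + ((1 + ((1 + 1) + (1 + 0)) + t + 1) + 0)) + u + 1) + 1)"
    by (simp add: P(2) fold_body_def sexp_bool_def)
  then have "cal P (length (x # xs) * (C + 12) + 4) h [env, sexp_list (map ex (x # xs)), ea a]
      = Some (ea (foldr f (x # xs) a))"
    unfolding cal_eq_Some using P(1) t(1) u(1)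
    by (intro conjI exI[where P = "\<lambda>t. t \<le> _ \<and> _ t"]) (simp_all add: algebra_simps)
  then show ?case .
qed


section \<open>Backward evaluation of formulas\<close>

text \<open>One syntax for both logics, so that evaluation, counting and the program are treated
  only once. The Boolean of \<open>OProp\<close> tells whether the environment owns the proposition,
  as in the input encoding.\<close>

datatype oper =
    OTrue | OFalse | OProp bool nat | ONeg | OAnd | OOr | ONext | OUntil | ORelease
  | OFun "real list \<Rightarrow> real"

datatype fm = Fm oper "fm list"

fun fm_of_ltl :: "nat set \<Rightarrow> ltl \<Rightarrow> fm" where
  "fm_of_ltl X TT = Fm OTrue []"
| "fm_of_ltl X FF = Fm OFalse []"
| "fm_of_ltl X (Prop p) = Fm (OProp (p \<in> X) p) []"
| "fm_of_ltl X (Neg \<psi>) = Fm ONeg [fm_of_ltl X \<psi>]"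
| "fm_of_ltl X (And \<psi>\<^sub>1 \<psi>\<^sub>2) = Fm OAnd [fm_of_ltl X \<psi>\<^sub>1, fm_of_ltl X \<psi>\<^sub>2]"
| "fm_of_ltl X (Or \<psi>\<^sub>1 \<psi>\<^sub>2) = Fm OOr [fm_of_ltl X \<psi>\<^sub>1, fm_of_ltl X \<psi>\<^sub>2]"
| "fm_of_ltl X (Next \<psi>) = Fm ONext [fm_of_ltl X \<psi>]"
| "fm_of_ltl X (Until \<psi>\<^sub>1 \<psi>\<^sub>2) = Fm OUntil [fm_of_ltl X \<psi>\<^sub>1, fm_of_ltl X \<psi>\<^sub>2]"
| "fm_of_ltl X (Release \<psi>\<^sub>1 \<psi>\<^sub>2) = Fm ORelease [fm_of_ltl X \<psi>\<^sub>1, fm_of_ltl X \<psi>\<^sub>2]"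

fun fm_of_qltl :: "nat set \<Rightarrow> qltl \<Rightarrow> fm" where
  "fm_of_qltl X QTT = Fm OTrue []"
| "fm_of_qltl X QFF = Fm OFalse []"
| "fm_of_qltl X (QProp p) = Fm (OProp (p \<in> X) p) []"
| "fm_of_qltl X (QNeg \<psi>) = Fm ONeg [fm_of_qltl X \<psi>]"
| "fm_of_qltl X (QAnd \<psi>\<^sub>1 \<psi>\<^sub>2) = Fm OAnd [fm_of_qltl X \<psi>\<^sub>1, fm_of_qltl X \<psi>\<^sub>2]"
| "fm_of_qltl X (QNext \<psi>) = Fm ONext [fm_of_qltl X \<psi>]"
| "fm_of_qltl X (QUntil \<psi>\<^sub>1 \<psi>\<^sub>2) = Fm OUntil [fm_of_qltl X \<psi>\<^sub>1, fm_of_qltl X \<psi>\<^sub>2]"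
| "fm_of_qltl X (QFun f \<psi>s) = Fm (OFun f) (map (fm_of_qltl X) \<psi>s)"

fun fm_len :: "fm \<Rightarrow> nat" where
  "fm_len (Fm q cs) = 1 + sum_list (map fm_len cs)"

lemma fm_len_of_ltl: "fm_len (fm_of_ltl X \<alpha>) = ltl_length \<alpha>"
  by (induction \<alpha>) auto

lemma fm_len_of_qltl: "fm_len (fm_of_qltl X \<phi>) = qltl_length \<phi>"
proof (induction \<phi>)
  case (QFun f \<psi>s)
  then have "map (fm_len \<circ> fm_of_qltl X) \<psi>s = map qltl_length \<psi>s" by simp
  then show ?case by (simp only: fm_of_qltl.simps fm_len.simps qltl_length.simps map_map)
qed auto

fun arity_ok :: "oper \<Rightarrow> nat \<Rightarrow> bool" where
  "arity_ok ONeg k \<longleftrightarrow> k = 1"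
| "arity_ok ONext k \<longleftrightarrow> k = 1"
| "arity_ok OAnd k \<longleftrightarrow> k = 2"
| "arity_ok OOr k \<longleftrightarrow> k = 2"
| "arity_ok OUntil k \<longleftrightarrow> k = 2"
| "arity_ok ORelease k \<longleftrightarrow> k = 2"
| "arity_ok (OFun f) k \<longleftrightarrow> True"
| "arity_ok _ k \<longleftrightarrow> k = 0"

fun wf_fm :: "fm \<Rightarrow> bool" where
  "wf_fm (Fm q cs) \<longleftrightarrow> arity_ok q (length cs) \<and> (\<forall>c\<in>set cs. wf_fm c)"

lemma wf_fm_of_ltl: "wf_fm (fm_of_ltl X \<alpha>)"
  by (induction \<alpha>) auto

lemma wf_fm_of_qltl: "wf_fm (fm_of_qltl X \<phi>)"
  by (induction \<phi>) auto

fun occs :: "fm \<Rightarrow> (bool \<times> nat) list" where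
  "occs (Fm q cs) = (case q of OProp b p \<Rightarrow> [(b, p)] | _ \<Rightarrow> concat (map occs cs))"

lemma set_occs_ltl: "set (occs (fm_of_ltl X \<alpha>)) = (\<lambda>p. (p \<in> X, p)) ` ltl_props \<alpha>"
  by (induction \<alpha>) auto

lemma set_occs_qltl: "set (occs (fm_of_qltl X \<phi>)) = (\<lambda>p. (p \<in> X, p)) ` qltl_props \<phi>"
  by (induction \<phi>) auto

lemma length_occs: "length (occs \<phi>) \<le> fm_len \<phi>"
proof (induction \<phi>)
  case (Fm q cs)
  then have "sum_list (map (length \<circ> occs) cs) \<le> sum_list (map fm_len cs)"
    by (intro sum_list_mono) auto
  then show ?case by (cases q) (auto simp: length_concat)
qed

text \<open>Values are arranged like the formula itself, one per occurrence of a subformula, so that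
  no numbering of subformulas is required.\<close>

datatype vt = VT (root: real) (subs: "vt list")

text \<open>
  \<open>ws\<close>: the values of the arguments at the current position; \<open>us\<close> and \<open>u\<close>: the values of the
  arguments and of the formula itself at the next one.
\<close>

fun opval :: "oper \<Rightarrow> nat set \<Rightarrow> real list \<Rightarrow> real list \<Rightarrow> real \<Rightarrow> real" where
  "opval OTrue a ws us u = 1"
| "opval OFalse a ws us u = 0"
| "opval (OProp b p) a ws us u = (if p \<in> a then 1 else 0)"
| "opval ONeg a ws us u = 1 - ws ! 0"
| "opval OAnd a ws us u = min (ws ! 0) (ws ! 1)"
| "opval OOr a ws us u = max (ws ! 0) (ws ! 1)"
| "opval ONext a ws us u = us ! 0"
| "opval OUntil a ws us u = max (ws ! 1) (min (ws ! 0) u)"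
| "opval ORelease a ws us u = min (ws ! 1) (max (ws ! 0) u)"
| "opval (OFun f) a ws us u = f ws"

text \<open>The children are turned into functions before they meet the trees: the recursive calls
  then range over members of \<open>cs\<close> under \<open>map\<close>, whose congruence rule
  serves the termination proof.\<close>

fun step :: "nat set \<Rightarrow> fm \<Rightarrow> vt \<Rightarrow> vt" where
  "step a (Fm q cs) t =
     (let ws = map2 (\<lambda>f t. f t) (map (step a) cs) (subs t)
      in VT (opval q a (map root ws) (map root (subs t)) (root t)) ws)"

declare step.simps[simp del]

text \<open>
  The values beyond the end of a trace: \<open>z = 0\<close> gives the strong semantics of \<open>X\<close> and \<open>U\<close>,
  \<open>z = 1\<close> the weak semantics of \<open>X\<close> and \<open>R\<close>.
\<close>

fun ini :: "real \<Rightarrow> fm \<Rightarrow> vt" where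
  "ini z (Fm q cs) = VT z (map (ini z) cs)"

definition val :: "real \<Rightarrow> fm \<Rightarrow> nat set list \<Rightarrow> real" where
  "val z \<phi> u = root (foldr (\<lambda>a. step a \<phi>) u (ini z \<phi>))"

lemma map2_app_map: "map2 (\<lambda>f t. f t) (map g cs) (map h cs) = map (\<lambda>c. g c (h c)) cs"
  by (induction cs) auto

lemma subs_foldr_step:
  "subs (foldr (\<lambda>a. step a (Fm q cs)) u (ini z (Fm q cs))) =
     map (\<lambda>c. foldr (\<lambda>a. step a c) u (ini z c)) cs"
  by (induction u) (simp_all add: step.simps Let_def map2_app_map)

lemma val_Nil: "val z \<phi> [] = z"
  by (cases \<phi>) (simp add: val_def)

text \<open>Evaluation commutes with passing to an argument, so the expansion law can be stated
  without trees. All semantic proofs rest on this form.\<close>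

lemma val_Cons:
  "val z (Fm q cs) (a # u) =
     opval q a (map (\<lambda>c. val z c (a # u)) cs) (map (\<lambda>c. val z c u) cs) (val z (Fm q cs) u)"
  unfolding val_def foldr_Cons o_apply
  by (subst step.simps)
    (simp only: Let_def subs_foldr_step map2_app_map vt.sel map_map o_def)

lemma step_cong:
  "(\<And>b p. (b, p) \<in> set (occs \<phi>) \<Longrightarrow> p \<in> a \<longleftrightarrow> p \<in> a') \<Longrightarrow> wf_fm \<phi> \<Longrightarrow> step a \<phi> t = step a' \<phi> t"
proof (induction \<phi> arbitrary: t)
  case (Fm q cs)
  have "map (step a) cs = map (step a') cs"
  \<comment> \<open>\<open>occs\<close> does not descend below a proposition; in that case
    well-formedness leaves no children.\<close>
  proof (cases "\<exists>b p. q = OProp b p")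
    case False
    then have "set (occs (Fm q cs)) = (\<Union>c\<in>set cs. set (occs c))" by (cases q) auto
    then show ?thesis using Fm by (fastforce simp: fun_eq_iff)
  qed (use Fm.prems in auto)
  moreover have "opval q a ws us u = opval q a' ws us u" for ws us u
    using Fm.prems by (cases q) auto
  ultimately show ?case by (simp only: step.simps)
qed

text \<open>The index \<open>i\<close> contributes \<open>g i\<close>. From all later indices
  \<open>f i\<close> can be pulled out, since the minimum with a constant is monotone and so
  commutes with a maximum over a nonempty set. Past the end the value 0 does no harm,
  \<open>g i\<close> being nonnegative.\<close>

lemma Max_Min_unroll:
  fixes f g :: "nat \<Rightarrow> real" and n :: nat
  defines "M \<equiv> \<lambda>i. MAX k\<in>{i..<n}. Min (insert (g k) (f ` {i..<k}))"
  assumes "i < n" "0 \<le> g i"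
  shows "M i = max (g i) (min (f i) (if Suc i < n then M (Suc i) else 0))"
proof (cases "Suc i < n")
  case True
  let ?h = "\<lambda>i k. Min (insert (g k) (f ` {i..<k}))"
  have eq: "{i..<n} = insert i {Suc i..<n}" using assms by auto
  have h: "?h i k = min (f i) (?h (Suc i) k)" if "k \<in> {Suc i..<n}" for k
  proof -
    have "{i..<k} = insert i {Suc i..<k}" using that by auto
    then have "insert (g k) (f ` {i..<k}) = insert (f i) (insert (g k) (f ` {Suc i..<k}))" by auto
    then show ?thesis by (simp only:) (rule Min_insert, auto)
  qed
  have "M i = max (?h i i) (Max (?h i ` {Suc i..<n}))"
    unfolding M_def eq using True by (simp add: Max_insert)
  also have "?h i ` {Suc i..<n} = min (f i) ` ?h (Suc i) ` {Suc i..<n}"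
    unfolding image_image using h by (intro image_cong) auto
  also have "Max \<dots> = min (f i) (M (Suc i))"
    unfolding M_def by (rule mono_Max_commute[symmetric]) (use True in \<open>auto simp: mono_def\<close>)
  finally show ?thesis using True by simp
next
  case False
  then have "{i..<n} = {i}" using assms by auto
  then show ?thesis using False assms(3) by (simp add: M_def)
qed

text \<open>The range is carried along because the unrolling of until wants a nonnegative second
  argument, and because \<open>unit_functions\<close> bounds a function only on arguments from
  [0,1].\<close>

lemma val_qltl:
  assumes "unit_functions F" "qltl_over F \<phi>" "i < length \<pi>"
  shows "val 0 (fm_of_qltl X \<phi>) (drop i \<pi>) = qltl_val \<pi> i \<phi> \<and> qltl_val \<pi> i \<phi> \<in> {0..1}"
  using assms(2,3)
proof (induction \<phi> arbitrary: i)
  case (QUntil \<psi>\<^sub>1 \<psi>\<^sub>2)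
  \<comment> \<open>Until refers to itself at the next position, so the structural induction is
    supplemented by one on the distance to the last position.\<close>
  have *: "val 0 (fm_of_qltl X (QUntil \<psi>\<^sub>1 \<psi>\<^sub>2)) (drop i \<pi>) = qltl_val \<pi> i (QUntil \<psi>\<^sub>1 \<psi>\<^sub>2) \<and>
      qltl_val \<pi> i (QUntil \<psi>\<^sub>1 \<psi>\<^sub>2) \<in> {0..1}" if "n = length \<pi> - Suc i" "i < length \<pi>" for n
    using that
  proof (induction n arbitrary: i)
    case 0
    then have i: "\<not> Suc i < length \<pi>" "drop (Suc i) \<pi> = []" by auto
    have v: "val 0 (fm_of_qltl X \<psi>\<^sub>1) (drop i \<pi>) = qltl_val \<pi> i \<psi>\<^sub>1" "0 \<le> qltl_val \<pi> i \<psi>\<^sub>1" "qltl_val \<pi> i \<psi>\<^sub>1 \<le> 1"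
      "val 0 (fm_of_qltl X \<psi>\<^sub>2) (drop i \<pi>) = qltl_val \<pi> i \<psi>\<^sub>2" "0 \<le> qltl_val \<pi> i \<psi>\<^sub>2" "qltl_val \<pi> i \<psi>\<^sub>2 \<le> 1"
      using QUntil.IH QUntil.prems(1) 0 by auto
    show ?case
      using v i unfolding qltl_val.simps fm_of_qltl.simps Max_Min_unroll[of i "length \<pi>" "\<lambda>j. qltl_val \<pi> j \<psi>\<^sub>2", OF 0(2) v(5)]
        Cons_nth_drop_Suc[OF 0(2), symmetric] val_Cons
      by (simp add: val_Nil)
  next
    case (Suc n)
    then have i: "Suc i < length \<pi>" by auto
    have v: "val 0 (fm_of_qltl X \<psi>\<^sub>1) (drop i \<pi>) = qltl_val \<pi> i \<psi>\<^sub>1" "0 \<le> qltl_val \<pi> i \<psi>\<^sub>1" "qltl_val \<pi> i \<psi>\<^sub>1 \<le> 1"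
      "val 0 (fm_of_qltl X \<psi>\<^sub>2) (drop i \<pi>) = qltl_val \<pi> i \<psi>\<^sub>2" "0 \<le> qltl_val \<pi> i \<psi>\<^sub>2" "qltl_val \<pi> i \<psi>\<^sub>2 \<le> 1"
      using QUntil.IH QUntil.prems(1) Suc.prems(2) by auto
    have "n = length \<pi> - Suc (Suc i)" using Suc.prems by simp
    from Suc.IH[OF this i]
    have u: "val 0 (fm_of_qltl X (QUntil \<psi>\<^sub>1 \<psi>\<^sub>2)) (drop (Suc i) \<pi>) = qltl_val \<pi> (Suc i) (QUntil \<psi>\<^sub>1 \<psi>\<^sub>2)"
      "0 \<le> qltl_val \<pi> (Suc i) (QUntil \<psi>\<^sub>1 \<psi>\<^sub>2)" "qltl_val \<pi> (Suc i) (QUntil \<psi>\<^sub>1 \<psi>\<^sub>2) \<le> 1" by auto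
    have "qltl_val \<pi> i (QUntil \<psi>\<^sub>1 \<psi>\<^sub>2) =
        max (qltl_val \<pi> i \<psi>\<^sub>2) (min (qltl_val \<pi> i \<psi>\<^sub>1) (qltl_val \<pi> (Suc i) (QUntil \<psi>\<^sub>1 \<psi>\<^sub>2)))"
      using Max_Min_unroll[of i "length \<pi>" "\<lambda>j. qltl_val \<pi> j \<psi>\<^sub>2" "\<lambda>j. qltl_val \<pi> j \<psi>\<^sub>1", OF Suc.prems(2) v(5)] i
      by simp
    moreover have "val 0 (fm_of_qltl X (QUntil \<psi>\<^sub>1 \<psi>\<^sub>2)) (drop i \<pi>) = \<dots>"
      using v u(1) unfolding Cons_nth_drop_Suc[OF Suc.prems(2), symmetric] fm_of_qltl.simps val_Cons
      by simp
    ultimately show ?case using v u by (auto simp: min_def max_def)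
  qed
  show ?case by (rule *[OF refl QUntil.prems(2)])
next
  case (QFun f \<psi>s)
  have IH: "val 0 (fm_of_qltl X \<psi>) (drop i \<pi>) = qltl_val \<pi> i \<psi> \<and> qltl_val \<pi> i \<psi> \<in> {0..1}"
    if "\<psi> \<in> set \<psi>s" for \<psi>
    using QFun that by auto
  have "map (\<lambda>\<psi>. val 0 (fm_of_qltl X \<psi>) (drop i \<pi>)) \<psi>s = map (qltl_val \<pi> i) \<psi>s" using IH by auto
  then have "val 0 (fm_of_qltl X (QFun f \<psi>s)) (drop i \<pi>) = qltl_val \<pi> i (QFun f \<psi>s)"
    unfolding Cons_nth_drop_Suc[OF QFun.prems(2), symmetric] fm_of_qltl.simps val_Cons
    by (simp only: opval.simps qltl_val.simps map_map o_def)
  moreover have "(length \<psi>s, f) \<in> F" using QFun.prems by simp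
  then have "f (map (qltl_val \<pi> i) \<psi>s) \<in> {0..1}"
    using assms(1) IH unfolding unit_functions_def
    by (auto dest!: bspec[of F _ "(length \<psi>s, f)"] spec[of _ "map (qltl_val \<pi> i) \<psi>s"])
  ultimately show ?case by simp
next
  case (QNext \<psi>)
  then show ?case
    unfolding Cons_nth_drop_Suc[OF QNext.prems(2), symmetric] fm_of_qltl.simps val_Cons
    by (cases "Suc i < length \<pi>") (auto simp: val_Nil)
next
  case (QNeg \<psi>)
  then have "val 0 (fm_of_qltl X \<psi>) (drop i \<pi>) = qltl_val \<pi> i \<psi> \<and> qltl_val \<pi> i \<psi> \<in> {0..1}" by auto
  then show ?case
    unfolding Cons_nth_drop_Suc[OF QNeg.prems(2), symmetric] fm_of_qltl.simps val_Cons by auto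
next
  case (QAnd \<psi>\<^sub>1 \<psi>\<^sub>2)
  then have "val 0 (fm_of_qltl X \<psi>\<^sub>1) (drop i \<pi>) = qltl_val \<pi> i \<psi>\<^sub>1 \<and> qltl_val \<pi> i \<psi>\<^sub>1 \<in> {0..1}"
    "val 0 (fm_of_qltl X \<psi>\<^sub>2) (drop i \<pi>) = qltl_val \<pi> i \<psi>\<^sub>2 \<and> qltl_val \<pi> i \<psi>\<^sub>2 \<in> {0..1}" by auto
  then show ?case
    unfolding Cons_nth_drop_Suc[OF QAnd.prems(2), symmetric] fm_of_qltl.simps val_Cons by auto
qed (auto simp: Cons_nth_drop_Suc[symmetric] val_Cons)

section \<open>Finite prefixes that decide co-safe and safe formulas\<close>

fun seg :: "'a word \<Rightarrow> nat \<Rightarrow> nat \<Rightarrow> 'a list" where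
  "seg w i 0 = []"
| "seg w i (Suc n) = w i # seg w (Suc i) n"

text \<open>\<open>seg\<close> grows at the front and carries a starting position, as
  \<open>val_Cons\<close> and the inductions over positions demand; here it is tied back to ordinary
  prefixes.\<close>

lemma seg_eq_prefix: "seg w 0 n = prefix n w"
proof -
  have "seg w i n = map w [i..<i + n]" for i
    by (induction n arbitrary: i) (auto simp: upt_rec)
  then show ?thesis by (simp add: subsequence_def)
qed

lemma ltl_sem_Until_unroll:
  "ltl_sem \<pi> i (Until a b) \<longleftrightarrow> ltl_sem \<pi> i b \<or> ltl_sem \<pi> i a \<and> ltl_sem \<pi> (Suc i) (Until a b)"
    (is "?l \<longleftrightarrow> ?r")
proof
  assume ?l
  then obtain k where k: "k \<ge> i" "ltl_sem \<pi> k b" "\<forall>j\<in>{i..<k}. ltl_sem \<pi> j a" by auto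
  then show ?r by (cases "k = i") (auto intro!: exI[of _ k])
next
  assume ?r
  then consider "ltl_sem \<pi> i b"
    | k where "ltl_sem \<pi> i a" "k \<ge> Suc i" "ltl_sem \<pi> k b" "\<forall>j\<in>{Suc i..<k}. ltl_sem \<pi> j a"
    by auto
  then show ?l
  proof cases
    case 2
    moreover from this have "\<forall>j\<in>{i..<k}. ltl_sem \<pi> j a"
      by (metis atLeastLessThan_iff le_antisym not_less_eq_eq)
    ultimately show ?thesis by (auto intro!: exI[of _ k])
  qed auto
qed

lemma val_cosafe_01:
  assumes "cosafe \<alpha>"
  shows "val 0 (fm_of_ltl X \<alpha>) u \<in> {0, 1}"
  using assms
proof (induction arbitrary: u)
  case (8 \<psi>\<^sub>1 \<psi>\<^sub>2)
  show ?case
  proof (induction u)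
    case (Cons a u)
    then show ?case using 8(3,4)[of "a # u"] by (auto simp: val_Cons)
  qed (simp add: val_Nil)
next
  case (5 \<psi>\<^sub>1 \<psi>\<^sub>2) show ?case using 5(3,4)[of u] by (cases u) (auto simp: val_Nil val_Cons)
next
  case (6 \<psi>\<^sub>1 \<psi>\<^sub>2) show ?case using 6(3,4)[of u] by (cases u) (auto simp: val_Nil val_Cons)
next
  case (7 \<psi>) then show ?case by (cases u) (auto simp: val_Nil val_Cons)
next
  case 1 then show ?case by (cases u) (auto simp: val_Nil val_Cons)
next
  case 2 then show ?case by (cases u) (auto simp: val_Nil val_Cons)
next
  case 3 then show ?case by (cases u) (auto simp: val_Nil val_Cons)
next
  case 4 then show ?case by (cases u) (auto simp: val_Nil val_Cons)
qed

text \<open>Negation is confined to propositions and all other operators are monotone. As the value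
  0 beyond the end is the least one, replacing the end by a further letter can only raise the
  result.\<close>

lemma val_cosafe_mono_Suc:
  assumes "cosafe \<alpha>"
  shows "val 0 (fm_of_ltl X \<alpha>) (seg w i n) \<le> val 0 (fm_of_ltl X \<alpha>) (seg w i (Suc n))"
  using assms
proof (induction arbitrary: i n)
  case (8 \<psi>\<^sub>1 \<psi>\<^sub>2)
  show ?case
  proof (induction n arbitrary: i)
    case 0
    then show ?case using val_cosafe_01[OF cosafe.intros(8)[OF 8(1,2)], of X "seg w i 1"]
      by (auto simp: val_Nil)
  next
    case (Suc n)
    from 8(3,4)[of i "Suc n"] Suc[of "Suc i"] show ?case by (auto simp: val_Cons min_def max_def)
  qed
next
  case (5 \<psi>\<^sub>1 \<psi>\<^sub>2)
  then show ?case using 5(3,4)[of i n] val_cosafe_01[OF cosafe.intros(5)[OF 5(1,2)], of X "seg w i 1"]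
    by (cases n) (auto simp: val_Nil val_Cons min_def max_def)
next
  case (6 \<psi>\<^sub>1 \<psi>\<^sub>2)
  then show ?case using 6(3,4)[of i n] val_cosafe_01[OF cosafe.intros(6)[OF 6(1,2)], of X "seg w i 1"]
    by (cases n) (auto simp: val_Nil val_Cons min_def max_def)
next
  case (7 \<psi>)
  then show ?case by (cases n) (auto simp: val_Nil val_Cons)
next
  case 1 then show ?case by (cases n) (auto simp: val_Nil val_Cons)
next
  case 2 then show ?case by (cases n) (auto simp: val_Nil val_Cons)
next
  case 3 then show ?case by (cases n) (auto simp: val_Nil val_Cons)
next
  case 4 then show ?case by (cases n) (auto simp: val_Nil val_Cons)
qed

lemma val_cosafe_mono:
  assumes "cosafe \<alpha>" "n \<le> m" "val 0 (fm_of_ltl X \<alpha>) (seg w i n) = 1"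
  shows "val 0 (fm_of_ltl X \<alpha>) (seg w i m) = 1"
proof -
  have "val 0 (fm_of_ltl X \<alpha>) (seg w i n) \<le> val 0 (fm_of_ltl X \<alpha>) (seg w i m)"
    by (rule lift_Suc_mono_le[of "\<lambda>n. val 0 (fm_of_ltl X \<alpha>) (seg w i n)"])
      (rule val_cosafe_mono_Suc[OF assms(1)] assms(2))+
  then show ?thesis using assms(3) val_cosafe_01[OF assms(1), of X "seg w i m"] by auto
qed

text \<open>A co-safe formula is satisfied through finitely many positions. Monotonicity replaces
  the prefixes that witness several subformulas by a common longer one.\<close>

lemma cosafe_iff_prefix:
  assumes "cosafe \<alpha>"
  shows "ltl_sem w i \<alpha> \<longleftrightarrow> (\<exists>n. val 0 (fm_of_ltl X \<alpha>) (seg w i n) = 1)"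
  using assms
proof (induction arbitrary: i)
  case 1 then show ?case by (auto intro!: exI[of _ 1] simp: val_Cons)
next
  case 2
  have "val 0 (fm_of_ltl X FF) (seg w i n) \<noteq> 1" for n by (cases n) (auto simp: val_Cons val_Nil)
  then show ?case by auto
next
  case (3 p)
  have "val 0 (fm_of_ltl X (Prop p)) (seg w i n) = 1 \<longleftrightarrow> n \<noteq> 0 \<and> p \<in> w i" for n
    by (cases n) (auto simp: val_Cons val_Nil)
  then show ?case by auto
next
  case (4 p)
  have "val 0 (fm_of_ltl X (Neg (Prop p))) (seg w i n) = 1 \<longleftrightarrow> n \<noteq> 0 \<and> p \<notin> w i" for n
    by (cases n) (auto simp: val_Cons val_Nil)
  then show ?case by auto
next
  case (5 \<psi>\<^sub>1 \<psi>\<^sub>2)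
  have *: "val 0 (fm_of_ltl X (And \<psi>\<^sub>1 \<psi>\<^sub>2)) (seg w i n) = 1 \<longleftrightarrow>
      val 0 (fm_of_ltl X \<psi>\<^sub>1) (seg w i n) = 1 \<and> val 0 (fm_of_ltl X \<psi>\<^sub>2) (seg w i n) = 1" for n
    using val_cosafe_01[OF 5(1), of X "seg w i n"] val_cosafe_01[OF 5(2), of X "seg w i n"]
    by (cases n) (auto simp: val_Nil val_Cons)
  show ?case unfolding * ltl_sem.simps 5(3,4)
    using val_cosafe_mono[OF 5(1), of _ _ X w i] val_cosafe_mono[OF 5(2), of _ _ X w i]
    by (metis nat_le_linear)
next
  case (6 \<psi>\<^sub>1 \<psi>\<^sub>2)
  have *: "val 0 (fm_of_ltl X (Or \<psi>\<^sub>1 \<psi>\<^sub>2)) (seg w i n) = 1 \<longleftrightarrow>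
      val 0 (fm_of_ltl X \<psi>\<^sub>1) (seg w i n) = 1 \<or> val 0 (fm_of_ltl X \<psi>\<^sub>2) (seg w i n) = 1" for n
    using val_cosafe_01[OF 6(1), of X "seg w i n"] val_cosafe_01[OF 6(2), of X "seg w i n"]
    by (cases n) (auto simp: val_Nil val_Cons)
  show ?case unfolding * ltl_sem.simps 6(3,4) by blast
next
  case (7 \<psi>)
  have *: "val 0 (fm_of_ltl X (Next \<psi>)) (seg w i n) = 1 \<longleftrightarrow>
      (\<exists>m. n = Suc m \<and> val 0 (fm_of_ltl X \<psi>) (seg w (Suc i) m) = 1)" for n
    by (cases n) (auto simp: val_Nil val_Cons)
  show ?case unfolding * ltl_sem.simps 7(2) by blast
next
  case (8 \<psi>\<^sub>1 \<psi>\<^sub>2)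
  let ?U = "Until \<psi>\<^sub>1 \<psi>\<^sub>2"
  have *: "val 0 (fm_of_ltl X ?U) (seg w i n) = 1 \<longleftrightarrow> (\<exists>m. n = Suc m \<and>
      (val 0 (fm_of_ltl X \<psi>\<^sub>2) (seg w i n) = 1 \<or>
       val 0 (fm_of_ltl X \<psi>\<^sub>1) (seg w i n) = 1 \<and> val 0 (fm_of_ltl X ?U) (seg w (Suc i) m) = 1))" for i n
    using val_cosafe_01[OF 8(1), of X "seg w i n"] val_cosafe_01[OF 8(2), of X "seg w i n"]
      val_cosafe_01[OF cosafe.intros(8)[OF 8(1,2)], of X "seg w (Suc i) (n - 1)"]
    by (cases n) (auto simp: val_Nil val_Cons)
  have **: "val 0 (fm_of_ltl X \<psi>) (seg w i (Suc n)) = 1" if "cosafe \<psi>" "val 0 (fm_of_ltl X \<psi>) (seg w i n) = 1" for \<psi> i n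
    using val_cosafe_mono[OF that(1) _ that(2), of "Suc n"] by simp
  show ?case
  proof
    assume "ltl_sem w i ?U"
    then obtain k where "k \<ge> i" "ltl_sem w k \<psi>\<^sub>2" "\<forall>j\<in>{i..<k}. ltl_sem w j \<psi>\<^sub>1" by auto
    then show "\<exists>n. val 0 (fm_of_ltl X ?U) (seg w i n) = 1"
    proof (induction "k - i" arbitrary: i)
      case 0
      then obtain n where "val 0 (fm_of_ltl X \<psi>\<^sub>2) (seg w i n) = 1" using 8(4) by auto
      then show ?case using **[OF 8(2)] * by blast
    next
      case (Suc d)
      then have "\<exists>n. val 0 (fm_of_ltl X ?U) (seg w (Suc i) n) = 1" by (intro Suc.hyps(1)) auto
      then obtain n where n: "val 0 (fm_of_ltl X ?U) (seg w (Suc i) n) = 1" ..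
      have "ltl_sem w i \<psi>\<^sub>1" using Suc by auto
      then obtain m where m: "val 0 (fm_of_ltl X \<psi>\<^sub>1) (seg w i m) = 1" using 8(3) by auto
      \<comment> \<open>The witnesses for the remaining until formula and for its first argument are
        prolonged to the same end position, so that the unrolling applies.\<close>
      have "val 0 (fm_of_ltl X ?U) (seg w (Suc i) (max n m)) = 1"
        by (rule val_cosafe_mono[OF cosafe.intros(8)[OF 8(1,2)] _ n]) simp
      moreover have "val 0 (fm_of_ltl X \<psi>\<^sub>1) (seg w i (Suc (max n m))) = 1"
        by (rule val_cosafe_mono[OF 8(1) _ m]) simp
      ultimately show ?case using * by blast
    qed
  next
    assume "\<exists>n. val 0 (fm_of_ltl X ?U) (seg w i n) = 1"
    then obtain n where "val 0 (fm_of_ltl X ?U) (seg w i n) = 1" ..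
    then show "ltl_sem w i ?U"
    proof (induction n arbitrary: i)
      case 0
      then show ?case by (simp add: val_Nil)
    next
      case (Suc n)
      then show ?case unfolding ltl_sem_Until_unroll[of w i] 8(3,4) using *[of i "Suc n"] by blast
    qed
  qed
qed

text \<open>The complement in negation normal form. It turns safe formulas into co-safe ones and so
  transfers the results on prefixes.\<close>

fun dual :: "ltl \<Rightarrow> ltl" where
  "dual TT = FF"
| "dual FF = TT"
| "dual (Prop p) = Neg (Prop p)"
| "dual (Neg \<psi>) = \<psi>"
| "dual (And a b) = Or (dual a) (dual b)"
| "dual (Or a b) = And (dual a) (dual b)"
| "dual (Next a) = Next (dual a)"
| "dual (Until a b) = Release (dual a) (dual b)"
| "dual (Release a b) = Until (dual a) (dual b)"

lemma cosafe_dual: "safe \<alpha> \<Longrightarrow> cosafe (dual \<alpha>)"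
  by (induction rule: safe.induct) (auto intro: cosafe.intros)

lemma ltl_sem_dual: "safe \<alpha> \<Longrightarrow> ltl_sem w i (dual \<alpha>) \<longleftrightarrow> \<not> ltl_sem w i \<alpha>"
  by (induction arbitrary: i rule: safe.induct) auto

text \<open>De Morgan at every operator: x to 1 - x exchanges minimum with maximum and the end value
  1 with 0, so weak semantics becomes strong semantics of the dual.\<close>

lemma val_dual:
  assumes "safe \<alpha>"
  shows "val 0 (fm_of_ltl X (dual \<alpha>)) u = 1 - val 1 (fm_of_ltl X \<alpha>) u"
  using assms
proof (induction arbitrary: u)
  case (8 \<psi>\<^sub>1 \<psi>\<^sub>2)
  show ?case
  proof (induction u)
    case (Cons a u)
    then show ?case using 8(3,4)[of "a # u"] by (auto simp: val_Cons min_def max_def)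
  qed (simp add: val_Nil)
next
  case (5 \<psi>\<^sub>1 \<psi>\<^sub>2)
  then show ?case using 5(3,4)[of u] by (cases u) (auto simp: val_Nil val_Cons min_def max_def)
next
  case (6 \<psi>\<^sub>1 \<psi>\<^sub>2)
  then show ?case using 6(3,4)[of u] by (cases u) (auto simp: val_Nil val_Cons min_def max_def)
next
  case (7 \<psi>) then show ?case by (cases u) (auto simp: val_Nil val_Cons)
next
  case 1 then show ?case by (cases u) (auto simp: val_Nil val_Cons)
next
  case 2 then show ?case by (cases u) (auto simp: val_Nil val_Cons)
next
  case 3 then show ?case by (cases u) (auto simp: val_Nil val_Cons)
next
  case 4 then show ?case by (cases u) (auto simp: val_Nil val_Cons)
qed

lemma safe_iff_prefix:
  assumes "safe \<alpha>"
  shows "ltl_sem w i \<alpha> \<longleftrightarrow> (\<forall>n. \<not> val 1 (fm_of_ltl X \<alpha>) (seg w i n) \<le> 0)"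
proof -
  have "val 1 (fm_of_ltl X \<alpha>) u \<le> 0 \<longleftrightarrow> val 0 (fm_of_ltl X (dual \<alpha>)) u = 1" for u
    using val_cosafe_01[OF cosafe_dual[OF assms], of X u] val_dual[OF assms, of X u] by auto
  then show ?thesis
    using ltl_sem_dual[OF assms] cosafe_iff_prefix[OF cosafe_dual[OF assms]] by metis
qed


section \<open>Fixed points as ranked lists\<close>

definition ins :: "('s \<Rightarrow> 's list \<Rightarrow> bool) \<Rightarrow> 's \<Rightarrow> 's list \<Rightarrow> 's list" where
  "ins cond s Z = (if s \<in> set Z then Z else if cond s Z then s # Z else Z)"

text \<open>Folding over \<open>S\<close> makes the list its own round counter, so that the program
  can do without numbers. Every round before stabilisation inserts an element, and at most
  \<open>length S\<close> elements fit.\<close>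

definition solve :: "'s list \<Rightarrow> ('s \<Rightarrow> 's list \<Rightarrow> bool) \<Rightarrow> 's list" where
  "solve S cond = foldr (\<lambda>_. foldr (ins cond) S) S []"

text \<open>An element is justified by the elements that were inserted before it, which form its tail.\<close>

inductive ranked :: "('s \<Rightarrow> 's list \<Rightarrow> bool) \<Rightarrow> 's list \<Rightarrow> bool" for cond where
  "ranked cond []"
| "ranked cond Z \<Longrightarrow> cond s Z \<Longrightarrow> s \<notin> set Z \<Longrightarrow> ranked cond (s # Z)"

lemma ranked_distinct: "ranked cond Z \<Longrightarrow> distinct Z"
  by (induction rule: ranked.induct) auto

lemma ranked_ins: "ranked cond Z \<Longrightarrow> ranked cond (ins cond s Z)"
  by (auto simp: ins_def intro: ranked.intros)

lemma ranked_foldr_ins: "ranked cond Z \<Longrightarrow> ranked cond (foldr (ins cond) xs Z)"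
  by (induction xs) (auto intro: ranked_ins)

lemma ins_cases: "ins cond s Z = Z \<or> ins cond s Z = s # Z"
  by (simp add: ins_def)

lemma ins_fixed: "ins cond s Z = Z \<Longrightarrow> cond s Z \<Longrightarrow> s \<in> set Z"
  by (simp add: ins_def split: if_splits)

lemma foldr_ins_append: "\<exists>ys. foldr (ins cond) xs Z = ys @ Z \<and> set ys \<subseteq> set xs"
proof (induction xs)
  case (Cons x xs)
  then obtain ys where "foldr (ins cond) xs Z = ys @ Z" "set ys \<subseteq> set xs" by blast
  then show ?case using ins_cases[of cond x "ys @ Z"] by (auto intro: exI[of _ "x # ys"])
qed simp

text \<open>Lists only grow during a pass. A pass that returns its input therefore left it alone at
  every element, and each test was made against the final list; no monotonicity of
  \<open>cond\<close> enters.\<close>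

lemma foldr_ins_fixed:
  assumes "foldr (ins cond) xs Z = Z" "s \<in> set xs" "cond s Z"
  shows "s \<in> set Z"
  using assms
proof (induction xs)
  case (Cons x xs)
  obtain ys where ys: "foldr (ins cond) xs Z = ys @ Z" using foldr_ins_append[of cond xs Z] by blast
  obtain zs where "ins cond x (ys @ Z) = zs @ ys @ Z" using ins_cases[of cond x "ys @ Z"] by fastforce
  then have "foldr (ins cond) xs Z = Z" using Cons.prems(1) ys by auto
  then show ?case using Cons ins_fixed[of cond x Z] by auto
qed simp

lemma foldr_const: "foldr (\<lambda>_. f) xs z = (f ^^ length xs) z"
  by (induction xs) auto

lemma ranked_solve: "ranked cond (solve S cond)"
proof -
  have "ranked cond (((foldr (ins cond) S) ^^ n) [])" for n
    by (induction n) (auto intro: ranked.intros ranked_foldr_ins)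
  then show ?thesis by (simp add: solve_def foldr_const)
qed

lemma set_solve: "set (solve S cond) \<subseteq> set S"
proof -
  have "set (((foldr (ins cond) S) ^^ n) []) \<subseteq> set S" for n
  proof (induction n)
    case (Suc n)
    then show ?case using foldr_ins_append[of cond S "((foldr (ins cond) S) ^^ n) []"] by auto
  qed simp
  then show ?thesis by (simp add: solve_def foldr_const)
qed

lemma length_le_of_distinct_subset: "distinct Z \<Longrightarrow> set Z \<subseteq> set S \<Longrightarrow> length Z \<le> length S"
  by (metis List.finite_set card_length card_mono distinct_card le_trans)

lemma length_solve: "length (solve S cond) \<le> length S"
  by (rule length_le_of_distinct_subset[OF ranked_distinct[OF ranked_solve] set_solve])

lemma solve_closed:
  assumes "s \<in> set S" "cond s (solve S cond)"
  shows "s \<in> set (solve S cond)"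
proof -
  let ?R = "foldr (ins cond) S"
  \<comment> \<open>After \<open>n\<close> rounds the list is stable or has at least
    \<open>n\<close> elements. If it were still unstable after \<open>length S\<close> rounds, the
    next one would produce too many distinct elements.\<close>
  have *: "?R ((?R ^^ n) []) = (?R ^^ n) [] \<or> n \<le> length ((?R ^^ n) [])" for n
  proof (induction n)
    case (Suc n)
    obtain ys where "?R ((?R ^^ n) []) = ys @ (?R ^^ n) []"
      using foldr_ins_append[of cond S "(?R ^^ n) []"] by blast
    then show ?case using Suc by (cases ys) auto
  qed simp
  let ?Z = "(?R ^^ length S) []"
  have Z: "solve S cond = ?Z" by (simp add: solve_def foldr_const)
  obtain ys where ys: "?R ?Z = ys @ ?Z" "set ys \<subseteq> set S"
    using foldr_ins_append[of cond S ?Z] by blast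
  have "distinct (ys @ ?Z)"
    using ranked_distinct[OF ranked_foldr_ins[OF ranked_solve[of cond S], of S]] unfolding Z ys(1) .
  then have "length (ys @ ?Z) \<le> length S"
    using ys(2) set_solve[of S cond, unfolded Z] by (intro length_le_of_distinct_subset) auto
  then have "?R ?Z = ?Z" using *[of "length S"] ys(1) by (cases ys) auto
  then show ?thesis using foldr_ins_fixed[of cond S ?Z s] assms Z by simp
qed

text \<open>With the newest element in front, the length of \<open>after s Z\<close> is the rank of
  \<open>s\<close> in the fixed point iteration; it is the measure that drops along the moves chosen
  below.\<close>

fun after :: "'s \<Rightarrow> 's list \<Rightarrow> 's list" where
  "after s [] = []"
| "after s (y # ys) = (if y = s then ys else after s ys)"

lemma set_after: "set (after s Z) \<subseteq> set Z"
  by (induction Z) auto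

lemma length_after: "length (after s Z) \<le> length Z"
  by (induction Z) auto

lemma ranked_after: "ranked cond Z \<Longrightarrow> s \<in> set Z \<Longrightarrow> cond s (after s Z)"
  by (induction rule: ranked.induct) auto

lemma length_after_less:
  assumes "distinct Z" "s' \<in> set (after s Z)"
  shows "length (after s' Z) < length (after s Z)"
proof -
  have less: "length (after x ys) < length ys" if "x \<in> set ys" for x :: 'a and ys
    using that by (induction ys) (auto simp: less_Suc_eq)
  from assms show ?thesis
  proof (induction Z)
    case (Cons y Z)
    then show ?case using less[of s' Z] set_after[of s Z] by (cases "y = s") auto
  qed simp
qed


lemma no_infinite_descent: "\<not> (\<forall>i\<ge>N. f (Suc i) < (f i :: nat))"
proof
  assume *: "\<forall>i\<ge>N. f (Suc i) < f i"
  have "f (N + k) + k \<le> f N" for k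
  proof (induction k)
    case (Suc k)
    then show ?case using *[rule_format, of "N + k"] by simp
  qed simp
  from this[of "Suc (f N)"] show False by simp
qed


section \<open>Games with a safe and a co-safe assumption\<close>

text \<open>In a turn the environment chooses from \<open>As\<close> and then the agent from
  \<open>Bs\<close>. The play can stop only on entering a state, with the value of the state
  entered; this is why the conditions below test values of successors.\<close>

locale arena =
  fixes S :: "'s list" and As :: "'a list" and Bs :: "'b list" and \<delta> :: "'s \<Rightarrow> 'a \<Rightarrow> 'b \<Rightarrow> 's"
    and bad good :: "'s \<Rightarrow> bool" and vl :: "'s \<Rightarrow> real"
begin

text \<open>\<open>pos\<close> chooses between a set to enter and a set to avoid, so that three
  fixed points and both kinds of moves share one procedure. A successor of value at least
  \<open>b\<close> is always admissible because the play may end there.\<close>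

definition pick :: "real \<Rightarrow> bool \<Rightarrow> 's list \<Rightarrow> 's \<Rightarrow> 'a \<Rightarrow> ('b \<times> 's) option" where
  "pick b pos Z s A =
     foldr (\<lambda>B acc. if b \<le> vl (\<delta> s A B) \<or> (\<delta> s A B \<in> set Z) = pos then Some (B, \<delta> s A B) else acc)
       Bs None"

lemma pick_None:
  "pick b pos Z s A = None \<longleftrightarrow> (\<forall>B\<in>set Bs. \<not> b \<le> vl (\<delta> s A B) \<and> (\<delta> s A B \<in> set Z) \<noteq> pos)"
  unfolding pick_def by (induction Bs) auto

lemma pick_Some:
  "pick b pos Z s A = Some (B, s') \<Longrightarrow>
     B \<in> set Bs \<and> s' = \<delta> s A B \<and> (b \<le> vl s' \<or> (s' \<in> set Z) = pos)"
  unfolding pick_def by (induction Bs) (auto split: if_splits)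

text \<open>In a bad state the safe formula is already falsified, so the agent has nothing left to
  achieve.\<close>

definition win_cond :: "real \<Rightarrow> 's \<Rightarrow> 's list \<Rightarrow> bool" where
  "win_cond b s Z \<longleftrightarrow> bad s \<or> (\<forall>A\<in>set As. pick b True Z s A \<noteq> None)"

definition win :: "real \<Rightarrow> 's list" where
  "win b = solve S (win_cond b)"

text \<open>
  The states from which the agent can neither force \<open>win b\<close> nor avoid \<open>good\<close> states forever,
  computed as a least fixed point.
\<close>

definition lose_cond :: "real \<Rightarrow> 's list \<Rightarrow> 's \<Rightarrow> 's list \<Rightarrow> bool" where
  "lose_cond b W s Z \<longleftrightarrow> s \<notin> set W \<and> (good s \<or> \<not> (\<forall>A\<in>set As. pick b False Z s A \<noteq> None))"

definition lose :: "real \<Rightarrow> 's list" where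
  "lose b = solve S (lose_cond b (win b))"

text \<open>The states with a play that avoids \<open>lose b\<close> and ends with value at least \<open>b\<close>.\<close>

definition live_cond :: "real \<Rightarrow> 's list \<Rightarrow> 's \<Rightarrow> 's list \<Rightarrow> bool" where
  "live_cond b L s Z \<longleftrightarrow> s \<notin> set L \<and> (\<exists>A\<in>set As. pick b True Z s A \<noteq> None)"

definition live :: "real \<Rightarrow> 's list" where
  "live b = solve S (live_cond b (lose b))"

text \<open>Inside \<open>win b\<close> the target is what was inserted before \<open>s\<close>,
  which makes the rank drop; elsewhere it is enough to stay out of \<open>lose b\<close>.\<close>

definition move0 :: "real \<Rightarrow> 's \<Rightarrow> 'a \<Rightarrow> ('b \<times> 's) option" where
  "move0 b s A = (if s \<in> set (win b) then pick b True (after s (win b)) s A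
                  else pick b False (lose b) s A)"

definition move1 :: "real \<Rightarrow> 's \<Rightarrow> 'a \<Rightarrow> ('b \<times> 's) option" where
  "move1 b s A = pick b True (after s (live b)) s A"

fun mv :: "real \<Rightarrow> bool \<times> 's \<Rightarrow> 'a \<Rightarrow> ('b \<times> bool \<times> 's) option" where
  "mv b (m, s) A =
     (case (if m then move1 b s A else None) of Some (B, s') \<Rightarrow> Some (B, True, s')
      | None \<Rightarrow> map_option (\<lambda>(B, s'). (B, False, s')) (move0 b s A))"

lemma win_not_lose: "s \<in> set (win b) \<Longrightarrow> s \<notin> set (lose b)"
  unfolding lose_def using ranked_after[OF ranked_solve, of s S "lose_cond b (win b)"]
  by (auto simp: lose_cond_def)

lemma live_not_lose: "s \<in> set (live b) \<Longrightarrow> s \<notin> set (lose b)"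
  unfolding live_def using ranked_after[OF ranked_solve, of s S "live_cond b (lose b)"]
  by (auto simp: live_cond_def)

lemma not_lose:
  assumes "s \<in> set S" "s \<notin> set (lose b)" "s \<notin> set (win b)"
  shows "\<not> good s" "A \<in> set As \<Longrightarrow> pick b False (lose b) s A \<noteq> None"
  using solve_closed[of s S "lose_cond b (win b)"] assms
  unfolding lose_def[symmetric] lose_cond_def by auto

text \<open>A state of \<open>win b\<close> that is not bad has a move by its own justification, and
  a state outside \<open>win b\<close> and \<open>lose b\<close> has one because
  \<open>lose b\<close> is closed.\<close>

lemma mv_None:
  assumes "s \<in> set S" "s \<notin> set (lose b)" "A \<in> set As" "mv b (m, s) A = None"
  shows "bad s"
proof -
  have m: "move0 b s A = None" using assms(4) by (auto split: option.splits if_splits)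
  show ?thesis
  proof (cases "s \<in> set (win b)")
    case True
    then have "win_cond b s (after s (win b))" unfolding win_def by (rule ranked_after[OF ranked_solve])
    then show ?thesis using m True assms(3) by (auto simp: move0_def win_cond_def)
  next
    case False
    then show ?thesis using not_lose(2)[OF assms(1,2) False assms(3)] m by (simp add: move0_def)
  qed
qed

lemma mv_Some:
  assumes "s \<in> set S" "s \<notin> set (lose b)" "mv b (m, s) A = Some (B, m', s')"
  shows "B \<in> set Bs" "s' = \<delta> s A B" "m' \<Longrightarrow> m"
    and "\<not> b \<le> vl s' \<Longrightarrow> s' \<notin> set (lose b)"
    and "\<not> b \<le> vl s' \<Longrightarrow> m' \<Longrightarrow>
      s' \<in> set (live b) \<and> length (after s' (live b)) < length (after s (live b))"
    and "\<not> b \<le> vl s' \<Longrightarrow> \<not> m' \<Longrightarrow> s \<in> set (win b) \<Longrightarrow>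
      s' \<in> set (win b) \<and> length (after s' (win b)) < length (after s (win b))"
proof -
  consider (1) "m" "m'" "move1 b s A = Some (B, s')" | (0) "\<not> m'" "move0 b s A = Some (B, s')"
    using assms(3) by (auto split: option.splits if_splits)
  then have "B \<in> set Bs \<and> s' = \<delta> s A B \<and> (m' \<longrightarrow> m) \<and> (\<not> b \<le> vl s' \<longrightarrow> s' \<notin> set (lose b)) \<and>
    (\<not> b \<le> vl s' \<longrightarrow> m' \<longrightarrow>
      s' \<in> set (live b) \<and> length (after s' (live b)) < length (after s (live b))) \<and>
    (\<not> b \<le> vl s' \<longrightarrow> \<not> m' \<longrightarrow> s \<in> set (win b) \<longrightarrow>
      s' \<in> set (win b) \<and> length (after s' (win b)) < length (after s (win b)))"
  proof cases
    case 1
    have d: "distinct (live b)" unfolding live_def by (rule ranked_distinct[OF ranked_solve])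
    from pick_Some[OF 1(3)[unfolded move1_def]] 1 show ?thesis
      using length_after_less[OF d, of s' s] set_after[of s "live b"] live_not_lose[of s' b] by auto
  next
    case 0
    have d: "distinct (win b)" unfolding win_def by (rule ranked_distinct[OF ranked_solve])
    show ?thesis
    proof (cases "s \<in> set (win b)")
      case True
      then have "pick b True (after s (win b)) s A = Some (B, s')" using 0 by (simp add: move0_def)
      from pick_Some[OF this] 0 show ?thesis
        using length_after_less[OF d, of s' s] set_after[of s "win b"] win_not_lose[of s' b] by auto
    next
      case False
      then have "pick b False (lose b) s A = Some (B, s')" using 0 by (simp add: move0_def)
      from pick_Some[OF this] 0 False show ?thesis by auto
    qed
  qed
  then show "B \<in> set Bs" "s' = \<delta> s A B" "m' \<Longrightarrow> m"
    "\<not> b \<le> vl s' \<Longrightarrow> s' \<notin> set (lose b)"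
    "\<not> b \<le> vl s' \<Longrightarrow> m' \<Longrightarrow>
      s' \<in> set (live b) \<and> length (after s' (live b)) < length (after s (live b))"
    "\<not> b \<le> vl s' \<Longrightarrow> \<not> m' \<Longrightarrow> s \<in> set (win b) \<Longrightarrow>
      s' \<in> set (win b) \<and> length (after s' (win b)) < length (after s (win b))"
    by blast+
qed

text \<open>Mode \<open>True\<close> cannot last, since the rank in \<open>live b\<close> drops with
  each move that does not end. Afterwards a stay in \<open>win b\<close> is impossible because its
  rank drops likewise. What remains is the region outside \<open>win b\<close> and
  \<open>lose b\<close>, which contains no good state.\<close>

lemma endless_play_eventually_not_good:
  assumes closed: "\<And>s A B. s \<in> set S \<Longrightarrow> A \<in> set As \<Longrightarrow> B \<in> set Bs \<Longrightarrow> \<delta> s A B \<in> set S"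
    and "st 0 = (True, s0)" "s0 \<in> set (live b)" and A: "\<And>i. A i \<in> set As"
    and run: "\<And>i. \<exists>B m' s'. mv b (st i) (A i) = Some (B, m', s') \<and> \<not> b \<le> vl s' \<and> st (Suc i) = (m', s')"
  shows "\<exists>N. \<forall>i\<ge>N. \<not> good (snd (st i))"
proof -
  have inS: "snd (st i) \<in> set S \<and> snd (st i) \<notin> set (lose b)" for i
  proof (induction i)
    case 0
    then show ?case using assms(2,3) live_not_lose set_solve[of S] by (auto simp: live_def)
  next
    case (Suc i)
    from run[of i] obtain B m' s' where *: "mv b (st i) (A i) = Some (B, m', s')"
      "\<not> b \<le> vl s'" "st (Suc i) = (m', s')" by blast
    note ** = mv_Some[OF Suc[THEN conjunct1] Suc[THEN conjunct2], where m = "fst (st i)", unfolded prod.collapse, OF *(1)]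
    show ?case using **(1,2,4) * Suc closed A by auto
  qed
  have trans: "(fst (st (Suc i)) \<longrightarrow> fst (st i) \<and>
        length (after (snd (st (Suc i))) (live b)) < length (after (snd (st i)) (live b))) \<and>
      (\<not> fst (st (Suc i)) \<longrightarrow> snd (st i) \<in> set (win b) \<longrightarrow> snd (st (Suc i)) \<in> set (win b) \<and>
        length (after (snd (st (Suc i))) (win b)) < length (after (snd (st i)) (win b)))" for i
  proof -
    from run[of i] obtain B m' s' where *: "mv b (st i) (A i) = Some (B, m', s')"
      "\<not> b \<le> vl s'" "st (Suc i) = (m', s')" by blast
    note ** = mv_Some[OF inS[of i, THEN conjunct1] inS[of i, THEN conjunct2], where m = "fst (st i)", unfolded prod.collapse, OF *(1)]
    show ?thesis using **(3)  **(5)[OF *(2)] **(6)[OF *(2)] *(3) by auto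
  qed
  obtain N where N: "\<not> fst (st N)"
  proof (rule ccontr)
    assume "\<not> thesis"
    then have "fst (st i)" for i using that by blast
    then have "length (after (snd (st (Suc i))) (live b)) < length (after (snd (st i)) (live b))" for i
      using trans[of i] by simp
    then show False
      using no_infinite_descent[of 0 "\<lambda>i. length (after (snd (st i)) (live b))"] by simp
  qed
  have m0: "\<not> fst (st i)" if "i \<ge> N" for i
    using that N by (induction i rule: dec_induct) (use trans in blast)+
  have "snd (st i) \<notin> set (win b)" if "i \<ge> N" for i
  proof
    assume w: "snd (st i) \<in> set (win b)"
    have m: "\<not> fst (st (Suc j))" if "j \<ge> i" for j using m0[of "Suc j"] that \<open>i \<ge> N\<close> by simp
    have "snd (st j) \<in> set (win b)" if "j \<ge> i" for j
      using that w by (induction j rule: dec_induct) (use trans m in blast)+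
    then have "length (after (snd (st (Suc j))) (win b)) < length (after (snd (st j)) (win b))"
      if "j \<ge> i" for j using trans[of j] m that by simp
    then show False
      using no_infinite_descent[of i "\<lambda>i. length (after (snd (st i)) (win b))"] by blast
  qed
  then show ?thesis using not_lose(1) inS by blast
qed

text \<open>Environment words along which the machine stays in mode \<open>True\<close> until it
  ends. The ending move itself may also be one of \<open>move0\<close>, hence the free mode
  \<open>m'\<close> in the first rule.\<close>

inductive ending :: "real \<Rightarrow> 's \<Rightarrow> 'a list \<Rightarrow> bool" for b where
  "A \<in> set As \<Longrightarrow> mv b (True, s) A = Some (B, m', s') \<Longrightarrow> b \<le> vl s' \<Longrightarrow> ending b s [A]"
| "A \<in> set As \<Longrightarrow> mv b (True, s) A = Some (B, True, s') \<Longrightarrow> \<not> b \<le> vl s' \<Longrightarrow> ending b s' u \<Longrightarrow>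
    ending b s (A # u)"

lemma live_ending: "s \<in> set (live b) \<Longrightarrow> \<exists>u. ending b s u"
proof (induction "length (after s (live b))" arbitrary: s rule: less_induct)
  case less
  have s: "s \<in> set S" "s \<notin> set (lose b)"
    using less.prems live_not_lose set_solve[of S] by (auto simp: live_def)
  have "live_cond b (lose b) s (after s (live b))"
    using less.prems unfolding live_def by (rule ranked_after[OF ranked_solve])
  then obtain A B s' where A: "A \<in> set As" and "move1 b s A = Some (B, s')"
    by (auto simp: live_cond_def move1_def)
  then have mv: "mv b (True, s) A = Some (B, True, s')" by simp
  show ?case
  proof (cases "b \<le> vl s'")
    case True
    then show ?thesis using ending.intros(1)[OF A mv] by blast
  next
    case False
    from mv_Some(5)[OF s mv False] less.hyps obtain u where "ending b s' u" by auto
    then show ?thesis using ending.intros(2)[OF A mv False] by blast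
  qed
qed

text \<open>The complement of a closed attractor is a trap in which the environment can hold the
  agent.\<close>

lemma not_win:
  assumes "s \<in> set S" "s \<notin> set (win b)"
  shows "\<not> bad s \<and> (\<exists>A\<in>set As. \<forall>B\<in>set Bs. \<not> b \<le> vl (\<delta> s A B) \<and> \<delta> s A B \<notin> set (win b))"
  using solve_closed[of s S "win_cond b"] assms unfolding win_def[symmetric] win_cond_def
  by (auto simp: pick_None)

text \<open>Induction along the order of insertion. The first element of \<open>H\<close> to enter
  the list would be justified by elements outside \<open>H\<close> only, but from \<open>H\<close>
  the agent can always end or remain in \<open>H\<close>.\<close>

lemma invariant_not_lose:
  assumes "\<And>s. s \<in> H \<Longrightarrow> good s \<Longrightarrow> s \<in> set (win b)"
    and "\<And>s A. s \<in> H \<Longrightarrow> A \<in> set As \<Longrightarrow> \<exists>B\<in>set Bs. b \<le> vl (\<delta> s A B) \<or> \<delta> s A B \<in> H"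
  shows "H \<inter> set (lose b) = {}"
proof -
  have "H \<inter> set Z = {}" if "ranked (lose_cond b (win b)) Z" for Z
    using that
  proof induction
    case (2 Z s)
    have False if "s \<in> H"
    proof -
      from 2(2) that assms(1) obtain A where "A \<in> set As" "pick b False Z s A = None"
        by (auto simp: lose_cond_def simp del: not_None_eq)
      with assms(2)[OF that] 2(4) show False unfolding pick_None by blast
    qed
    with 2 show ?case by auto
  qed simp
  from this[OF ranked_solve] show ?thesis by (simp add: lose_def)
qed

lemma live_step:
  assumes "s \<in> set S" "s \<notin> set (lose b)" "A \<in> set As" "B \<in> set Bs"
    "b \<le> vl (\<delta> s A B) \<or> \<delta> s A B \<in> set (live b)"
  shows "s \<in> set (live b)"
proof -
  have "pick b True (live b) s A \<noteq> None" using assms(4,5) unfolding pick_None by auto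
  then show ?thesis
    using solve_closed[of s S "live_cond b (lose b)"] assms(1-3)
    unfolding live_def[symmetric] live_cond_def by auto
qed

text \<open>The candidates are the values of the states, among which every attained value occurs.
  Each candidate is a threshold with regions of its own.\<close>

definition best :: "'s \<Rightarrow> real option" where
  "best s0 = foldr (\<lambda>s acc. if s0 \<in> set (live (vl s)) \<and> (case acc of None \<Rightarrow> True | Some b \<Rightarrow> b \<le> vl s)
     then Some (vl s) else acc) S None"

lemma best_Some:
  assumes "s \<in> set S" "s0 \<in> set (live (vl s))"
  shows "\<exists>b. best s0 = Some b \<and> s0 \<in> set (live b) \<and> vl s \<le> b"
proof -
  let ?f = "\<lambda>s acc. if s0 \<in> set (live (vl s)) \<and> (case acc of None \<Rightarrow> True | Some b \<Rightarrow> b \<le> vl s)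
     then Some (vl s) else acc"
  have *: "foldr ?f xs None = Some b \<Longrightarrow> s0 \<in> set (live b)" for xs b
    by (induction xs arbitrary: b) (auto split: if_splits)
  have "\<exists>b. foldr ?f xs None = Some b \<and> vl s \<le> b" if "s \<in> set xs" for xs
    using that
  proof (induction xs)
    case (Cons x xs)
    show ?case
    proof (cases "s \<in> set xs")
      case True
      with Cons.IH show ?thesis by (auto intro: order_trans)
    next
      case False
      with Cons.prems have "x = s" by simp
      then show ?thesis using assms(2) by (cases "foldr ?f xs None") auto
    qed
  qed simp
  from this[OF assms(1)] * show ?thesis unfolding best_def by blast
qed

lemma best_live: "best s0 = Some b \<Longrightarrow> s0 \<in> set (live b)"
proof -
  let ?f = "\<lambda>s acc. if s0 \<in> set (live (vl s)) \<and> (case acc of None \<Rightarrow> True | Some b \<Rightarrow> b \<le> vl s)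
     then Some (vl s) else acc"
  have "foldr ?f xs None = Some b \<Longrightarrow> s0 \<in> set (live b)" for xs b
    by (induction xs arbitrary: b) (auto split: if_splits)
  then show "best s0 = Some b \<Longrightarrow> s0 \<in> set (live b)" unfolding best_def by blast
qed

end


section \<open>The game of a synthesis problem\<close>

lemma val_safe_mono:
  assumes "safe \<alpha>" "n \<le> m" "val 1 (fm_of_ltl X \<alpha>) (seg w i n) \<le> 0"
  shows "val 1 (fm_of_ltl X \<alpha>) (seg w i m) \<le> 0"
  using val_cosafe_mono[OF cosafe_dual[OF assms(1)] assms(2), of X w i]
    val_cosafe_01[OF cosafe_dual[OF assms(1)], of X "seg w i n"] assms(3)
  by (simp add: val_dual[OF assms(1)])

lemma sexp_list_inject: "sexp_list xs = sexp_list ys \<longleftrightarrow> xs = ys"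
proof (induction xs arbitrary: ys)
  case Nil
  then show ?case by (cases ys) auto
next
  case (Cons x xs)
  then show ?case by (cases ys) auto
qed

lemma sexp_list_map_inject:
  "(\<And>x y. f x = f y \<longleftrightarrow> x = y) \<Longrightarrow> sexp_list (map f xs) = sexp_list (map f ys) \<longleftrightarrow> xs = ys"
  unfolding sexp_list_inject by (metis inj_map_eq_map injI)

fun enc_vt :: "vt \<Rightarrow> sexp" where
  "enc_vt (VT r ts) = Pair (Num r) (sexp_list (map enc_vt ts))"

lemma enc_vt_inject: "enc_vt t = enc_vt t' \<longleftrightarrow> t = t'"
proof (induction t arbitrary: t')
  case (VT r ts)
  obtain r' ts' where t': "t' = VT r' ts'" by (cases t')
  have "map enc_vt ts = map enc_vt ts' \<longleftrightarrow> ts = ts'"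
    using VT
  proof (induction ts arbitrary: ts')
    case (Cons t ts)
    then show ?case by (cases ts') auto
  qed auto
  then show ?case by (simp add: t' sexp_list_inject)
qed

type_synonym vec = "vt list"
text \<open>A map between vectors as an association list. All states keep the keys in the same
  order, so that equal maps are equal lists and can be compared by the program.\<close>

type_synonym state = "(vec \<times> vec) list"

definition enc_vec :: "vec \<Rightarrow> sexp" where
  "enc_vec V = sexp_list (map enc_vt V)"

lemma enc_vec_inject: "enc_vec V = enc_vec V' \<longleftrightarrow> V = V'"
  unfolding enc_vec_def by (rule sexp_list_map_inject[OF enc_vt_inject])

definition enc_vv :: "vec \<times> vec \<Rightarrow> sexp" where
  "enc_vv p = Pair (enc_vec (fst p)) (enc_vec (snd p))"

definition enc_state :: "state \<Rightarrow> sexp" where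
  "enc_state s = sexp_list (map enc_vv s)"

lemma enc_state_inject: "enc_state s = enc_state s' \<longleftrightarrow> s = s'"
  unfolding enc_state_def
  by (rule sexp_list_map_inject) (auto simp: enc_vv_def enc_vec_inject prod_eq_iff)

definition vstep :: "nat set \<Rightarrow> fm list \<Rightarrow> vec \<Rightarrow> vec" where
  "vstep a fs V = map2 (\<lambda>f t. f t) (map (step a) fs) V"

definition lookup :: "vec \<Rightarrow> state \<Rightarrow> vec" where
  "lookup W s = foldr (\<lambda>p acc. if W = fst p then snd p else acc) s []"

text \<open>The new letter is the last of the trace and so the first one met in backward evaluation:
  the old map is precomposed with \<open>vstep a fs\<close>.\<close>

definition sstep :: "nat set \<Rightarrow> fm list \<Rightarrow> state \<Rightarrow> state" where
  "sstep a fs s = foldr (\<lambda>p acc. (fst p, lookup (vstep a fs (fst p)) s) # acc) s []"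

definition ivec :: "fm list \<Rightarrow> vec" where
  "ivec fs = [ini 1 (fs ! 0), ini 0 (fs ! 1), ini 0 (fs ! 2)]"

text \<open>Phrased by comparison, here and for \<open>good\<close>, because this is the only test
  on numbers that a program has.\<close>

definition bad :: "fm list \<Rightarrow> state \<Rightarrow> bool" where
  "bad fs s \<longleftrightarrow> root (lookup (ivec fs) s ! 0) \<le> 0"

definition good :: "fm list \<Rightarrow> state \<Rightarrow> bool" where
  "good fs s \<longleftrightarrow> 1 \<le> root (lookup (ivec fs) s ! 1)"

definition value_of :: "fm list \<Rightarrow> state \<Rightarrow> real" where
  "value_of fs s = root (lookup (ivec fs) s ! 2)"

definition sublists :: "nat list \<Rightarrow> nat list list" where
  "sublists xs = foldr (\<lambda>p acc. foldr (\<lambda>l r. (p # l) # r) acc acc) xs [[]]"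

lemma foldr_Cons_map: "foldr (\<lambda>l r. f l # r) xs ys = map f xs @ ys"
  by (induction xs) auto

lemma sublists_simps:
  "sublists [] = [[]]" "sublists (p # xs) = map ((#) p) (sublists xs) @ sublists xs"
  by (simp_all add: sublists_def foldr_Cons_map)

lemma length_sublists: "length (sublists xs) = 2 ^ length xs"
  by (induction xs) (auto simp: sublists_simps)

lemma in_sublists: "A \<in> set (sublists xs) \<Longrightarrow> set A \<subseteq> set xs \<and> length A \<le> length xs"
  by (induction xs arbitrary: A) (fastforce simp: sublists_simps)+

lemma ex_sublists: "D \<subseteq> set xs \<Longrightarrow> \<exists>A\<in>set (sublists xs). set A = D"
proof (induction xs arbitrary: D)
  case (Cons p xs)
  have "D - {p} \<subseteq> set xs" using Cons.prems by auto
  from Cons.IH[OF this] obtain A where A: "A \<in> set (sublists xs)" "set A = D - {p}" by blast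
  show ?case
  proof (cases "p \<in> D")
    case True
    then show ?thesis using A by (intro bexI[of _ "p # A"]) (auto simp: sublists_simps)
  next
    case False
    then show ?thesis using A by (intro bexI[of _ A]) (auto simp: sublists_simps)
  qed
qed (simp add: sublists_simps)

text \<open>Repeated occurrences are kept. Different members of \<open>sublists\<close> can
  therefore denote the same set, and moves must be chosen in a way that depends only on the
  set.\<close>

definition props :: "bool \<Rightarrow> fm list \<Rightarrow> nat list" where
  "props b fs = map snd (filter (\<lambda>(c, p). c = b) (concat (map occs fs)))"

lemma sstep_map: "sstep a fs s = map (\<lambda>p. (fst p, lookup (vstep a fs (fst p)) s)) s"
  by (simp add: sstep_def foldr_Cons_map)

lemma lookup_map: "V \<in> set vs \<Longrightarrow> lookup V (map (\<lambda>V. (V, f V)) vs) = f V"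
  unfolding lookup_def by (induction vs) auto

text \<open>\<open>Sym 0\<close> is the sink for plays that are over. It is not a pair and so
  differs from every \<open>mode_state\<close>; as no row starts in it, the output stays empty
  forever.\<close>

fun done_or :: "bool \<Rightarrow> sexp \<Rightarrow> sexp" where
  "done_or e q = (if e then Sym 0 else q)"

definition mode_state :: "bool \<Rightarrow> state \<Rightarrow> sexp" where
  "mode_state m s = Pair (sexp_bool m) (enc_state s)"

lemma mode_state_inject: "mode_state m s = mode_state m' s' \<longleftrightarrow> m = m' \<and> s = s'"
  by (auto simp: mode_state_def enc_state_inject sexp_bool_def)

type_synonym entry = "sexp \<times> nat list \<times> nat list \<times> bool \<times> sexp"

text \<open>
  Mode \<open>True\<close> follows a play that ends, as long as the environment cooperates. Where it has no
  move the entries of mode \<open>False\<close> take over, and where these have no move either, the state is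
  bad, so that the strategy may stop tracking the play.
\<close>

definition entries :: "(state \<Rightarrow> real) \<Rightarrow> nat list list \<Rightarrow> real \<Rightarrow> sexp \<Rightarrow> bool \<Rightarrow>
    (nat list \<Rightarrow> (nat list \<times> state) option) \<Rightarrow> entry list \<Rightarrow> entry list" where
  "entries vl As b q m f acc = foldr (\<lambda>A acc.
     case f A of Some (B, s') \<Rightarrow> (q, A, B, b \<le> vl s', done_or (b \<le> vl s') (mode_state m s')) # acc
     | None \<Rightarrow> if m then acc else (q, A, [], False, Sym 0) # acc) As acc"

locale game = fixes fs :: "fm list" and S :: "state list"
begin

definition As :: "nat list list" where "As = sublists (props True fs)"
definition Bs :: "nat list list" where "Bs = sublists (props False fs)"
definition \<delta> :: "state \<Rightarrow> nat list \<Rightarrow> nat list \<Rightarrow> state" where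
  "\<delta> s A B = sstep (set A \<union> set B) fs s"

sublocale arena S As Bs \<delta> "bad fs" "good fs" "value_of fs" .

text \<open>A transducer takes the first matching row, so the order of the blocks is a priority: in
  mode \<open>True\<close> the rows of \<open>move1\<close> shadow those of \<open>move0\<close>,
  and the latter lead into mode \<open>False\<close>.\<close>

definition add_rows :: "real \<Rightarrow> state \<Rightarrow> entry list \<Rightarrow> entry list" where
  "add_rows b s acc =
     entries (value_of fs) As b (mode_state True s) True (move1 b s)
       (entries (value_of fs) As b (mode_state True s) False (move0 b s)
         (entries (value_of fs) As b (mode_state False s) False (move0 b s) acc))"

definition rows :: "real \<Rightarrow> entry list" where
  "rows b = foldr (add_rows b) S []"

definition machine :: "state \<Rightarrow> real \<Rightarrow> sexp transducer" where
  "machine s0 b = Transducer (mode_state True s0) (props True fs) (rows b)"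

lemma pick_cong: "set A = set A' \<Longrightarrow> pick b p Z s A = pick b p Z s A'"
proof -
  assume "set A = set A'"
  then have "\<delta> s A = \<delta> s A'" by (simp add: \<delta>_def fun_eq_iff)
  then show ?thesis by (simp only: pick_def)
qed

lemma move_cong: "set A = set A' \<Longrightarrow> move0 b s A = move0 b s A'"
  "set A = set A' \<Longrightarrow> move1 b s A = move1 b s A'"
  "set A = set A' \<Longrightarrow> mv b (m, s) A = mv b (m, s) A'"
proof -
  assume A: "set A = set A'"
  show 0: "move0 b s A = move0 b s A'" "move1 b s A = move1 b s A'"
    unfolding move0_def move1_def pick_cong[OF A] by (rule refl)+
  show "mv b (m, s) A = mv b (m, s) A'" by (simp only: mv.simps 0)
qed

definition found :: "sexp \<Rightarrow> nat set \<Rightarrow> entry list \<Rightarrow> (nat list \<times> bool \<times> sexp) option" where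
  "found q D es = map_option (\<lambda>(_, _, r). r) (find (\<lambda>(p, A, _). p = q \<and> set A = D) es)"

text \<open>Several lists in \<open>As\<close> may have the same set; by \<open>cong\<close> they
  yield the same move, so it does not matter which of their rows is found.\<close>

lemma found_entries:
  assumes cong: "\<And>A A'. set A = set A' \<Longrightarrow> f A = f A'" and "A0 \<in> set As"
  shows "found q (set A0) (entries vl As b q' m f acc) =
    (if q = q' then
       (case f A0 of Some (B, s') \<Rightarrow> Some (B, b \<le> vl s', done_or (b \<le> vl s') (mode_state m s'))
        | None \<Rightarrow> if m then found q (set A0) acc else Some ([], False, Sym 0))
     else found q (set A0) acc)"
proof -
  let ?F = "\<lambda>A acc.
     case f A of Some (B, s') \<Rightarrow> (q', A, B, b \<le> vl s', done_or (b \<le> vl s') (mode_state m s')) # acc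
     | None \<Rightarrow> if m then acc else (q', A, [], False, Sym 0) # acc"
  have 1: "found q D (foldr ?F xs acc) = found q D acc" if "q \<noteq> q' \<or> (\<forall>A\<in>set xs. set A \<noteq> D)" for xs D q
    using that by (induction xs) (auto simp: found_def split: option.splits)
  have 2: "found q' (set A0) (foldr ?F xs acc) =
     (case f A0 of Some (B, s') \<Rightarrow> Some (B, b \<le> vl s', done_or (b \<le> vl s') (mode_state m s'))
        | None \<Rightarrow> if m then found q' (set A0) acc else Some ([], False, Sym 0))"
    if "\<exists>A\<in>set xs. set A = set A0" for xs
    using that
  proof (induction xs)
    case (Cons A xs)
    have step: "found q' (set A0) (?F A acc') = (if set A = set A0 then
       (case f A0 of Some (B, s') \<Rightarrow> Some (B, b \<le> vl s', done_or (b \<le> vl s') (mode_state m s'))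
        | None \<Rightarrow> if m then found q' (set A0) acc' else Some ([], False, Sym 0))
        else found q' (set A0) acc')" for acc'
      using cong[of A A0] by (auto simp: found_def split: option.splits)
    show ?case
    proof (cases "\<exists>A\<in>set xs. set A = set A0")
      case True
      then show ?thesis using Cons.IH step[of "foldr ?F xs acc"] by (auto split: option.splits)
    next
      case False
      then have "set A = set A0" using Cons.prems by auto
      then show ?thesis using 1[of q' xs "set A0"] False step[of "foldr ?F xs acc"] by (auto split: option.splits)
    qed
  qed simp
  show ?thesis
  proof (cases "q = q'")
    case True
    from 2[of As] assms(2) show ?thesis unfolding entries_def True by (simp only: if_True simp_thms) blast
  next
    case False
    with 1[of q As "set A0"] show ?thesis unfolding entries_def by (simp only: if_False simp_thms)
  qed
qed

lemma found_rows:
  assumes "A \<in> set As" "s \<in> set S"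
  shows "found (mode_state m s) (set A) (rows b) =
    (case mv b (m, s) A of None \<Rightarrow> Some ([], False, Sym 0)
     | Some (B, m', s') \<Rightarrow> Some (B, b \<le> value_of fs s', done_or (b \<le> value_of fs s') (mode_state m' s')))"
    (is "_ = ?R")
proof -
  have G: "found (mode_state m s) (set A) (add_rows b x acc) =
     (if x = s then ?R else found (mode_state m s) (set A) acc)" for x acc
    unfolding add_rows_def found_entries[where f = "move1 b x", OF move_cong(2) assms(1), simplified]
      found_entries[where f = "move0 b x", OF move_cong(1) assms(1), simplified]
      mode_state_inject by (cases m; cases "x = s") (auto split: option.splits)
  have "s \<in> set xs \<Longrightarrow> found (mode_state m s) (set A) (foldr (add_rows b) xs []) = ?R" for xs
  proof (induction xs)
    case (Cons x xs)
    then show ?case unfolding foldr_Cons o_apply G by (cases "x = s") simp_all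
  qed simp
  then show ?thesis using assms(2) unfolding rows_def by blast
qed

lemma machine_step:
  assumes "A \<in> set As" "s \<in> set S" "set A = a \<inter> set (props True fs)"
  shows "transducer_step (machine s0 b) (mode_state m s) a =
    (case mv b (m, s) A of None \<Rightarrow> (({}, False), Sym 0)
     | Some (B, m', s') \<Rightarrow> ((set B, b \<le> value_of fs s'), done_or (b \<le> value_of fs s') (mode_state m' s')))"
  using found_rows[OF assms(1,2), of m b]
  unfolding transducer_step_def machine_def found_def assms(3)
  by (auto split: option.splits simp del: mv.simps)

lemma rows_fst_ne: "e \<in> set (rows b) \<Longrightarrow> fst e \<noteq> Sym 0"
proof -
  have E: "e \<in> set (entries vl As b q m f acc) \<Longrightarrow> fst e = q \<or> e \<in> set acc" for e vl b q m f acc and As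
    unfolding entries_def by (induction As) (auto split: option.splits if_splits)
  have "e \<in> set (foldr (add_rows b) xs []) \<Longrightarrow> fst e \<noteq> Sym 0" for xs
    by (induction xs) (auto simp: add_rows_def mode_state_def dest!: E)
  then show "e \<in> set (rows b) \<Longrightarrow> fst e \<noteq> Sym 0" unfolding rows_def by blast
qed

lemma machine_step_done: "transducer_step (machine s0 b) (Sym 0) a = (({}, False), Sym 0)"
proof -
  have "find (\<lambda>(p, A, _). p = Sym 0 \<and> set A = a \<inter> set (props True fs)) (rows b) = None"
    using rows_fst_ne unfolding find_None_iff by fastforce
  then show ?thesis by (simp add: transducer_step_def machine_def)
qed

end


section \<open>Optimality of the machine\<close>

lemma foldr_vstep_nth:
  "length V = length fs \<Longrightarrow> length (foldr (\<lambda>a. vstep a fs) u V) = length fs \<and>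
    (\<forall>i<length fs. foldr (\<lambda>a. vstep a fs) u V ! i = foldr (\<lambda>a. step a (fs ! i)) u (V ! i))"
  by (induction u) (auto simp: vstep_def)

text \<open>Optimality is proved for any lists \<open>vs\<close> and \<open>S\<close> that contain
  the initial elements and are closed under the letters, independently of how the program computes
  them.\<close>

locale synthesis =
  fixes F :: "(nat \<times> (real list \<Rightarrow> real)) set" and X Y :: "nat set" and \<alpha>\<^sub>s \<alpha>\<^sub>c :: ltl and \<phi> :: qltl
    and vs :: "vec list" and S :: "state list" and fs :: "fm list"
  assumes unit: "unit_functions F" and disj: "X \<inter> Y = {}"
    and safe: "safe \<alpha>\<^sub>s" "ltl_props \<alpha>\<^sub>s \<subseteq> X \<union> Y"
    and cosafe: "cosafe \<alpha>\<^sub>c" "ltl_props \<alpha>\<^sub>c \<subseteq> X \<union> Y"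
    and over: "qltl_over F \<phi>" "qltl_props \<phi> \<subseteq> X \<union> Y"
    and fs: "fs = [fm_of_ltl X \<alpha>\<^sub>s, fm_of_ltl X \<alpha>\<^sub>c, fm_of_qltl X \<phi>]"
    and ivec_in: "ivec fs \<in> set vs"
    and vs_closed: "\<And>V D. V \<in> set vs \<Longrightarrow> D \<subseteq> set (props True fs) \<union> set (props False fs) \<Longrightarrow> vstep D fs V \<in> set vs"
    and init_in: "map (\<lambda>V. (V, V)) vs \<in> set S"
    and S_closed: "\<And>s D. s \<in> set S \<Longrightarrow> D \<subseteq> set (props True fs) \<union> set (props False fs) \<Longrightarrow> sstep D fs s \<in> set S"
begin

sublocale game fs S .

declare mv.simps [simp del]

abbreviation "xs \<equiv> set (props True fs)"
abbreviation "ys \<equiv> set (props False fs)"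

lemma occs_fs: "(b, p) \<in> set (concat (map occs fs)) \<Longrightarrow> p \<in> X \<union> Y \<and> b = (p \<in> X)"
  using safe(2) cosafe(2) over(2) by (auto simp: fs set_occs_ltl set_occs_qltl)

lemma xs_X: "xs \<subseteq> X" and ys_Y: "ys \<subseteq> Y"
  unfolding props_def by (auto dest!: occs_fs simp del: set_concat)

lemma occs_in: "(b, p) \<in> set (concat (map occs fs)) \<Longrightarrow> p \<in> xs \<union> ys"
  unfolding props_def by (cases b) (force simp del: set_concat)+

text \<open>\<open>X\<close> and \<open>Y\<close> may be infinite, but the automaton sees only the
  propositions that occur in the formulas.\<close>

definition restrict :: "nat set \<Rightarrow> nat set" where
  "restrict a = a \<inter> (xs \<union> ys)"

text \<open>The automaton state reached by \<open>u\<close>, in closed form; \<open>sg_snoc\<close>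
  shows that it evolves by \<open>sstep\<close>.\<close>

definition sg :: "nat set list \<Rightarrow> state" where
  "sg u = map (\<lambda>V. (V, foldr (\<lambda>a. vstep a fs) (map restrict u) V)) vs"

lemma sg_snoc: "sstep (restrict a) fs (sg u) = sg (u @ [a])"
proof -
  have "lookup (vstep (restrict a) fs V) (sg u) =
      foldr (\<lambda>a. vstep a fs) (map restrict u) (vstep (restrict a) fs V)" if "V \<in> set vs" for V
    unfolding sg_def by (rule lookup_map) (rule vs_closed[OF that], simp add: restrict_def)
  then show ?thesis by (simp add: sstep_map sg_def)
qed

lemma sg_Nil: "sg [] = map (\<lambda>V. (V, V)) vs"
  by (simp add: sg_def)

lemma sg_in: "sg u \<in> set S"
proof (induction u rule: rev_induct)
  case (snoc a u)
  have "restrict a \<subseteq> xs \<union> ys" by (simp add: restrict_def)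
  from S_closed[OF snoc this] show ?case by (simp add: sg_snoc)
qed (simp add: sg_Nil init_in)

lemma lookup_sg:
  "lookup (ivec fs) (sg u) = foldr (\<lambda>a. vstep a fs) (map restrict u) (ivec fs)"
  unfolding sg_def by (rule lookup_map[OF ivec_in])

lemma foldr_restrict:
  assumes "i < length fs"
  shows "foldr (\<lambda>a. step a (fs ! i)) (map restrict u) t = foldr (\<lambda>a. step a (fs ! i)) u t"
proof -
  have wf: "wf_fm (fs ! i)" using assms by (auto simp: fs nth_Cons' wf_fm_of_ltl wf_fm_of_qltl)
  have "set (occs (fs ! i)) \<subseteq> set (concat (map occs fs))" using nth_mem[OF assms] by auto
  then have "step (restrict a) (fs ! i) t = step a (fs ! i) t" for a t
    using occs_in by (intro step_cong[OF _ wf]) (auto simp: restrict_def simp del: set_concat)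
  then show ?thesis by (induction u) auto
qed

lemma sg_root:
  assumes "i < 3"
  shows "root (lookup (ivec fs) (sg u) ! i) = val (if i = 0 then 1 else 0) (fs ! i) u"
proof -
  have l: "length (ivec fs) = length fs" "i < length fs" using assms by (auto simp: ivec_def fs)
  have "ivec fs ! i = ini (if i = 0 then 1 else 0) (fs ! i)"
    using assms by (auto simp: ivec_def nth_Cons' less_Suc_eq numeral_3_eq_3 fs)
  then show ?thesis
    using foldr_vstep_nth[OF l(1), of "map restrict u"] l(2)
    by (simp add: lookup_sg val_def foldr_restrict)
qed

lemma bad_sg: "bad fs (sg u) \<longleftrightarrow> val 1 (fm_of_ltl X \<alpha>\<^sub>s) u \<le> 0"
  using sg_root[of 0] by (simp add: bad_def fs)

lemma good_sg: "good fs (sg u) \<longleftrightarrow> val 0 (fm_of_ltl X \<alpha>\<^sub>c) u = 1"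
  using sg_root[of 1] val_cosafe_01[OF cosafe(1), of X u] by (auto simp add: good_def fs)

lemma value_sg: "value_of fs (sg u) = val 0 (fm_of_qltl X \<phi>) u"
  using sg_root[of 2] by (simp add: value_of_def fs)

lemma value_sg_qltl: "u \<noteq> [] \<Longrightarrow> value_of fs (sg u) = qltl_val u 0 \<phi> \<and> qltl_val u 0 \<phi> \<in> {0..1}"
  using val_qltl[OF unit over(1), of 0 u X] by (simp add: value_sg)

lemma \<delta>_sg: "set A \<union> set B = restrict a \<Longrightarrow> \<delta> (sg u) A B = sg (u @ [a])"
  by (simp add: \<delta>_def sg_snoc)

lemma \<delta>_closed: "s \<in> set S \<Longrightarrow> A \<in> set As \<Longrightarrow> B \<in> set Bs \<Longrightarrow> \<delta> s A B \<in> set S"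
  unfolding \<delta>_def As_def Bs_def by (intro S_closed) (auto dest!: in_sublists)

text \<open>The winning condition of a play that never ends, obtained from the two prefix
  characterisations.\<close>

lemma ltl_falsified:
  "\<not> ltl_sem w 0 (And \<alpha>\<^sub>s \<alpha>\<^sub>c) \<longleftrightarrow> (\<exists>n. bad fs (sg (prefix n w))) \<or> (\<forall>n. \<not> good fs (sg (prefix n w)))"
  by (simp add: safe_iff_prefix[OF safe(1), where X = X] cosafe_iff_prefix[OF cosafe(1), where X = X]
      bad_sg good_sg seg_eq_prefix)

lemma good_mono: "n \<le> m \<Longrightarrow> good fs (sg (prefix n w)) \<Longrightarrow> good fs (sg (prefix m w))"
  using val_cosafe_mono[OF cosafe(1), of n m X w 0] by (simp add: good_sg seg_eq_prefix)

lemma bad_mono: "n \<le> m \<Longrightarrow> bad fs (sg (prefix n w)) \<Longrightarrow> bad fs (sg (prefix m w))"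
  using val_safe_mono[OF safe(1), of n m X w 0] by (simp add: bad_sg seg_eq_prefix)

text \<open>There may be infinitely many traces, but by \<open>finite_qltl_values\<close> only
  finitely many values, so the minimum in \<open>bgv\<close> is a genuine one.\<close>

lemma bgv_le: "\<pi> \<in> fin_traces X \<sigma> \<Longrightarrow> bgv X \<phi> \<sigma> \<le> qltl_val \<pi> 0 \<phi>"
proof -
  assume "\<pi> \<in> fin_traces X \<sigma>"
  moreover have "finite ((\<lambda>\<pi>. qltl_val \<pi> 0 \<phi>) ` fin_traces X \<sigma>)"
    by (rule finite_subset[OF _ finite_qltl_values[of \<phi>]]) auto
  ultimately show ?thesis unfolding bgv_def by auto
qed

lemma bgv_attained: "fin_traces X \<sigma> \<noteq> {} \<Longrightarrow> \<exists>\<pi>\<in>fin_traces X \<sigma>. bgv X \<phi> \<sigma> = qltl_val \<pi> 0 \<phi>"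
proof -
  assume ne: "fin_traces X \<sigma> \<noteq> {}"
  have "finite ((\<lambda>\<pi>. qltl_val \<pi> 0 \<phi>) ` fin_traces X \<sigma>)"
    by (rule finite_subset[OF _ finite_qltl_values[of \<phi>]]) auto
  from Min_in[OF this] ne show ?thesis unfolding bgv_def by auto
qed

lemma fin_traces_ne: "\<pi> \<in> fin_traces X \<sigma> \<Longrightarrow> \<pi> \<noteq> []"
  by (auto simp: fin_traces_def ends_at_def)

lemma bgv_nonneg: "0 \<le> bgv X \<phi> \<sigma>"
proof (cases "fin_traces X \<sigma> = {}")
  case False
  from bgv_attained[OF this] obtain \<pi> where \<pi>: "\<pi> \<in> fin_traces X \<sigma>" "bgv X \<phi> \<sigma> = qltl_val \<pi> 0 \<phi>" by blast
  show ?thesis using value_sg_qltl[OF fin_traces_ne[OF \<pi>(1)]] \<pi>(2) by simp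
qed (simp add: bgv_def)


declare subseq_to_Suc [simp del]

subsection \<open>The machine guarantees its threshold\<close>

context
  fixes b :: real and w :: "nat set word"
  assumes live0: "sg [] \<in> set (live b)" and w: "w \<in> env_words X"
begin

abbreviation "M \<equiv> machine (sg []) b"
abbreviation "\<tau> \<equiv> strategy_of M"

definition q :: "nat \<Rightarrow> sexp" where
  "q n = foldl (\<lambda>q a. snd (transducer_step M q a)) (initial M) (prefix n w)"

lemma q_0: "q 0 = mode_state True (sg [])"
  by (simp add: q_def machine_def)

lemma q_Suc: "q (Suc n) = snd (transducer_step M (q n) (w n))"
  by (simp add: q_def subseq_to_Suc)

lemma \<tau>_Suc: "\<tau> (prefix (Suc n) w) = fst (transducer_step M (q n) (w n))"
  by (simp add: strategy_of_def q_def subseq_to_Suc)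

lemma ex_A: "\<exists>A\<in>set As. set A = w n \<inter> xs"
  unfolding As_def by (rule ex_sublists) simp

text \<open>The step that keeps the state stored in the transducer equal to \<open>sg\<close> of the
  induced trace.\<close>

lemma machine_output:
  assumes "q n = mode_state m (sg (prefix n (inf_trace \<tau> w)))"
    and nl: "sg (prefix n (inf_trace \<tau> w)) \<notin> set (lose b)"
    and A: "A \<in> set As" "set A = w n \<inter> xs"
    and mv: "mv b (m, sg (prefix n (inf_trace \<tau> w))) A = Some (B, m', s')"
  shows "\<tau> (prefix (Suc n) w) = (set B, b \<le> value_of fs s')"
    "q (Suc n) = done_or (b \<le> value_of fs s') (mode_state m' s')"
    "s' = sg (prefix (Suc n) (inf_trace \<tau> w))"
proof -
  let ?u = "prefix n (inf_trace \<tau> w)"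
  note st = machine_step[OF A(1) sg_in A(2), of "sg []" b m ?u]
  note * = mv_Some[OF sg_in nl mv]
  show out: "\<tau> (prefix (Suc n) w) = (set B, b \<le> value_of fs s')"
    and qs: "q (Suc n) = done_or (b \<le> value_of fs s') (mode_state m' s')"
    by (simp_all only: \<tau>_Suc q_Suc assms st option.case prod.case fst_conv snd_conv)
  have B: "set B \<subseteq> ys" using *(1) in_sublists by (auto simp: Bs_def)
  have "w n \<subseteq> X" using w by (simp add: env_words_def)
  then have wn: "w n \<inter> ys = {}" using ys_Y disj by blast
  have "set A \<union> set B = restrict (inf_trace \<tau> w n)"
    using B A(2) wn by (auto simp: restrict_def inf_trace_def out)
  from \<delta>_sg[OF this, of ?u] show "s' = sg (prefix (Suc n) (inf_trace \<tau> w))"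
    using *(2) by (simp add: subseq_to_Suc)
qed

lemma q_invariant:
  "q n = Sym 0 \<or> (\<exists>m. q n = mode_state m (sg (prefix n (inf_trace \<tau> w))) \<and>
     sg (prefix n (inf_trace \<tau> w)) \<notin> set (lose b))"
proof (induction n)
  case 0
  then show ?case using q_0 live_not_lose[OF live0] by auto
next
  case (Suc n)
  show ?case
  proof (cases "q n = Sym 0")
    case True
    then show ?thesis by (simp add: q_Suc machine_step_done)
  next
    case False
    let ?u = "prefix n (inf_trace \<tau> w)"
    from Suc False obtain m where m: "q n = mode_state m (sg ?u)" "sg ?u \<notin> set (lose b)" by auto
    obtain A where A: "A \<in> set As" "set A = w n \<inter> xs" using ex_A by blast
    note st = machine_step[OF A(1) sg_in A(2), of "sg []" b m ?u]
    show ?thesis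
    proof (cases "mv b (m, sg ?u) A")
      case None
      then show ?thesis by (simp add: q_Suc m st)
    next
      case (Some r)
      obtain B m' s' where r: "r = (B, m', s')" by (cases r)
      note * = machine_output[OF m A Some[unfolded r]]
      note ** = mv_Some(4)[OF sg_in m(2) Some[unfolded r]]
      show ?thesis
      proof (cases "b \<le> value_of fs s'")
        case False
        then show ?thesis using *(2,3) ** by auto
      qed (simp add: *(2))
    qed
  qed
qed

text \<open>The flag \<open>end\<close> is output only on a transition into the sink from outside.
  As the sink is never left, this also gives uniqueness of the end.\<close>

lemma ends_machine:
  assumes "ends_at \<tau> w n"
  shows "b \<le> qltl_val (prefix n (inf_trace \<tau> w)) 0 \<phi>" "q n = Sym 0" "q (n - 1) \<noteq> Sym 0"
proof -
  obtain k where k: "n = Suc k" using assms by (cases n) (auto simp: ends_at_def)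
  have e: "snd (fst (transducer_step M (q k) (w k)))" using assms by (simp add: k ends_at_def \<tau>_Suc)
  then show "q (n - 1) \<noteq> Sym 0" by (auto simp: k machine_step_done)
  let ?u = "prefix k (inf_trace \<tau> w)"
  from q_invariant[of k] e obtain m where m: "q k = mode_state m (sg ?u)" "sg ?u \<notin> set (lose b)"
    by (auto simp: machine_step_done)
  obtain A where A: "A \<in> set As" "set A = w k \<inter> xs" using ex_A by blast
  note st = machine_step[OF A(1) sg_in A(2), of "sg []" b m ?u]
  from e have "mv b (m, sg ?u) A \<noteq> None" by (intro notI) (simp add: m st)
  then obtain B m' s' where mv: "mv b (m, sg ?u) A = Some (B, m', s')" by auto
  note * = machine_output[OF m A mv]
  have b: "b \<le> value_of fs s'" using assms by (simp add: k ends_at_def *(1))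
  then show "q n = Sym 0" by (simp add: k *(2))
  show "b \<le> qltl_val (prefix n (inf_trace \<tau> w)) 0 \<phi>"
    using b value_sg_qltl[of "prefix n (inf_trace \<tau> w)"] by (simp add: k *(3))
qed

lemma q_done_stays: "q n = Sym 0 \<Longrightarrow> n \<le> k \<Longrightarrow> q k = Sym 0"
  by (rotate_tac, induction k rule: dec_induct) (auto simp: q_Suc machine_step_done)

lemma machine_ends_once: "\<exists>\<^sub>\<le>\<^sub>1 n. ends_at \<tau> w n"
proof -
  have False if "ends_at \<tau> w n" "ends_at \<tau> w k" "n < k" for n k
    using ends_machine(2)[OF that(1)] ends_machine(3)[OF that(2)] q_done_stays[of n "k - 1"] that(3) by linarith
  then show ?thesis by (intro Uniq_I) (metis linorder_neqE_nat)
qed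

text \<open>If no prefix is bad, \<open>mv\<close> never fails, so the machine never reaches the
  sink and the play is endless in the sense of the game. From some point on no state is then good,
  and since good states persist, none ever was.\<close>

lemma machine_constrained:
  assumes no_end: "\<not> (\<exists>n. ends_at \<tau> w n)"
  shows "\<not> ltl_sem (inf_trace \<tau> w) 0 (And \<alpha>\<^sub>s \<alpha>\<^sub>c)"
proof (cases "\<exists>n. bad fs (sg (prefix n (inf_trace \<tau> w)))")
  case True
  then show ?thesis by (simp add: ltl_falsified del: ltl_sem.simps)
next
  case not_bad: False
  define s where "s n = sg (prefix n (inf_trace \<tau> w))" for n
  obtain A where A: "\<And>n. A n \<in> set As" "\<And>n. set (A n) = w n \<inter> xs" using ex_A by metis
  have act: "\<exists>m. q n = mode_state m (s n) \<and> s n \<notin> set (lose b)" for n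
  proof (induction n)
    case 0
    then show ?case using q_0 live_not_lose[OF live0] by (auto simp: s_def)
  next
    case (Suc n)
    then obtain m where m: "q n = mode_state m (s n)" "s n \<notin> set (lose b)" by blast
    have "mv b (m, s n) (A n) \<noteq> None"
      using mv_None[OF _ m(2) A(1)] sg_in not_bad unfolding s_def by blast
    then obtain B m' s' where mv: "mv b (m, s n) (A n) = Some (B, m', s')" by auto
    note * = machine_output[OF m[unfolded s_def] A(1,2) mv[unfolded s_def]]
    have "\<not> ends_at \<tau> w (Suc n)" using no_end by blast
    then have "\<not> b \<le> value_of fs s'" by (simp add: ends_at_def *(1))
    then show ?case using *(2) q_invariant[of "Suc n"] by (auto simp: s_def mode_state_def)
  qed
  then obtain m where m: "\<And>n. q n = mode_state (m n) (s n)" "\<And>n. s n \<notin> set (lose b)" by metis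
  have "\<exists>N. \<forall>i\<ge>N. \<not> good fs (snd (m i, s i))"
  proof (rule endless_play_eventually_not_good[of "\<lambda>i. (m i, s i)" "sg []" b A])
    show "(m 0, s 0) = (True, sg [])" using m(1)[of 0] q_0 by (simp add: mode_state_inject)
    show "\<exists>B m' s'. mv b (m i, s i) (A i) = Some (B, m', s') \<and> \<not> b \<le> value_of fs s' \<and>
        (m (Suc i), s (Suc i)) = (m', s')" for i
    proof -
      have "mv b (m i, s i) (A i) \<noteq> None"
        using mv_None[OF _ m(2) A(1)] sg_in not_bad unfolding s_def by blast
      then obtain B m' s' where mv: "mv b (m i, s i) (A i) = Some (B, m', s')" by auto
      note * = machine_output[OF m(1)[unfolded s_def] m(2)[unfolded s_def] A(1,2) mv[unfolded s_def]]
      have "\<not> ends_at \<tau> w (Suc i)" using no_end by blast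
      then have "\<not> b \<le> value_of fs s'" by (simp add: ends_at_def *(1))
      then show ?thesis using *(2) m(1)[of "Suc i"] mv by (auto simp: mode_state_inject)
    qed
  qed (use live0 A(1) \<delta>_closed in auto)
  then obtain N where N: "\<And>i. i \<ge> N \<Longrightarrow> \<not> good fs (s i)" by auto
  have "\<not> good fs (s i)" for i
    using good_mono[of i "max i N" "inf_trace \<tau> w"] N[of "max i N"] by (auto simp: s_def)
  then show ?thesis unfolding ltl_falsified s_def by blast
qed

lemma machine_ending:
  assumes "ending b s u" "s \<in> set S" "s \<notin> set (lose b)" "q n = mode_state True s" "\<And>i. i < length u \<Longrightarrow> w (n + i) = set (u ! i)"
  shows "ends_at \<tau> w (n + length u)"
  using assms
proof (induction arbitrary: n)
  case (1 A s B m' s')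
  have A: "set A = w n \<inter> xs" using 1(7)[of 0] 1(1) in_sublists by (auto simp: As_def)
  note st = machine_step[OF 1(1,4) A, of "sg []" b True]
  show ?case using st by (simp add: ends_at_def \<tau>_Suc 1(2,3,6))
next
  case (2 A s B s' u)
  have A: "set A = w n \<inter> xs" using 2(9)[of 0] 2(1) in_sublists by (auto simp: As_def)
  note st = machine_step[OF 2(1,6) A, of "sg []" b True]
  note * = mv_Some[OF 2(6,7) 2(2)]
  have "q (Suc n) = mode_state True s'" using st by (simp add: q_Suc 2(2,3,8))
  moreover have "s' \<in> set S" using *(1,2) \<delta>_closed 2(1,6) by simp
  ultimately have "ends_at \<tau> w (Suc n + length u)"
    using 2(9)[of "Suc i" for i] *(4)[OF 2(3)] by (intro 2(5)) auto
  then show ?case by simp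
qed

end

lemma machine_output_Y: "fst (fst (transducer_step (machine s0 b) p a)) \<subseteq> Y"
proof -
  have E: "set (fst (snd (snd e))) \<subseteq> ys \<or> e \<in> set acc"
    if "e \<in> set (entries vl As b p m f acc)" and f: "\<forall>A B s'. f A = Some (B, s') \<longrightarrow> set B \<subseteq> ys"
    for e vl b p m f acc and As
    using that(1) unfolding entries_def
  proof (induction As)
    case (Cons A As)
    show ?case
    proof (cases "f A")
      case None
      then show ?thesis using Cons by (auto split: if_splits)
    next
      case (Some r)
      obtain B s' where r: "r = (B, s')" by (cases r)
      then have "set B \<subseteq> ys" using f Some by blast
      then show ?thesis using Cons Some r by auto
    qed
  qed auto
  have "set B \<subseteq> ys" if "pick b p Z s A = Some (B, s')" for p Z s A B s'
    using pick_Some[OF that] in_sublists unfolding Bs_def by blast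
  then have f: "\<forall>A B s'. move0 b s A = Some (B, s') \<longrightarrow> set B \<subseteq> ys"
    "\<forall>A B s'. move1 b s A = Some (B, s') \<longrightarrow> set B \<subseteq> ys" for s
    unfolding move0_def move1_def by (metis, metis)
  have "e \<in> set (foldr (add_rows b) ss []) \<Longrightarrow>
     set (fst (snd (snd e))) \<subseteq> ys" for e ss
  proof (induction ss)
    case (Cons s ss)
    then show ?case unfolding foldr_Cons o_apply add_rows_def by (auto dest!: E[OF _ f(1)] E[OF _ f(2)])
  qed simp
  then have rows: "e \<in> set (rows b) \<Longrightarrow> set (fst (snd (snd e))) \<subseteq> Y" for e
    using ys_Y unfolding rows_def by blast
  show ?thesis
  proof (cases "find (\<lambda>(p', A, _). p' = p \<and> set A = a \<inter> set (observed (machine s0 b))) (rows b)")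
    case (Some e)
    then have "e \<in> set (rows b)" unfolding find_Some_iff by (metis nth_mem)
    from rows[OF this] Some show ?thesis
      by (cases e) (simp add: transducer_step_def machine_def)
  qed (simp add: transducer_step_def machine_def)
qed

lemma machine_strategy:
  assumes "sg [] \<in> set (live b)"
  shows "constrained_strategy X Y (And \<alpha>\<^sub>s \<alpha>\<^sub>c) (strategy_of (machine (sg []) b))"
  unfolding constrained_strategy_def is_strategy_def
proof (intro conjI allI ballI impI)
  show "fst (strategy_of (machine (sg []) b) u) \<subseteq> Y" for u
    using machine_output_Y by (simp add: strategy_of_def)
  fix w assume w: "w \<in> env_words X"
  show "\<exists>\<^sub>\<le>\<^sub>1 n. ends_at (strategy_of (machine (sg []) b)) w n"
    by (rule machine_ends_once[OF assms w])
  show "(\<exists>n. ends_at (strategy_of (machine (sg []) b)) w n) \<or>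
      \<not> ltl_sem (inf_trace (strategy_of (machine (sg []) b)) w) 0 (And \<alpha>\<^sub>s \<alpha>\<^sub>c)"
    using machine_constrained[OF assms w] by blast
qed

text \<open>Without an actual ending play the guaranteed value would be 0 by convention, however
  large \<open>b\<close> is.\<close>

lemma machine_traces:
  assumes "sg [] \<in> set (live b)"
  shows "fin_traces X (strategy_of (machine (sg []) b)) \<noteq> {}"
proof -
  obtain u where u: "ending b (sg []) u" using live_ending[OF assms] by blast
  then have uA: "set u \<subseteq> set As" by induction auto
  define w where "w = (\<lambda>i. if i < length u then set (u ! i) else {})"
  have "set (u ! i) \<subseteq> X" if "i < length u" for i
    using nth_mem[OF that] uA in_sublists xs_X unfolding As_def by blast
  then have w: "w \<in> env_words X" by (auto simp: env_words_def w_def)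
  have "ends_at (strategy_of (machine (sg []) b)) w (0 + length u)"
    by (rule machine_ending[OF assms w u sg_in live_not_lose[OF assms] q_0[OF assms w]])
      (simp add: w_def)
  then show ?thesis using w unfolding fin_traces_def by auto
qed

lemma machine_bgv:
  assumes "sg [] \<in> set (live b)"
  shows "b \<le> bgv X \<phi> (strategy_of (machine (sg []) b))"
proof -
  let ?\<sigma> = "strategy_of (machine (sg []) b)"
  obtain \<pi> where \<pi>: "\<pi> \<in> fin_traces X ?\<sigma>" "bgv X \<phi> ?\<sigma> = qltl_val \<pi> 0 \<phi>"
    using bgv_attained[OF machine_traces[OF assms]] by blast
  then obtain w n where "w \<in> env_words X" "ends_at ?\<sigma> w n" "\<pi> = prefix n (inf_trace ?\<sigma> w)"
    unfolding fin_traces_def by blast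
  then show ?thesis using ends_machine(1)[OF assms] \<pi>(2) by simp
qed


subsection \<open>No strategy guarantees more\<close>

definition tr :: "strategy \<Rightarrow> nat set list \<Rightarrow> nat set list" where
  "tr \<sigma> u = map (\<lambda>i. u ! i \<union> fst (\<sigma> (take (Suc i) u))) [0..<length u]"

lemma tr_snoc: "tr \<sigma> (u @ [x]) = tr \<sigma> u @ [x \<union> fst (\<sigma> (u @ [x]))]"
  by (auto simp: tr_def nth_append)

lemma tr_prefix: "tr \<sigma> (prefix n w) = prefix n (inf_trace \<sigma> w)"
  by (rule nth_equalityI) (simp_all add: tr_def inf_trace_def min_absorb1)

definition no_end :: "strategy \<Rightarrow> nat set list \<Rightarrow> bool" where
  "no_end \<sigma> u \<longleftrightarrow> (\<forall>k. 1 \<le> k \<and> k \<le> length u \<longrightarrow> \<not> snd (\<sigma> (take k u)))"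

lemma no_end_snoc: "no_end \<sigma> (u @ [x]) \<longleftrightarrow> no_end \<sigma> u \<and> \<not> snd (\<sigma> (u @ [x]))"
  by (auto simp: no_end_def le_Suc_eq)

context
  fixes \<sigma> :: strategy and b :: real
  assumes \<sigma>: "constrained_strategy X Y (And \<alpha>\<^sub>s \<alpha>\<^sub>c) \<sigma>" and ne: "fin_traces X \<sigma> \<noteq> {}"
    and b: "b = bgv X \<phi> \<sigma>"
begin

text \<open>Continued by empty letters, the history becomes an environment word on which the
  strategy ends exactly here, so its trace counts for the minimum.\<close>

lemma end_value:
  assumes "set (u @ [x]) \<subseteq> Pow X" "snd (\<sigma> (u @ [x]))"
  shows "b \<le> value_of fs (sg (tr \<sigma> (u @ [x])))"
proof -
  let ?w = "(u @ [x]) \<frown> (\<lambda>_. {})"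
  have p: "prefix (Suc (length u)) ?w = u @ [x]" using prefix_conc_length[of "u @ [x]"] by simp
  have "range ?w \<subseteq> Pow X" unfolding range_conc using assms(1) by auto
  then have w: "?w \<in> env_words X" by (auto simp: env_words_def simp del: range_conc)
  have "ends_at \<sigma> ?w (Suc (length u))" using assms(2) p by (simp add: ends_at_def)
  then have t: "tr \<sigma> (u @ [x]) \<in> fin_traces X \<sigma>"
    unfolding fin_traces_def using w p tr_prefix[of \<sigma> ?w "Suc (length u)"] by force
  then show ?thesis using bgv_le[OF t] value_sg_qltl[OF fin_traces_ne[OF t]] b by simp
qed

text \<open>The reply of the strategy, cut down to the observed agent propositions, is a move of the
  game, and \<open>sg\<close> does not notice the cut.\<close>

lemma strategy_move:
  assumes "A \<in> set As" "set u \<subseteq> Pow X"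
  shows "\<exists>B\<in>set Bs. \<delta> (sg (tr \<sigma> u)) A B = sg (tr \<sigma> (u @ [set A])) \<and> set (u @ [set A]) \<subseteq> Pow X"
proof -
  let ?a = "set A \<union> fst (\<sigma> (u @ [set A]))"
  have A: "set A \<subseteq> xs" using assms(1) in_sublists by (auto simp: As_def)
  then have u: "set (u @ [set A]) \<subseteq> Pow X" using assms(2) xs_X by auto
  then have Y: "fst (\<sigma> (u @ [set A])) \<subseteq> Y"
    using \<sigma> unfolding constrained_strategy_def is_strategy_def by blast
  have "restrict ?a - set A \<subseteq> ys" using Y xs_X disj by (auto simp: restrict_def)
  then obtain B where B: "B \<in> set Bs" "set B = restrict ?a - set A"
    using ex_sublists unfolding Bs_def by blast
  have "set A \<union> set B = restrict ?a" using B(2) A by (auto simp: restrict_def)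
  from \<delta>_sg[OF this, of "tr \<sigma> u"] B(1) u show ?thesis by (auto simp: tr_snoc)
qed

text \<open>Otherwise the environment could hold the play in its trap outside \<open>win b\<close>.
  No state there is bad, by \<open>end_value\<close> the strategy cannot end, and the state remains
  good; the limit play satisfies both formulas without ending, against the constraint.\<close>

lemma good_win:
  assumes "set u \<subseteq> Pow X" "no_end \<sigma> u" "good fs (sg (tr \<sigma> u))"
  shows "sg (tr \<sigma> u) \<in> set (win b)"
proof (rule ccontr)
  assume nw: "sg (tr \<sigma> u) \<notin> set (win b)"
  let ?P = "\<lambda>v. set v \<subseteq> Pow X \<and> no_end \<sigma> v \<and> sg (tr \<sigma> v) \<notin> set (win b)"
  have ext: "\<exists>x. ?P (v @ [x])" if "?P v" for v
  proof -
    have "\<exists>A\<in>set As. \<forall>B\<in>set Bs. \<not> b \<le> value_of fs (\<delta> (sg (tr \<sigma> v)) A B) \<and> \<delta> (sg (tr \<sigma> v)) A B \<notin> set (win b)"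
      using not_win[OF sg_in, of "tr \<sigma> v" b] that by simp
    then obtain A where A: "A \<in> set As"
      "\<forall>B\<in>set Bs. \<not> b \<le> value_of fs (\<delta> (sg (tr \<sigma> v)) A B) \<and> \<delta> (sg (tr \<sigma> v)) A B \<notin> set (win b)"
      by blast
    from strategy_move[OF A(1), of v] that obtain B where B: "B \<in> set Bs"
      "\<delta> (sg (tr \<sigma> v)) A B = sg (tr \<sigma> (v @ [set A]))" "set (v @ [set A]) \<subseteq> Pow X" by blast
    have "\<not> snd (\<sigma> (v @ [set A]))" using end_value[OF B(3)] A(2) B(1,2) by fastforce
    then show ?thesis using A(2) B that by (auto simp: no_end_snoc intro!: exI[of _ "set A"])
  qed
  define nx where "nx v = (SOME x. ?P (v @ [x]))" for v
  \<comment> \<open>Histories that extend each other by trap moves of the environment;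
    \<open>w\<close> below is their limit.\<close>
  define g where "g = rec_nat u (\<lambda>_ v. v @ [nx v])"
  have g_Suc: "g (Suc n) = g n @ [nx (g n)]" for n by (simp add: g_def)
  have g: "?P (g n)" for n
  proof (induction n)
    case 0
    then show ?case using assms(1,2) nw by (simp add: g_def)
  next
    case (Suc n)
    from someI_ex[OF ext[OF Suc]] show ?case unfolding g_Suc nx_def .
  qed
  have len: "length (g n) = length u + n" for n
    by (induction n) (auto simp: g_def)
  have take: "take (length (g n)) (g m) = g n" if "n \<le> m" for n m
    using that
  proof (induction m rule: dec_induct)
    case (step m)
    then show ?case using len by (simp add: g_Suc)
  qed simp
  define w where "w = (\<lambda>i. g (Suc i) ! i)"
  have pre: "prefix k w = take k (g n)" if "k \<le> length (g n)" for k n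
  proof (rule nth_equalityI)
    fix i assume "i < length (prefix k w)"
    then have i: "i < k" by simp
    have "g (Suc i) ! i = g n ! i"
    proof (cases "Suc i \<le> n")
      case True
      then have "g (Suc i) ! i = take (length (g (Suc i))) (g n) ! i" using take by simp
      then show ?thesis using len by simp
    next
      case False
      then have "g n ! i = take (length (g n)) (g (Suc i)) ! i" using take[of n "Suc i"] by simp
      then show ?thesis using that i by simp
    qed
    then show "prefix k w ! i = take k (g n) ! i" using i that by (simp add: w_def)
  qed (use that in simp)
  have w: "w \<in> env_words X"
  proof -
    have "w i \<in> set (g (Suc i))" for i unfolding w_def using len[of "Suc i"] by (intro nth_mem) simp
    then show ?thesis using g unfolding env_words_def by blast
  qed
  have "\<not> ends_at \<sigma> w k" for k
  proof -
    have "no_end \<sigma> (g k)" "k \<le> length (g k)" using g len by auto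
    then show ?thesis using pre[of k k] by (auto simp: ends_at_def no_end_def)
  qed
  with \<sigma> w have f: "\<not> ltl_sem (inf_trace \<sigma> w) 0 (And \<alpha>\<^sub>s \<alpha>\<^sub>c)" unfolding constrained_strategy_def by blast
  have sg: "sg (prefix (length u + n) (inf_trace \<sigma> w)) = sg (tr \<sigma> (g n))" for n
    using pre[of "length (g n)" n] len[of n] by (simp flip: tr_prefix)
  have "\<not> bad fs (sg (prefix n (inf_trace \<sigma> w)))" for n
    using bad_mono[of n "length u + n" "inf_trace \<sigma> w"] sg[of n] not_win[OF sg_in, of "tr \<sigma> (g n)" b] g[of n] by auto
  moreover have "good fs (sg (prefix (length u) (inf_trace \<sigma> w)))"
    using sg[of 0] assms(3) by (simp add: g_def)
  ultimately show False using f unfolding ltl_falsified by blast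
qed

text \<open>The states met while the strategy has not ended form an invariant for
  \<open>invariant_not_lose\<close>, with \<open>good_win\<close> as its first premise. Along one
  ending play, \<open>live_step\<close> then carries membership in \<open>live b\<close> from the
  end back to the start.\<close>

lemma strategy_live: "sg [] \<in> set (live b)"
proof -
  define H where "H = {sg (tr \<sigma> u) | u. set u \<subseteq> Pow X \<and> no_end \<sigma> u}"
  have H: "H \<inter> set (lose b) = {}"
  proof (rule invariant_not_lose)
    show "s \<in> H \<Longrightarrow> good fs s \<Longrightarrow> s \<in> set (win b)" for s unfolding H_def using good_win by blast
    fix s A assume "s \<in> H" "A \<in> set As"
    then obtain u where u: "s = sg (tr \<sigma> u)" "set u \<subseteq> Pow X" "no_end \<sigma> u" by (auto simp: H_def)
    from strategy_move[OF \<open>A \<in> set As\<close> u(2)] obtain B where B: "B \<in> set Bs"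
      "\<delta> s A B = sg (tr \<sigma> (u @ [set A]))" "set (u @ [set A]) \<subseteq> Pow X" unfolding u(1) by blast
    show "\<exists>B\<in>set Bs. b \<le> value_of fs (\<delta> s A B) \<or> \<delta> s A B \<in> H"
    proof (cases "snd (\<sigma> (u @ [set A]))")
      case True
      then show ?thesis using end_value[OF B(3)] B by (intro bexI[of _ B]) auto
    next
      case False
      then have "\<delta> s A B \<in> H" unfolding H_def mem_Collect_eq
        using B u(3) by (intro exI[of _ "u @ [set A]"]) (auto simp: no_end_snoc)
      then show ?thesis using B(1) by blast
    qed
  qed
  from ne obtain w n where w: "w \<in> env_words X" "ends_at \<sigma> w n" unfolding fin_traces_def by blast
  have uniq: "\<not> ends_at \<sigma> w k" if "k \<noteq> n" for k
    using \<sigma> w that unfolding constrained_strategy_def is_strategy_def by (metis Uniq_D)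
  have pX: "set (prefix k w) \<subseteq> Pow X" for k using w(1) by (auto simp: env_words_def)
  have in_H: "sg (tr \<sigma> (prefix k w)) \<in> H" if "k < n" for k
  proof -
    have "no_end \<sigma> (prefix k w)"
      using uniq that by (auto simp: no_end_def ends_at_def min_absorb1)
    then show ?thesis unfolding H_def using pX by blast
  qed
  \<comment> \<open>\<open>strategy_move\<close> covers only letters of observed propositions. Those
    of \<open>w\<close> may contain others, so the game move is their observed part.\<close>
  have backw: "sg (tr \<sigma> (prefix k w)) \<in> set (live b)"
    if "k < n" and nxt: "b \<le> value_of fs (sg (tr \<sigma> (prefix (Suc k) w))) \<or>
      sg (tr \<sigma> (prefix (Suc k) w)) \<in> set (live b)" for k
  proof -
    obtain A where A: "A \<in> set As" "set A = w k \<inter> xs" using ex_sublists[of "w k \<inter> xs"] unfolding As_def by auto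
    let ?a = "w k \<union> fst (\<sigma> (prefix (Suc k) w))"
    have Y: "fst (\<sigma> (prefix (Suc k) w)) \<subseteq> Y"
      using \<sigma> pX unfolding constrained_strategy_def is_strategy_def by blast
    have X: "w k \<subseteq> X" using w(1) by (simp add: env_words_def)
    have "restrict ?a - set A \<subseteq> ys" using Y X A(2) xs_X disj by (auto simp: restrict_def)
    then obtain B where B: "B \<in> set Bs" "set B = restrict ?a - set A"
      using ex_sublists unfolding Bs_def by blast
    have "set A \<union> set B = restrict ?a" using B(2) A(2) by (auto simp: restrict_def)
    from \<delta>_sg[OF this, of "tr \<sigma> (prefix k w)"]
    have "\<delta> (sg (tr \<sigma> (prefix k w))) A B = sg (tr \<sigma> (prefix (Suc k) w))"
      by (simp add: tr_snoc subseq_to_Suc)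
    then show ?thesis
      using live_step[OF sg_in _ A(1) B(1), of "tr \<sigma> (prefix k w)" b] in_H[OF that(1)] H nxt by auto
  qed
  have "sg (tr \<sigma> (prefix (n - Suc d) w)) \<in> set (live b)" if "d < n" for d
    using that
  proof (induction d)
    case 0
    then obtain k where k: "n = Suc k" by (cases n) auto
    have "b \<le> value_of fs (sg (tr \<sigma> (prefix k w @ [w k])))"
      using w(2) k pX[of n] by (intro end_value) (auto simp: ends_at_def simp flip: subseq_to_Suc)
    then show ?case using backw[of k] k by (simp add: subseq_to_Suc)
  next
    case (Suc d)
    then have "n - Suc d = Suc (n - Suc (Suc d))" by simp
    then show ?case using Suc backw[of "n - Suc (Suc d)"] by simp
  qed
  from this[of "n - 1"] w(2) show ?thesis by (simp add: ends_at_def tr_def)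
qed

end

text \<open>A strategy that always ends satisfies the constraint for any formulas. Hence some
  threshold is feasible and \<open>best\<close> is not \<open>None\<close>.\<close>

lemma immediate_end:
  fixes \<sigma> defines "\<sigma> \<equiv> \<lambda>u :: nat set list. ({} :: nat set, length u = 1)"
  shows "constrained_strategy X Y (And \<alpha>\<^sub>s \<alpha>\<^sub>c) \<sigma>" "fin_traces X \<sigma> \<noteq> {}"
proof -
  have e: "ends_at \<sigma> w n \<longleftrightarrow> n = 1" for w n by (auto simp: ends_at_def \<sigma>_def)
  show "constrained_strategy X Y (And \<alpha>\<^sub>s \<alpha>\<^sub>c) \<sigma>"
    unfolding constrained_strategy_def is_strategy_def e by (auto simp: \<sigma>_def Uniq_def)
  have "(\<lambda>_. {}) \<in> env_words X" by (simp add: env_words_def)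
  then show "fin_traces X \<sigma> \<noteq> {}" unfolding fin_traces_def e by auto
qed

lemma bgv_le_best:
  assumes "constrained_strategy X Y (And \<alpha>\<^sub>s \<alpha>\<^sub>c) \<sigma>" "fin_traces X \<sigma> \<noteq> {}"
  shows "\<exists>b. best (sg []) = Some b \<and> bgv X \<phi> \<sigma> \<le> b"
proof -
  obtain \<pi> where \<pi>: "\<pi> \<in> fin_traces X \<sigma>" "bgv X \<phi> \<sigma> = qltl_val \<pi> 0 \<phi>"
    using bgv_attained[OF assms(2)] by blast
  then have v: "value_of fs (sg \<pi>) = bgv X \<phi> \<sigma>" using value_sg_qltl[OF fin_traces_ne[OF \<pi>(1)]] by simp
  from best_Some[OF sg_in, of "sg []" \<pi>] strategy_live[OF assms refl] show ?thesis unfolding v by auto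
qed

text \<open>A competitor without finite traces has value 0, which is no better since all values are
  nonnegative; any other one is bounded by \<open>best\<close>, and the machine reaches this
  threshold.\<close>

theorem machine_optimal:
  "\<exists>b. best (sg []) = Some b \<and>
     bgv_optimal X Y (And \<alpha>\<^sub>s \<alpha>\<^sub>c) \<phi> (strategy_of (machine (sg []) b))"
proof -
  obtain b where b: "best (sg []) = Some b" using bgv_le_best[OF immediate_end] by blast
  note live = best_live[OF b]
  have "bgv X \<phi> \<sigma>' \<le> bgv X \<phi> (strategy_of (machine (sg []) b))"
    if "constrained_strategy X Y (And \<alpha>\<^sub>s \<alpha>\<^sub>c) \<sigma>'" for \<sigma>'
  proof (cases "fin_traces X \<sigma>' = {}")
    case True
    then show ?thesis using bgv_nonneg by (simp add: bgv_def)
  next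
    case False
    from bgv_le_best[OF that False] machine_bgv[OF live] b show ?thesis by auto
  qed
  then show ?thesis using b machine_strategy[OF live] unfolding bgv_optimal_def by (auto simp: not_less)
qed

end


section \<open>The program\<close>

abbreviation (input) "V0 \<equiv> EVar 0"
abbreviation (input) "V1 \<equiv> EVar 1"
abbreviation (input) "V2 \<equiv> EVar 2"
abbreviation (input) "V3 \<equiv> EVar 3"
abbreviation (input) "V4 \<equiv> EVar 4"
abbreviation (input) "nil \<equiv> ESym 0"
abbreviation (input) "yes \<equiv> ESym 1"

abbreviation (input) "p_eq \<equiv> 1 :: nat"
abbreviation (input) "p_mem \<equiv> 3 :: nat"
abbreviation (input) "p_assoc \<equiv> 5 :: nat"
abbreviation (input) "p_kids \<equiv> 6 :: nat"
abbreviation (input) "p_coll \<equiv> 7 :: nat"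
abbreviation (input) "p_colls \<equiv> 8 :: nat"
abbreviation (input) "p_sub1s \<equiv> 10 :: nat"
abbreviation (input) "p_subs \<equiv> 12 :: nat"
abbreviation (input) "p_ini \<equiv> 13 :: nat"
abbreviation (input) "p_inis \<equiv> 14 :: nat"
abbreviation (input) "p_roots \<equiv> 16 :: nat"
abbreviation (input) "p_step \<equiv> 17 :: nat"
abbreviation (input) "p_steps \<equiv> 18 :: nat"
abbreviation (input) "p_opval \<equiv> 19 :: nat"
abbreviation (input) "p_min \<equiv> 20 :: nat"
abbreviation (input) "p_max \<equiv> 21 :: nat"
abbreviation (input) "p_delta \<equiv> 23 :: nat"
abbreviation (input) "p_next \<equiv> 24 :: nat"
abbreviation (input) "p_new1 \<equiv> 26 :: nat"
abbreviation (input) "p_new \<equiv> 28 :: nat"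
abbreviation (input) "p_union \<equiv> 30 :: nat"
abbreviation (input) "p_closure \<equiv> 31 :: nat"
abbreviation (input) "p_bad \<equiv> 32 :: nat"
abbreviation (input) "p_good \<equiv> 33 :: nat"
abbreviation (input) "p_value \<equiv> 34 :: nat"
abbreviation (input) "p_picks \<equiv> 36 :: nat"
abbreviation (input) "p_pick \<equiv> 37 :: nat"
abbreviation (input) "p_all \<equiv> 39 :: nat"
abbreviation (input) "p_ex \<equiv> 41 :: nat"
abbreviation (input) "p_cond \<equiv> 42 :: nat"
abbreviation (input) "p_round \<equiv> 44 :: nat"
abbreviation (input) "p_solve \<equiv> 46 :: nat"
abbreviation (input) "p_regions \<equiv> 47 :: nat"
abbreviation (input) "p_best \<equiv> 49 :: nat"
abbreviation (input) "p_after \<equiv> 51 :: nat"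
abbreviation (input) "p_entries \<equiv> 53 :: nat"
abbreviation (input) "p_target \<equiv> 54 :: nat"
abbreviation (input) "p_rows \<equiv> 56 :: nat"
abbreviation (input) "p_copy \<equiv> 58 :: nat"

text \<open>There is no test for the kind of an atom, so \<open>ESymEq V0 V0\<close> is used to
  recognise symbols, and other atoms are compared as numbers in both directions. Functions would get
  stuck, whence the condition \<open>fn_free\<close> later.\<close>

definition "body_eq = EIf (EIsPair V0)
  (EIf (EIsPair V1)
    (EIf (ECall p_eq [EFst V0, EFst V1]) (ECall p_eq [ESnd V0, ESnd V1]) nil) nil)
  (EIf (EIsPair V1) nil
    (EIf (ESymEq V0 V0) (ESymEq V0 V1)
      (EIf (ESymEq V1 V1) nil (EIf (ELeq V0 V1) (ELeq V1 V0) nil))))"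

definition "body_mem = EIf (ECall p_eq [V0, V1]) yes V2"

definition "body_assoc = EIf (ECall p_eq [V0, EFst V1]) (ESnd V1) V2"

text \<open>Propositions carry data where other formulas have arguments, and function applications
  keep their arguments in a nested list.\<close>

definition "body_kids = EIf (ESymEq (EFst V0) (ESym 2)) nil
  (EIf (ESymEq (EFst V0) (ESym 9)) (EFst (ESnd (ESnd V0))) (ESnd V0))"

definition "body_coll = EIf (ESymEq (EFst V1) (ESym 2))
  (EIf (ESymEq (EFst (EFst (ESnd V1))) V0) (ECons (ESnd (EFst (ESnd V1))) V2) V2)
  (ECall p_colls [V0, ECall p_kids [V1], V2])"

definition "body_sub1 = ECons (ECons V0 V1) V2"

definition "body_sub = ECall p_sub1s [V1, V2, V2]"

definition "body_ini = ECons (ECons V0 (ECall p_inis [V0, ECall p_kids [V1], nil])) V2"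

definition "body_root = ECons (EFst V1) V2"

definition "body_step = ELet (ECall p_steps [V0, ECall p_kids [V1], ESnd V2])
  (ECons (ECall p_opval [V1, V2, V3, V0]) V0)"

definition "body_steps = EIf (EIsPair V1)
  (ECons (ECall p_step [V0, EFst V1, EFst V2]) (ECall p_steps [V0, ESnd V1, ESnd V2])) nil"

definition tag_case :: "nat \<Rightarrow> expr \<Rightarrow> expr \<Rightarrow> expr" where
  "tag_case n e1 e2 = EIf (ESymEq (EFst V1) (ESym n)) e1 e2"

text \<open>The variables are the letter, the formula, its values at the next position, and the
  values of its arguments at the current one. A letter is a pair of lists, so a proposition is
  sought in both halves. The number 0 has to be generated as the complement of 1.\<close>

definition "body_opval =
  tag_case 0 EOne
  (tag_case 1 (ECompl EOne)
  (tag_case 2 (EIf (ECall p_mem [ESnd (EFst (ESnd V1)), EFst V0, nil]) EOne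
     (EIf (ECall p_mem [ESnd (EFst (ESnd V1)), ESnd V0, nil]) EOne (ECompl EOne)))
  (tag_case 3 (ECompl (EFst (EFst V3)))
  (tag_case 4 (ECall p_min [EFst (EFst V3), EFst (EFst (ESnd V3))])
  (tag_case 5 (ECall p_max [EFst (EFst V3), EFst (EFst (ESnd V3))])
  (tag_case 6 (EFst (EFst (ESnd V2)))
  (tag_case 7 (ECall p_max [EFst (EFst (ESnd V3)), ECall p_min [EFst (EFst V3), EFst V2]])
  (tag_case 8 (ECall p_min [EFst (EFst (ESnd V3)), ECall p_max [EFst (EFst V3), EFst V2]])
  (EApply (EFst (ESnd V1)) (ECall p_roots [nil, V3, nil]))))))))))"

definition "body_min = EIf (ELeq V0 V1) V0 V1"

definition "body_max = EIf (ELeq V0 V1) V1 V0"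

section \<open>Transitions and closure in the program\<close>

definition "body_delta = ECons
  (ECons (EFst V1) (ECall p_assoc
    [ECall p_steps [EFst (EFst V0), ESnd (EFst V0), EFst V1], ESnd V0, nil])) V2"

text \<open>The flag chooses between maps and vectors, so that one closure procedure computes all
  vectors and afterwards all states.\<close>

definition "body_next = EIf V0 (ECall p_delta [ECons (ECons V2 V1) V3, V3, nil])
  (ECall p_steps [V2, V1, V3])"

definition "body_new1 = ELet
  (ECall p_next [EFst (EFst (EFst V0)), ESnd (EFst (EFst V0)), ECons V1 nil, ESnd (EFst V0)])
  (EIf (ECall p_mem [V0, ESnd V1, nil]) V3 (ECons V0 V3))"

definition "body_new =
  ECall p_new1 [ECons (ECons (EFst (EFst V0)) V1) (ESnd V0), ESnd (EFst V0), V2]"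

definition "body_union = EIf (ECall p_mem [V1, V2, nil]) V2 (ECons V1 V2)"

definition "body_closure = ELet (ECall p_new [ECons V0 V1, V1, nil])
  (EIf (EIsPair V0) (ECall p_closure [V1, ECall p_union [nil, V0, V2]]) V2)"

definition "body_bad = ELeq (EFst (EFst (ECall p_assoc [V0, V1, nil]))) (ECompl EOne)"

definition "body_good = ELeq EOne (EFst (EFst (ESnd (ECall p_assoc [V0, V1, nil]))))"

definition "body_value = EFst (EFst (ESnd (ESnd (ECall p_assoc [V0, V1, nil]))))"

text \<open>The game data is \<open>(b, problem, initial vector, moves of the environment, moves of the agent)\<close>.\<close>

definition "g_prob e = EFst (ESnd e)"
definition "g_init e = EFst (ESnd (ESnd e))"
definition "g_As e = EFst (ESnd (ESnd (ESnd e)))"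
definition "g_Bs e = ESnd (ESnd (ESnd (ESnd e)))"

section \<open>Solving the game and writing out the transducer\<close>

definition "body_picks = ELet
  (ECall p_delta [ECons (ECons (ECons (ESnd (ESnd (ESnd V0))) V1) (g_prob (EFst V0)))
     (EFst (ESnd (ESnd V0))), EFst (ESnd (ESnd V0)), nil])
  (EIf (ELeq (EFst (EFst V1)) (ECall p_value [g_init (EFst V1), V0])) (ECons V2 V0)
    (EIf (ECall p_mem [V0, ESnd (EFst (ESnd V1)), nil])
      (EIf (EFst (EFst (ESnd V1))) (ECons V2 V0) V3)
      (EIf (EFst (EFst (ESnd V1))) V3 (ECons V2 V0))))"

definition "body_pick = ECall p_picks
  [ECons (EFst V0) (ECons (EFst (ESnd V0)) (ECons (ESnd (ESnd V0)) V1)), g_Bs (EFst V0), nil]"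

definition "body_all = EIf (ECall p_pick [V0, V1]) V2 nil"

definition "body_ex = EIf (ECall p_pick [V0, V1]) yes V2"

text \<open>\<open>V0\<close> codes the fixed point: 0 for \<open>win\<close>, 1 for
  \<open>lose\<close>, 2 for \<open>live\<close>. \<open>V2\<close> is the list whose elements the
  latter two exclude.\<close>

definition "body_cond = EIf (ESymEq V0 (ESym 0))
  (EIf (ECall p_bad [g_init V1, V3]) yes
    (ECall p_all [ECons V1 (ECons (ECons yes V4) V3), g_As V1, yes]))
  (EIf (ECall p_mem [V3, V2, nil]) nil
    (EIf (ESymEq V0 (ESym 1))
      (EIf (ECall p_good [g_init V1, V3]) yes
        (EIf (ECall p_all [ECons V1 (ECons (ECons nil V4) V3), g_As V1, yes]) nil yes))
      (ECall p_ex [ECons V1 (ECons (ECons yes V4) V3), g_As V1, nil])))"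

definition "body_round = EIf (ECall p_mem [V1, V2, nil]) V2
  (EIf (ECall p_cond [EFst (EFst V0), ESnd (EFst V0), EFst (ESnd V0), V1, V2]) (ECons V1 V2) V2)"

definition "body_solve = ECall p_round [V0, ESnd (ESnd V0), V2]"

definition "call_solve k G D S = ECall p_solve [ECons (ECons (ESym k) G) (ECons D S), S, nil]"

definition "body_regions = ELet (call_solve 0 V0 nil V1)
  (ELet (call_solve 1 V1 V0 V2)
    (ECons V1 (ECons V0 (call_solve 2 V2 V0 V3))))"

definition "body_best = ELet (ECall p_value [EFst (ESnd (EFst V0)), V1])
  (EIf (ECall p_mem [EFst (ESnd V1),
      ESnd (ESnd (ECall p_regions [ECons V0 (EFst V1), ESnd (ESnd V1)])), nil])
    (EIf (ESymEq V3 nil) V0 (EIf (ELeq V3 V0) V0 V3))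
    V3)"

text \<open>A fold runs from the end of the list, so it carries a pair: the part already seen and
  the answer so far.\<close>

definition "body_after = ECons (ECons V1 (EFst V2)) (EIf (ECall p_eq [V0, V1]) (EFst V2) (ESnd V2))"

definition "body_entries = ELet
  (ECall p_pick [ECons (EFst (EFst V0)) (ECons (ESnd (EFst V0)) (ESnd (ESnd V0))), V1])
  (EIf V0
    (ELet (ELeq (EFst (EFst (EFst V1))) (ECall p_value [g_init (EFst (EFst V1)), ESnd V0]))
      (ECons (ECons (EFst (EFst (ESnd V2))) (ECons V3 (ECons (EFst V1) (ECons V0
         (ECons (EIf V0 nil (ECons (ESnd (EFst (ESnd V2))) (ESnd V1))) nil))))) V4))
    (EIf (ESnd (EFst (ESnd V1))) V3
      (ECons (ECons (EFst (EFst (ESnd V1))) (ECons V2 (ECons nil (ECons nil (ECons nil nil))))) V3)))"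

definition "body_target = EIf (ECall p_mem [V1, EFst V0, nil])
  (ECons yes (ESnd (ECall p_after [V1, EFst V0, ECons nil nil])))
  (ECons nil (EFst (ESnd V0)))"

definition "call_entries G sZ m m' s acc =
  ECall p_entries [ECons (ECons G sZ) (ECons (ECons (ECons m s) m') s), g_As G, acc]"

definition "body_rows =
  call_entries (EFst V0) (ECons yes (ESnd (ECall p_after [V1, ESnd (ESnd (ESnd V0)), ECons nil nil]))) yes yes V1
  (call_entries (EFst V0) (ECall p_target [ESnd V0, V1]) yes nil V1
  (call_entries (EFst V0) (ECall p_target [ESnd V0, V1]) nil nil V1 V2))"

definition "body_copy = ECons (ECons V1 V1) V2"

text \<open>
  With \<open>u\<close> and \<open>v\<close> for the propositions of the environment and the agent, the local variables
  of the main procedure are, from the outside in, \<open>u, v, init, letters, vectors, s\<^sub>0, S, G\<^sub>0, G\<close>.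
\<close>

definition "body_main =
  ELet (ECall p_colls [yes, V0, nil])
  (ELet (ECall p_colls [nil, V1, nil])
  (ELet (ECall p_ini [EOne, EFst V2, ECall p_ini [ECompl EOne, EFst (ESnd V2),
           ECall p_ini [ECompl EOne, EFst (ESnd (ESnd V2)), nil]]])
  (ELet (ECall p_subs [nil, ECall p_colls [yes, V3, V1], ECons nil nil])
  (ELet (ECall p_closure [ECons (ECons nil V4) V0, ECons V1 nil])
  (ELet (ECall p_copy [nil, V0, nil])
  (ELet (ECall p_closure [ECons (ECons yes (EVar 6)) V2, ECons V0 nil])
  (ELet (ECons (EVar 7) (ECons V4 (ECons (ECall p_subs [nil, EVar 6, ECons nil nil])
           (ECall p_subs [nil, EVar 5, ECons nil nil]))))
  (ELet (ECons (ECall p_best [ECons V0 (ECons V2 V1), V1, nil]) V0)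
    (ECons (ECons yes V3) (ECons (EVar 8)
      (ECons (ECall p_rows [ECons V0 (ECall p_regions [V0, V2]), V2, nil]) nil)))))))))))"

definition prog :: "expr list" where
  "prog = [body_main, body_eq, body_mem, fold_body 3 2, body_assoc, fold_body 5 4, body_kids,
    body_coll, fold_body 8 7, body_sub1, fold_body 10 9, body_sub, fold_body 12 11,
    body_ini, fold_body 14 13, body_root, fold_body 16 15, body_step, body_steps, body_opval,
    body_min, body_max, body_delta, fold_body 23 22, body_next, body_new1, fold_body 26 25,
    body_new, fold_body 28 27, body_union, fold_body 30 29, body_closure, body_bad, body_good,
    body_value, body_picks, fold_body 36 35, body_pick, body_all, fold_body 39 38, body_ex,
    fold_body 41 40, body_cond, body_round, fold_body 44 43, body_solve, fold_body 46 45,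
    body_regions, body_best, fold_body 49 48, body_after, fold_body 51 50, body_entries,
    fold_body 53 52, body_target, body_rows, fold_body 56 55, body_copy, fold_body 58 57]"

lemma length_prog: "length prog = 59"
  by (simp add: prog_def)

lemma prog_nth:
  "prog ! 0 = body_main" "prog ! 1 = body_eq" "prog ! Suc 0 = body_eq" "prog ! 2 = body_mem" "prog ! 3 = fold_body 3 2"
  "prog ! 4 = body_assoc" "prog ! 5 = fold_body 5 4" "prog ! 6 = body_kids" "prog ! 7 = body_coll"
  "prog ! 8 = fold_body 8 7" "prog ! 9 = body_sub1" "prog ! 10 = fold_body 10 9"
  "prog ! 11 = body_sub" "prog ! 12 = fold_body 12 11" "prog ! 13 = body_ini"
  "prog ! 14 = fold_body 14 13" "prog ! 15 = body_root" "prog ! 16 = fold_body 16 15"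
  "prog ! 17 = body_step" "prog ! 18 = body_steps" "prog ! 19 = body_opval" "prog ! 20 = body_min"
  "prog ! 21 = body_max" "prog ! 22 = body_delta" "prog ! 23 = fold_body 23 22"
  "prog ! 24 = body_next" "prog ! 25 = body_new1" "prog ! 26 = fold_body 26 25"
  "prog ! 27 = body_new" "prog ! 28 = fold_body 28 27" "prog ! 29 = body_union"
  "prog ! 30 = fold_body 30 29" "prog ! 31 = body_closure" "prog ! 32 = body_bad"
  "prog ! 33 = body_good" "prog ! 34 = body_value" "prog ! 35 = body_picks"
  "prog ! 36 = fold_body 36 35" "prog ! 37 = body_pick" "prog ! 38 = body_all"
  "prog ! 39 = fold_body 39 38" "prog ! 40 = body_ex" "prog ! 41 = fold_body 41 40"
  "prog ! 42 = body_cond" "prog ! 43 = body_round" "prog ! 44 = fold_body 44 43"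
  "prog ! 45 = body_solve" "prog ! 46 = fold_body 46 45" "prog ! 47 = body_regions"
  "prog ! 48 = body_best" "prog ! 49 = fold_body 49 48" "prog ! 50 = body_after"
  "prog ! 51 = fold_body 51 50" "prog ! 52 = body_entries" "prog ! 53 = fold_body 53 52"
  "prog ! 54 = body_target" "prog ! 55 = body_rows" "prog ! 56 = fold_body 56 55"
  "prog ! 57 = body_copy" "prog ! 58 = fold_body 58 57"
  by (simp_all add: prog_def)

lemmas body_defs = body_main_def body_eq_def body_mem_def body_assoc_def body_kids_def body_coll_def
  body_sub1_def body_sub_def body_ini_def body_root_def body_step_def body_steps_def body_opval_def
  body_min_def body_max_def body_delta_def body_next_def body_new1_def body_new_def body_union_def
  body_closure_def body_bad_def body_good_def body_value_def body_picks_def body_pick_def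
  body_all_def body_ex_def body_cond_def body_round_def body_solve_def body_regions_def
  body_best_def body_after_def body_entries_def body_target_def body_rows_def body_copy_def
  fold_body_def g_prob_def g_init_def g_As_def g_Bs_def call_solve_def call_entries_def tag_case_def

text \<open>The origin of the constant 1000 in the bound on \<open>B\<close>. The factor 2 absorbs
  the successor when the cost of a body is estimated by \<open>B ^ Suc j\<close>.\<close>

lemma nodes_prog: "e \<in> set prog \<Longrightarrow> 2 * nodes e \<le> 1000"
proof -
  have "list_all (\<lambda>e. 2 * nodes e \<le> 1000) prog"
    unfolding prog_def body_defs by simp
  then show "e \<in> set prog \<Longrightarrow> 2 * nodes e \<le> 1000" by (simp add: list_all_iff)
qed

lemma sexp_bool_eq_0 [simp]: "sexp_bool b = Sym 0 \<longleftrightarrow> \<not> b"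
  by (simp add: sexp_bool_def)

lemma sexp_bool_consts: "sexp_bool True = Sym 1" "sexp_bool False = Sym 0"
  by (simp_all add: sexp_bool_def)

lemma is_pair_simps [simp]: "is_pair (Pair a b)" "\<not> is_pair (Sym n)" "\<not> is_pair (Num r)" "\<not> is_pair (Fn f)"
  by (simp_all add: is_pair_def)

fun fn_free :: "sexp \<Rightarrow> bool" where
  "fn_free (Fn f) = False"
| "fn_free (Pair a b) = (fn_free a \<and> fn_free b)"
| "fn_free _ = True"

locale lisp =
  fixes B M :: nat
  assumes B: "1000 \<le> B"
begin

text \<open>
  The cost of a call at level \<open>k\<close> is at most \<open>B ^ k\<close>. A body that makes calls of level \<open>k\<close> has
  level \<open>k + 1\<close> and a loop over fewer than \<open>B\<close> elements adds 2 levels. As \<open>B\<close> may be doubly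
  exponential, even levels proportional to the size of a state, that is, exponential ones, are
  affordable. So all recursions except \<open>p_closure\<close> may raise the level with every recursive call.
\<close>

definition cl :: "nat \<Rightarrow> nat \<Rightarrow> sexp list \<Rightarrow> sexp option" where
  "cl k = cal prog (B ^ k)"

lemma clI:
  assumes "den (cl j) (B ^ j) vs (prog ! g) = Some v" "g < length prog" "j < k"
  shows "cl k g vs = Some v"
proof -
  have "cal prog (nodes (prog ! g) * Suc (B ^ j)) g vs = Some v"
    using cal_body assms(1,2) unfolding cl_def by blast
  moreover have "nodes (prog ! g) * Suc (B ^ j) \<le> B ^ k"
  proof -
    have "2 * nodes (prog ! g) \<le> B" using nodes_prog[OF nth_mem[OF assms(2)]] B by linarith
    moreover have "Suc (B ^ j) \<le> 2 * B ^ j" using B by (simp add: Suc_leI)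
    ultimately have "nodes (prog ! g) * Suc (B ^ j) \<le> nodes (prog ! g) * (2 * B ^ j)" by simp
    also have "\<dots> = (2 * nodes (prog ! g)) * B ^ j" by simp
    also have "\<dots> \<le> B * B ^ j" using \<open>2 * nodes (prog ! g) \<le> B\<close> by (rule mult_le_mono1)
    also have "\<dots> = B ^ Suc j" by simp
    also have "\<dots> \<le> B ^ k" using assms(3) B by (intro power_increasing) auto
    finally show ?thesis .
  qed
  ultimately show ?thesis unfolding cl_def by (rule cal_mono)
qed

text \<open>One factor \<open>B\<close> pays for the number of iterations and a second one absorbs
  the constants of \<open>cal_foldr\<close>.\<close>

lemma cl_foldr:
  assumes "prog ! h = fold_body h g" "h < length prog" "length xs < B" "j + 2 \<le> k"
    and "\<And>ys x zs. xs = ys @ x # zs \<Longrightarrow>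
      cl j g [env, ex x, ea (foldr f zs a)] = Some (ea (f x (foldr f zs a)))"
  shows "cl k h [env, sexp_list (map ex xs), ea a] = Some (ea (foldr f xs a))"
proof -
  have "cal prog (length xs * (B ^ j + 12) + 4) h [env, sexp_list (map ex xs), ea a] = Some (ea (foldr f xs a))"
    using assms unfolding cl_def by (intro cal_foldr)
  moreover have "length xs * (B ^ j + 12) + 4 \<le> B ^ k"
  proof -
    have j: "B ^ j \<ge> 1" using B by simp
    have "length xs * (B ^ j + 12) + 4 \<le> B * (B ^ j + 12) + 4" using assms(3) by simp
    also have "\<dots> \<le> B * (13 * B ^ j) + B * B ^ j"
      using j B by (intro add_mono mult_le_mono) (auto intro: order_trans[OF _ mult_le_mono[OF order_refl j]])
    also have "\<dots> = 14 * (B * B ^ j)" by simp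
    also have "\<dots> \<le> B * (B * B ^ j)" using B by (intro mult_le_mono1) simp
    also have "\<dots> = B ^ (j + 2)" by simp
    also have "\<dots> \<le> B ^ k" using assms(4) B by (intro power_increasing) auto
    finally show ?thesis .
  qed
  ultimately show ?thesis unfolding cl_def by (rule cal_mono)
qed

lemmas run = clI[unfolded length_prog]

text \<open>The recursion follows the first tree and raises the level by one at every pair, so the
  size of that tree bounds the level.\<close>

lemma cl_eq: "fn_free a \<Longrightarrow> fn_free b \<Longrightarrow> size a < k \<Longrightarrow> cl k p_eq [a, b] = Some (sexp_bool (a = b))"
proof (induction a arbitrary: b k)
  case (Pair a1 a2)
  show ?case
  proof (cases b)
    case (Pair b1 b2)
    have IH: "cl (k - 1) p_eq [a1, b1] = Some (sexp_bool (a1 = b1))"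
      "cl (k - 1) p_eq [a2, b2] = Some (sexp_bool (a2 = b2))"
      using Pair.prems Pair.IH[of _ "k - 1"] Pair by auto
    show ?thesis
      by (rule run[where j = "k - 1"])
        (use Pair.prems(3) IH in \<open>simp_all add: Pair prog_nth body_eq_def sexp_bool_def\<close>)
  next
    case (Sym n)
    show ?thesis by (rule run[where j = 0]) (use Pair.prems(3) in \<open>simp_all add: Sym prog_nth body_eq_def sexp_bool_def\<close>)
  next
    case (Num r)
    show ?thesis by (rule run[where j = 0]) (use Pair.prems(3) in \<open>simp_all add: Num prog_nth body_eq_def sexp_bool_def\<close>)
  next
    case (Fn f)
    show ?thesis using Pair.prems(2) Fn by simp
  qed
next
  case (Sym n)
  show ?case by (rule run[where j = 0]; cases b) (use Sym.prems in \<open>simp_all add: prog_nth body_eq_def sexp_bool_def\<close>)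
next
  case (Num r)
  show ?case by (rule run[where j = 0]; cases b) (use Num.prems in \<open>auto simp: prog_nth body_eq_def sexp_bool_def\<close>)
next
  case (Fn f)
  then show ?case by simp
qed

end


section \<open>Correctness of the basic procedures\<close>

fun tag :: "oper \<Rightarrow> nat" where
  "tag OTrue = 0" | "tag OFalse = 1" | "tag (OProp b p) = 2" | "tag ONeg = 3" | "tag OAnd = 4"
| "tag OOr = 5" | "tag ONext = 6" | "tag OUntil = 7" | "tag ORelease = 8" | "tag (OFun f) = 9"

fun enc_fm :: "fm \<Rightarrow> sexp" where
  "enc_fm (Fm q cs) = Pair (Sym (tag q))
     (case q of OProp b p \<Rightarrow> sexp_list [Pair (sexp_bool b) (Sym p)]
      | OFun f \<Rightarrow> sexp_list [Fn f, sexp_list (map enc_fm cs)]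
      | _ \<Rightarrow> sexp_list (map enc_fm cs))"

lemma encode_ltl_eq: "encode_ltl X \<alpha> = enc_fm (fm_of_ltl X \<alpha>)"
  by (induction \<alpha>) (auto simp: encode_prop_def)

lemma encode_qltl_eq: "encode_qltl X \<phi> = enc_fm (fm_of_qltl X \<phi>)"
proof (induction \<phi>)
  case (QFun f \<psi>s)
  then have "map (encode_qltl X) \<psi>s = map enc_fm (map (fm_of_qltl X) \<psi>s)" by simp
  then show ?case by (simp only: encode_qltl.simps fm_of_qltl.simps enc_fm.simps oper.case tag.simps) simp
qed (auto simp: encode_prop_def)

definition enc_syms :: "nat list \<Rightarrow> sexp" where
  "enc_syms l = sexp_list (map Sym l)"

definition enc_fms :: "fm list \<Rightarrow> sexp" where
  "enc_fms cs = sexp_list (map enc_fm cs)"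

definition enc_symss :: "nat list list \<Rightarrow> sexp" where
  "enc_symss ls = sexp_list (map enc_syms ls)"

definition enc_letter :: "nat list \<Rightarrow> nat list \<Rightarrow> sexp" where
  "enc_letter A B = Pair (enc_syms A) (enc_syms B)"

definition fms_len :: "fm list \<Rightarrow> nat" where
  "fms_len cs = sum_list (map fm_len cs)"

lemma fms_len_simps [simp]: "fms_len [] = 0" "fms_len (c # cs) = fm_len c + fms_len cs"
  by (simp_all add: fms_len_def)

lemma fm_len_Fm: "fm_len (Fm q cs) = Suc (fms_len cs)"
  by (simp add: fms_len_def)

lemma fm_len_pos: "1 \<le> fm_len c"
  by (cases c) simp

lemma fm_len_le: "c \<in> set cs \<Longrightarrow> fm_len c \<le> fms_len cs"
  by (induction cs) auto

lemma length_le_fms_len: "length cs \<le> fms_len cs"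
proof (induction cs)
  case (Cons c cs)
  then show ?case using fm_len_pos[of c] by simp
qed simp

text \<open>Trees of this shape have encodings of linear size, which makes the comparison level
  \<open>M\<close> available, and can be traversed in parallel with the formula.\<close>

inductive shape :: "fm \<Rightarrow> vt \<Rightarrow> bool" where
  "list_all2 shape cs ts \<Longrightarrow> shape (Fm q cs) (VT r ts)"
monos list_all2_mono

lemma shape_iff: "shape (Fm q cs) t \<longleftrightarrow> list_all2 shape cs (subs t)"
  by (cases t) (auto elim: shape.cases intro: shape.intros)

lemma shape_ini: "shape c (ini z c)"
  by (induction c) (auto intro!: shape.intros simp: list_all2_conv_all_nth)

lemma shape_step: "shape c t \<Longrightarrow> shape c (step a c t)"
proof (induction c arbitrary: t)
  case (Fm q cs)
  then show ?case
    by (auto simp: shape_iff step.simps Let_def list_all2_conv_all_nth)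
qed

lemma shape_vstep: "list_all2 shape fs V \<Longrightarrow> list_all2 shape fs (vstep a fs V)"
  by (auto simp: vstep_def list_all2_conv_all_nth intro: shape_step)

lemma size_sexp_list: "size (sexp_list xs) = sum_list (map size xs) + length xs"
  by (induction xs) auto

lemma fn_free_sexp_list [simp]: "fn_free (sexp_list xs) \<longleftrightarrow> (\<forall>x\<in>set xs. fn_free x)"
  by (induction xs) auto

lemma fn_free_enc_vt [simp]: "fn_free (enc_vt t)"
  by (induction t) auto

lemma fn_free_enc_vec [simp]: "fn_free (enc_vec V)"
  by (simp add: enc_vec_def)

lemma fn_free_enc_state [simp]: "fn_free (enc_state s)"
  by (simp add: enc_state_def enc_vv_def)

lemma size_enc_vec_aux:
  "list_all2 (\<lambda>c t. Suc (size (enc_vt t)) \<le> 2 * fm_len c) cs ts \<Longrightarrow> size (enc_vec ts) \<le> 2 * fms_len cs"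
  by (induction rule: list_all2_induct) (auto simp: enc_vec_def)

text \<open>A node costs a pair for itself and a list cell in its parent. The \<open>Suc\<close>
  pays for that cell, so that the bounds of siblings simply add up.\<close>

lemma size_enc_vt: "shape c t \<Longrightarrow> Suc (size (enc_vt t)) \<le> 2 * fm_len c"
proof (induction c arbitrary: t)
  case (Fm q cs)
  then have "list_all2 (\<lambda>c t. Suc (size (enc_vt t)) \<le> 2 * fm_len c) cs (subs t)"
    by (auto simp: shape_iff list_all2_conv_all_nth)
  from size_enc_vec_aux[OF this] show ?case
    by (cases t) (simp add: enc_vec_def fms_len_def)
qed

lemma size_enc_vec: "list_all2 shape cs ts \<Longrightarrow> size (enc_vec ts) \<le> 2 * fms_len cs"
  by (rule size_enc_vec_aux) (auto elim!: list_all2_mono intro: size_enc_vt)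

context lisp
begin

text \<open>Level \<open>M\<close> for the comparison, one more for the body of the step and two for
  the loop.\<close>

lemma cl_mem:
  assumes "\<And>a b. e a = e b \<longleftrightarrow> a = b" "\<And>y. y \<in> set xs \<Longrightarrow> fn_free (e y)" "fn_free (e x)"
    "size (e x) < M" "length xs < B" "M + 3 \<le> k"
  shows "cl k p_mem [e x, sexp_list (map e xs), Sym 0] = Some (sexp_bool (x \<in> set xs))"
proof -
  have "cl k p_mem [e x, sexp_list (map e xs), sexp_bool False] =
      Some (sexp_bool (foldr (\<lambda>y acc. x = y \<or> acc) xs False))"
  proof (rule cl_foldr[where g = 2 and j = "M + 1"])
    fix ys y zs
    assume xs: "xs = ys @ y # zs"
    have "cl M p_eq [e x, e y] = Some (sexp_bool (x = y))"
      using cl_eq[of "e x" "e y" M] assms(2)[of y] assms(1,3,4) by (simp add: xs)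
    then show "cl (M + 1) 2 [e x, e y, sexp_bool (foldr (\<lambda>y acc. x = y \<or> acc) zs False)] =
        Some (sexp_bool (x = y \<or> foldr (\<lambda>y acc. x = y \<or> acc) zs False))"
      by (intro run[where j = M]) (auto simp: prog_nth body_mem_def sexp_bool_consts)
  qed (use assms in \<open>simp_all add: prog_nth length_prog\<close>)
  moreover have "foldr (\<lambda>y acc. x = y \<or> acc) xs False \<longleftrightarrow> x \<in> set xs" by (induction xs) auto
  ultimately show ?thesis by (simp add: sexp_bool_consts)
qed

lemma cl_assoc:
  assumes "size (enc_vec W) < M" "length s < B" "M + 3 \<le> k"
  shows "cl k p_assoc [enc_vec W, enc_state s, Sym 0] = Some (enc_vec (lookup W s))"
proof -
  have "cl k p_assoc [enc_vec W, sexp_list (map enc_vv s), enc_vec []] =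
      Some (enc_vec (foldr (\<lambda>p acc. if W = fst p then snd p else acc) s []))"
  proof (rule cl_foldr[where g = 4 and j = "M + 1"])
    fix ys zs :: state and p :: "vec \<times> vec"
    have "cl M p_eq [enc_vec W, enc_vec (fst p)] = Some (sexp_bool (W = fst p))"
      using cl_eq[of "enc_vec W" "enc_vec (fst p)" M] assms(1) by (simp add: enc_vec_inject)
    then show "cl (M + 1) 4 [enc_vec W, enc_vv p, enc_vec (foldr (\<lambda>p acc. if W = fst p then snd p else acc) zs [])] =
        Some (enc_vec (if W = fst p then snd p else foldr (\<lambda>p acc. if W = fst p then snd p else acc) zs []))"
      by (intro run[where j = M]) (auto simp: prog_nth body_assoc_def sexp_bool_consts enc_vv_def)
  qed (use assms in \<open>simp_all add: prog_nth length_prog\<close>)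
  then show ?thesis by (simp add: enc_vec_def enc_state_def lookup_def)
qed

lemma cl_kids:
  assumes "wf_fm (Fm q cs)" "1 \<le> k"
  shows "cl k p_kids [enc_fm (Fm q cs)] = Some (enc_fms cs)"
  by (rule run[where j = 0]; cases q) (use assms in \<open>auto simp: prog_nth body_kids_def sexp_bool_def enc_fms_def\<close>)

lemma cl_min: "1 \<le> k \<Longrightarrow> cl k p_min [Num x, Num y] = Some (Num (min x y))"
  by (rule run[where j = 0]) (auto simp: prog_nth body_min_def min_def)

lemma cl_max: "1 \<le> k \<Longrightarrow> cl k p_max [Num x, Num y] = Some (Num (max x y))"
  by (rule run[where j = 0]) (auto simp: prog_nth body_max_def max_def)

definition occs_of :: "bool \<Rightarrow> fm \<Rightarrow> nat list" where
  "occs_of b c = map snd (filter (\<lambda>(c, p). c = b) (occs c))"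

lemma foldr_occs_of:
  "foldr (\<lambda>c l. occs_of b c @ l) cs l = map snd (filter (\<lambda>(c, p). c = b) (concat (map occs cs))) @ l"
  unfolding occs_of_def by (induction cs) auto

text \<open>Each nesting of the formula costs three levels: one for the body and two for the loop
  over the arguments.\<close>

lemma cl_coll:
  assumes "wf_fm c" "3 * fm_len c \<le> k" "fm_len c < B"
  shows "cl k p_coll [sexp_bool b, enc_fm c, enc_syms l] = Some (enc_syms (occs_of b c @ l))"
  using assms
proof (induction c arbitrary: k l)
  case (Fm q cs)
  show ?case
  proof (cases "\<exists>d p. q = OProp d p")
    case True
    then obtain d p where q: "q = OProp d p" by blast
    show ?thesis
      by (rule run[where j = 0])
        (use Fm.prems in \<open>auto simp: q prog_nth body_coll_def sexp_bool_def occs_of_def enc_syms_def\<close>)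
  next
    case False
    then have tag: "tag q \<noteq> 2" by (cases q) auto
    let ?j = "k - 1"
    have "cl ?j p_colls [sexp_bool b, sexp_list (map enc_fm cs), enc_syms l] =
       Some (enc_syms (foldr (\<lambda>c l. occs_of b c @ l) cs l))"
    proof (rule cl_foldr[where g = p_coll and j = "?j - 2"])
      fix ys c zs assume cs: "cs = ys @ c # zs"
      have "fm_len c \<le> fms_len cs" by (rule fm_len_le) (simp add: cs)
      then show "cl (?j - 2) p_coll [sexp_bool b, enc_fm c, enc_syms (foldr (\<lambda>c l. occs_of b c @ l) zs l)] =
          Some (enc_syms (occs_of b c @ foldr (\<lambda>c l. occs_of b c @ l) zs l))"
        using Fm.prems cs by (intro Fm.IH) (auto simp: fm_len_Fm simp del: fm_len.simps)
    qed (use Fm.prems length_le_fms_len[of cs] in \<open>auto simp: prog_nth length_prog fm_len_Fm simp del: fm_len.simps\<close>)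
    moreover have "foldr (\<lambda>c l. occs_of b c @ l) cs l = occs_of b (Fm q cs) @ l"
    proof -
      have "occs (Fm q cs) = concat (map occs cs)" using False by (cases q) auto
      then show ?thesis unfolding foldr_occs_of by (simp only: occs_of_def)
    qed
    moreover have "cl ?j p_kids [enc_fm (Fm q cs)] = Some (enc_fms cs)"
      by (rule cl_kids) (use Fm.prems in auto)
    ultimately show ?thesis
      by (intro run[where j = "k - 1"])
        (use Fm.prems tag in \<open>auto simp: prog_nth body_coll_def enc_fms_def sexp_bool_consts\<close>)
  qed
qed

lemma cl_colls:
  assumes "\<And>c. c \<in> set cs \<Longrightarrow> wf_fm c" "3 * fms_len cs + 2 \<le> k" "fms_len cs < B"
  shows "cl k p_colls [sexp_bool b, enc_fms cs, enc_syms l] =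
    Some (enc_syms (map snd (filter (\<lambda>(c, p). c = b) (concat (map occs cs))) @ l))"
proof -
  have "cl k p_colls [sexp_bool b, sexp_list (map enc_fm cs), enc_syms l] =
       Some (enc_syms (foldr (\<lambda>c l. occs_of b c @ l) cs l))"
  proof (rule cl_foldr[where g = p_coll and j = "k - 2"])
    fix ys c zs assume cs: "cs = ys @ c # zs"
    have "fm_len c \<le> fms_len cs" by (rule fm_len_le) (simp add: cs)
    then show "cl (k - 2) p_coll [sexp_bool b, enc_fm c, enc_syms (foldr (\<lambda>c l. occs_of b c @ l) zs l)] =
        Some (enc_syms (occs_of b c @ foldr (\<lambda>c l. occs_of b c @ l) zs l))"
      using assms by (intro cl_coll) (auto simp: cs)
  qed (use assms length_le_fms_len[of cs] in \<open>auto simp: prog_nth length_prog\<close>)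
  then show ?thesis unfolding foldr_occs_of enc_fms_def .
qed

lemma cl_subs:
  assumes "2 ^ length xs < B" "7 \<le> k"
  shows "cl k p_subs [Sym 0, enc_syms xs, Pair (Sym 0) (Sym 0)] = Some (enc_symss (sublists xs))"
proof -
  have "cl k p_subs [Sym 0, sexp_list (map Sym xs), enc_symss [[]]] =
      Some (enc_symss (foldr (\<lambda>p acc. foldr (\<lambda>l r. (p # l) # r) acc acc) xs [[]]))"
  proof (rule cl_foldr[where g = 11 and j = 5])
    fix ys p zs assume xs: "xs = ys @ p # zs"
    let ?acc = "sublists zs"
    have "2 ^ length zs \<le> (2 ^ length xs :: nat)" by (rule power_increasing) (auto simp: xs)
    then have len: "length ?acc < B" unfolding length_sublists using assms(1) by (rule le_less_trans)
    have "cl 4 p_sub1s [Sym p, sexp_list (map enc_syms ?acc), enc_symss ?acc] =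
        Some (enc_symss (foldr (\<lambda>l r. (p # l) # r) ?acc ?acc))"
      by (rule cl_foldr[where g = 9 and j = 1], simp_all add: prog_nth length_prog len)
        (rule run[where j = 0], simp_all add: prog_nth body_sub1_def enc_symss_def enc_syms_def)
    then show "cl 5 11 [Sym 0, Sym p, enc_symss (foldr (\<lambda>p acc. foldr (\<lambda>l r. (p # l) # r) acc acc) zs [[]])] =
        Some (enc_symss (foldr (\<lambda>l r. (p # l) # r) (foldr (\<lambda>p acc. foldr (\<lambda>l r. (p # l) # r) acc acc) zs [[]])
          (foldr (\<lambda>p acc. foldr (\<lambda>l r. (p # l) # r) acc acc) zs [[]])))"
      unfolding sublists_def[symmetric]
      by (intro run[where j = 4]) (simp_all add: prog_nth length_prog body_sub_def enc_symss_def[of ?acc])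
  qed (use assms in \<open>auto simp: prog_nth length_prog intro: le_less_trans[OF less_imp_le[OF less_exp]]\<close>)
  then show ?thesis by (simp add: sublists_def enc_symss_def enc_syms_def)
qed

lemma cl_ini:
  assumes "wf_fm c" "3 * fm_len c \<le> k" "fm_len c < B"
  shows "cl k p_ini [Num z, enc_fm c, enc_vec ts] = Some (enc_vec (ini z c # ts))"
  using assms
proof (induction c arbitrary: k ts)
  case (Fm q cs)
  let ?j = "k - 1"
  have "cl ?j p_inis [Num z, sexp_list (map enc_fm cs), enc_vec []] =
     Some (enc_vec (foldr (\<lambda>c ts. ini z c # ts) cs []))"
  proof (rule cl_foldr[where g = p_ini and j = "?j - 2"])
    fix ys c zs assume cs: "cs = ys @ c # zs"
    have "fm_len c \<le> fms_len cs" by (rule fm_len_le) (simp add: cs)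
    then show "cl (?j - 2) p_ini [Num z, enc_fm c, enc_vec (foldr (\<lambda>c ts. ini z c # ts) zs [])] =
        Some (enc_vec (ini z c # foldr (\<lambda>c ts. ini z c # ts) zs []))"
      using Fm.prems cs by (intro Fm.IH) (auto simp: fm_len_Fm simp del: fm_len.simps)
  qed (use Fm.prems length_le_fms_len[of cs] in \<open>auto simp: prog_nth length_prog fm_len_Fm simp del: fm_len.simps\<close>)
  then have "cl ?j p_inis [Num z, enc_fms cs, Sym 0] = Some (enc_vec (map (ini z) cs))"
    by (simp add: enc_fms_def enc_vec_def foldr_Cons_map)
  moreover have "cl ?j p_kids [enc_fm (Fm q cs)] = Some (enc_fms cs)"
    by (rule cl_kids) (use Fm.prems in auto)
  ultimately show ?case
    by (intro run[where j = "k - 1"])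
      (use Fm.prems in \<open>simp_all add: prog_nth body_ini_def enc_vec_def del: enc_fm.simps\<close>)
qed

lemma cl_roots:
  assumes "length ts < B" "3 \<le> k"
  shows "cl k p_roots [Sym 0, enc_vec ts, Sym 0] = Some (sexp_list (map Num (map root ts)))"
proof -
  have enc: "enc_vt t = Pair (Num (root t)) (enc_vec (subs t))" for t by (cases t) (simp add: enc_vec_def)
  have "cl k p_roots [Sym 0, sexp_list (map enc_vt ts), sexp_list (map Num [])] =
      Some (sexp_list (map Num (foldr (\<lambda>t rs. root t # rs) ts [])))"
    by (rule cl_foldr[where g = 15 and j = 1], use assms in \<open>simp_all add: prog_nth length_prog\<close>)
      (rule run[where j = 0], simp_all add: prog_nth body_root_def enc)
  then show ?thesis by (simp add: foldr_Cons_map enc_vec_def)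
qed

lemma cl_opval:
  assumes "arity_ok q (length ws)" "length (subs t) = length ws" "length cs = length ws"
    "length A < B" "length A' < B" "length ws < B" "0 < M" "M + 5 \<le> k"
  shows "cl k p_opval [enc_letter A A', enc_fm (Fm q cs), enc_vt t, enc_vec ws] =
    Some (Num (opval q (set A \<union> set A') (map root ws) (map root (subs t)) (root t)))"
proof -
  have enc: "enc_vt t = Pair (Num (root t)) (enc_vec (subs t))" for t by (cases t) (simp add: enc_vec_def)
  have mem: "cl (M + 4) p_mem [Sym p, enc_syms L, Sym 0] = Some (sexp_bool (p \<in> set L))" if "length L < B" for p L
    unfolding enc_syms_def using assms(7) that by (intro cl_mem) auto
  have rts: "cl (M + 4) p_roots [Sym 0, enc_vec ws, Sym 0] = Some (sexp_list (map Num (map root ws)))"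
    using assms by (intro cl_roots) auto
  \<comment> \<open>\<open>den\<close> admits a function application only if the argument list is no
    longer than the cost bound of a call.\<close>
  have "B ^ 1 \<le> B ^ (M + 4)" using B by (intro power_increasing) auto
  then have B': "length ws \<le> B ^ (M + 4)" using assms(6) by simp
  have one: "\<exists>x. ys = [x]" if "length ys = 1" for ys :: "vt list" using that by (cases ys) auto
  have two: "\<exists>x y. ys = [x, y]" if "length ys = 2" for ys :: "vt list"
    using that by (cases ys; cases "tl ys") auto
  note s = prog_nth body_opval_def tag_case_def enc_letter_def mem rts sexp_bool_def cl_min cl_max assms(4-6)
  show ?thesis
  proof (cases q)
    case ONeg
    with assms one[of ws] obtain w where "ws = [w]" by auto
    then show ?thesis by (intro run[where j = "M + 4"]) (use assms in \<open>simp_all add: ONeg s enc enc_vec_def[of "[_]"]\<close>)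
  next
    case ONext
    with assms one[of "subs t"] obtain w where "subs t = [w]" by auto
    then show ?thesis by (intro run[where j = "M + 4"]) (use assms in \<open>simp_all add: ONext s enc enc_vec_def[of "[_]"]\<close>)
  next
    case OAnd
    with assms two[of ws] obtain v w where "ws = [v, w]" by auto
    then show ?thesis by (intro run[where j = "M + 4"]) (use assms in \<open>simp_all add: OAnd s enc enc_vec_def[of "[_, _]"]\<close>)
  next
    case OOr
    with assms two[of ws] obtain v w where "ws = [v, w]" by auto
    then show ?thesis by (intro run[where j = "M + 4"]) (use assms in \<open>simp_all add: OOr s enc enc_vec_def[of "[_, _]"]\<close>)
  next
    case OUntil
    with assms two[of ws] obtain v w where "ws = [v, w]" by auto
    then show ?thesis by (intro run[where j = "M + 4"]) (use assms in \<open>simp_all add: OUntil s enc enc_vec_def[of "[_, _]"]\<close>)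
  next
    case ORelease
    with assms two[of ws] obtain v w where "ws = [v, w]" by auto
    then show ?thesis by (intro run[where j = "M + 4"]) (use assms in \<open>simp_all add: ORelease s enc enc_vec_def[of "[_, _]"]\<close>)
  next
    case (OFun f)
    show ?thesis using B' apply_fn_list[of "map root ws" "B ^ (M + 4)" f]
      by (intro run[where j = "M + 4"]) (use assms(8) in \<open>simp_all add: OFun s\<close>)
  next
    case (OProp b p)
    show ?thesis by (intro run[where j = "M + 4"]) (use assms(8) in \<open>simp_all add: OProp s\<close>)
  qed (intro run[where j = "M + 4"]; use assms(8) in \<open>simp_all add: s\<close>)+
qed

end


section \<open>Correctness of the transition and closure procedures\<close>

context lisp
begin

text \<open>\<open>p_step\<close> and \<open>p_steps\<close> call each other. Correctness of the
  former is assumed on the members of \<open>cs\<close>, so that the lemma can be used inside the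
  induction that proves it. Every list cell costs a level, paid for by the length of its
  formula.\<close>

lemma cl_steps_aux:
  assumes "\<And>c k t. c \<in> set cs \<Longrightarrow> shape c t \<Longrightarrow> M + 5 + 3 * fm_len c \<le> k \<Longrightarrow>
      cl k p_step [l, enc_fm c, enc_vt t] = Some (enc_vt (step a c t))"
    "list_all2 shape cs ts" "M + 6 + 3 * fms_len cs \<le> k"
  shows "cl k p_steps [l, enc_fms cs, enc_vec ts] = Some (enc_vec (vstep a cs ts))"
  using assms(2,1,3)
proof (induction arbitrary: k rule: list_all2_induct)
  case Nil
  then show ?case
    by (intro run[where j = 0]) (auto simp: prog_nth body_steps_def enc_fms_def enc_vec_def vstep_def)
next
  case (Cons c cs t ts)
  have "cl (k - 1) p_step [l, enc_fm c, enc_vt t] = Some (enc_vt (step a c t))"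
    using Cons.prems Cons.hyps(1) by simp
  moreover have "cl (k - 1) p_steps [l, enc_fms cs, enc_vec ts] = Some (enc_vec (vstep a cs ts))"
    using Cons.prems fm_len_pos[of c] by (intro Cons.IH) auto
  ultimately show ?case
    by (intro run[where j = "k - 1"])
      (use Cons.prems in \<open>simp_all add: prog_nth body_steps_def enc_fms_def enc_vec_def vstep_def sexp_bool_consts\<close>)
qed

lemma cl_step:
  assumes "wf_fm c" "shape c t" "M + 5 + 3 * fm_len c \<le> k" "fm_len c < B"
    "length A < B" "length A' < B" "0 < M"
  shows "cl k p_step [enc_letter A A', enc_fm c, enc_vt t] = Some (enc_vt (step (set A \<union> set A') c t))"
  using assms(1-4)
proof (induction c arbitrary: k t)
  case (Fm q cs)
  let ?a = "set A \<union> set A'" and ?ws = "vstep (set A \<union> set A') cs (subs t)"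
  have sh: "list_all2 shape cs (subs t)" using Fm.prems(2) by (simp add: shape_iff)
  then have len: "length (subs t) = length cs" "length ?ws = length cs"
    by (auto dest: list_all2_lengthD simp: vstep_def)
  have le: "fm_len c \<le> fms_len cs" if "c \<in> set cs" for c using fm_len_le that .
  have "cl (k - 1) p_kids [enc_fm (Fm q cs)] = Some (enc_fms cs)"
    using Fm.prems by (intro cl_kids) auto
  moreover have "cl (k - 1) p_steps [enc_letter A A', enc_fms cs, enc_vec (subs t)] = Some (enc_vec ?ws)"
  proof (rule cl_steps_aux)
    fix c k t assume "c \<in> set cs" "shape c t" "M + 5 + 3 * fm_len c \<le> k"
    then show "cl k p_step [enc_letter A A', enc_fm c, enc_vt t] = Some (enc_vt (step ?a c t))"
      using Fm.prems le[of c] by (intro Fm.IH) (auto simp: fm_len_Fm simp del: fm_len.simps)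
  qed (use sh Fm.prems in \<open>auto simp: fm_len_Fm simp del: fm_len.simps\<close>)
  moreover have "cl (k - 1) p_opval [enc_letter A A', enc_fm (Fm q cs), enc_vt t, enc_vec ?ws] =
      Some (Num (opval q ?a (map root ?ws) (map root (subs t)) (root t)))"
    using Fm.prems len assms(5-7) length_le_fms_len[of cs]
    by (intro cl_opval) (auto simp: fm_len_Fm simp del: fm_len.simps)
  moreover have "enc_vt t = Pair (Num (root t)) (enc_vec (subs t))" by (cases t) (simp add: enc_vec_def)
  moreover have "enc_vt (step ?a (Fm q cs) t) =
      Pair (Num (opval q ?a (map root ?ws) (map root (subs t)) (root t))) (enc_vec ?ws)"
    by (simp add: step.simps Let_def vstep_def enc_vec_def)
  ultimately show ?case
    by (intro run[where j = "k - 1"])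
      (use Fm.prems(3) in \<open>simp_all add: prog_nth body_step_def fm_len_Fm del: fm_len.simps enc_fm.simps\<close>)
qed

lemma cl_steps:
  assumes "\<And>c. c \<in> set cs \<Longrightarrow> wf_fm c" "list_all2 shape cs ts" "M + 6 + 3 * fms_len cs \<le> k"
    "fms_len cs < B" "length A < B" "length A' < B" "0 < M"
  shows "cl k p_steps [enc_letter A A', enc_fms cs, enc_vec ts] = Some (enc_vec (vstep (set A \<union> set A') cs ts))"
proof (rule cl_steps_aux[OF _ assms(2,3)])
  fix c k t assume "c \<in> set cs" "shape c t" "M + 5 + 3 * fm_len c \<le> k"
  then show "cl k p_step [enc_letter A A', enc_fm c, enc_vt t] = Some (enc_vt (step (set A \<union> set A') c t))"
    using assms fm_len_le[of c cs] by (intro cl_step) auto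
qed

lemma cl_delta:
  assumes "\<And>c. c \<in> set fs \<Longrightarrow> wf_fm c" "\<And>p. p \<in> set s \<Longrightarrow> list_all2 shape fs (fst p)"
    "2 * fms_len fs < M" "M + 3 * fms_len fs + 10 \<le> k"
    "fms_len fs < B" "length A < B" "length A' < B" "length s < B"
  shows "cl k p_delta [Pair (Pair (enc_letter A A') (enc_fms fs)) (enc_state s), enc_state s, Sym 0] =
    Some (enc_state (sstep (set A \<union> set A') fs s))"
proof -
  let ?a = "set A \<union> set A'" and ?j = "k - 3"
  let ?env = "Pair (Pair (enc_letter A A') (enc_fms fs)) (enc_state s)"
  have "cl k p_delta [?env, sexp_list (map enc_vv s), enc_state []] =
      Some (enc_state (foldr (\<lambda>p acc. (fst p, lookup (vstep ?a fs (fst p)) s) # acc) s []))"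
  proof (rule cl_foldr[where g = 22 and j = "k - 2"])
    fix ys zs :: state and p :: "vec \<times> vec" assume s: "s = ys @ p # zs"
    then have sh: "list_all2 shape fs (fst p)" using assms(2) by auto
    let ?acc = "foldr (\<lambda>p acc. (fst p, lookup (vstep ?a fs (fst p)) s) # acc) zs []"
    have "cl ?j p_steps [enc_letter A A', enc_fms fs, enc_vec (fst p)] = Some (enc_vec (vstep ?a fs (fst p)))"
      using assms sh by (intro cl_steps) auto
    moreover have "cl ?j p_assoc [enc_vec (vstep ?a fs (fst p)), enc_state s, Sym 0] =
        Some (enc_vec (lookup (vstep ?a fs (fst p)) s))"
      using assms(3,4,8) size_enc_vec[OF shape_vstep[OF sh], of ?a] by (intro cl_assoc) auto
    ultimately show "cl (k - 2) 22 [?env, enc_vv p, enc_state ?acc] =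
        Some (enc_state ((fst p, lookup (vstep ?a fs (fst p)) s) # ?acc))"
      by (intro run[where j = ?j])
        (use assms(4) in \<open>simp_all add: prog_nth body_delta_def enc_vv_def enc_state_def[of "_ # _"] enc_state_def[of ?acc]\<close>)
  qed (use assms in \<open>simp_all add: prog_nth length_prog\<close>)
  then show ?thesis by (simp add: enc_state_def sstep_def)
qed

end


section \<open>Closing a finite set under the letters\<close>

definition new_elems :: "(nat list \<Rightarrow> 'x \<Rightarrow> 'x) \<Rightarrow> nat list list \<Rightarrow> 'x list \<Rightarrow> 'x list" where
  "new_elems f Ls l =
     foldr (\<lambda>x acc. foldr (\<lambda>L acc. if f L x \<in> set l then acc else f L x # acc) Ls acc) l []"

definition union_list :: "'x list \<Rightarrow> 'x list \<Rightarrow> 'x list" where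
  "union_list xs l = foldr (\<lambda>x acc. if x \<in> set acc then acc else x # acc) xs l"

lemma foldr_new: "set (foldr (\<lambda>L acc. if f L x \<in> set l then acc else f L x # acc) Ls acc) =
      {f L x | L. L \<in> set Ls} - set l \<union> set acc"
    "length (foldr (\<lambda>L acc. if f L x \<in> set l then acc else f L x # acc) Ls acc) \<le> length Ls + length acc"
  by (induction Ls) auto

lemma set_new_elems: "set (new_elems f Ls l) = {f L x | L x. L \<in> set Ls \<and> x \<in> set l} - set l"
proof -
  have "set (foldr (\<lambda>x acc. foldr (\<lambda>L acc. if f L x \<in> set l then acc else f L x # acc) Ls acc) xs []) =
      {f L x | L x. L \<in> set Ls \<and> x \<in> set xs} - set l" for xs
    by (induction xs) (auto simp: foldr_new)
  then show ?thesis unfolding new_elems_def .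
qed

lemma length_new_elems: "length (new_elems f Ls l) \<le> length l * length Ls"
proof -
  have "length (foldr (\<lambda>x acc. foldr (\<lambda>L acc. if f L x \<in> set l then acc else f L x # acc) Ls acc) xs []) \<le>
      length xs * length Ls" for xs
  proof (induction xs)
    case (Cons x xs)
    then show ?case by (auto intro: order_trans[OF foldr_new(2)])
  qed simp
  then show ?thesis unfolding new_elems_def .
qed

lemma union_list:
  "set (union_list xs l) = set xs \<union> set l" "distinct l \<Longrightarrow> distinct (union_list xs l)"
  unfolding union_list_def by (induction xs) (auto simp: insert_absorb)

text \<open>The product of \<open>card U\<close> and the number of letters is bounded because one
  round may list the same new element repeatedly, once per letter and source; only
  \<open>union_list\<close> removes the repetitions.\<close>

locale closure = lisp B M for B M +
  fixes e :: "'x \<Rightarrow> sexp" and f :: "nat list \<Rightarrow> 'x \<Rightarrow> 'x" and Ls :: "nat list list" and U :: "'x set"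
    and flag prob :: sexp and d :: nat
  assumes inj: "\<And>x y. e x = e y \<longleftrightarrow> x = y" and free: "\<And>x. x \<in> U \<Longrightarrow> fn_free (e x)"
    and size: "\<And>x. x \<in> U \<Longrightarrow> size (e x) < M"
    and closed: "\<And>L x. L \<in> set Ls \<Longrightarrow> x \<in> U \<Longrightarrow> f L x \<in> U"
    and U: "finite U" "card U < B" "card U * length Ls < B" and Ls: "length Ls < B"
    and nxt: "\<And>L x. L \<in> set Ls \<Longrightarrow> x \<in> U \<Longrightarrow>
      cl d p_next [flag, prob, Pair (enc_syms L) (Sym 0), e x] = Some (e (f L x))"
    and d: "M + 3 \<le> d"
begin

abbreviation "enc l \<equiv> sexp_list (map e l)"

lemma length_less: "distinct l \<Longrightarrow> set l \<subseteq> U \<Longrightarrow> length l \<le> card U"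
  by (metis U(1) card_mono distinct_card)

lemma mem:
  assumes "distinct l" "set l \<subseteq> U" "x \<in> U" "M + 3 \<le> k"
  shows "cl k p_mem [e x, enc l, Sym 0] = Some (sexp_bool (x \<in> set l))"
  using assms length_less[OF assms(1,2)] U(2) free size by (intro cl_mem inj) auto

lemma cl_new:
  assumes l: "distinct l" "set l \<subseteq> U"
  shows "cl (d + 6) p_new [Pair (Pair (Pair flag prob) (enc_symss Ls)) (enc l), enc l, Sym 0] =
    Some (enc (new_elems f Ls l))"
proof -
  have "cl (d + 6) p_new [Pair (Pair (Pair flag prob) (enc_symss Ls)) (enc l), enc l, enc []] =
    Some (enc (foldr (\<lambda>x acc. foldr (\<lambda>L acc. if f L x \<in> set l then acc else f L x # acc) Ls acc) l []))"
  proof (rule cl_foldr[where g = 27 and j = "d + 4"])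
    fix ys x zs assume "l = ys @ x # zs"
    then have x: "x \<in> U" using l by auto
    let ?F = "\<lambda>L acc. if f L x \<in> set l then acc else f L x # acc"
    have "cl (d + 3) p_new1 [Pair (Pair (Pair flag prob) (e x)) (enc l), sexp_list (map enc_syms Ls), enc acc] =
      Some (enc (foldr ?F Ls acc))" for acc
    proof (rule cl_foldr[where g = 25 and j = "d + 1"])
      fix ys L zs assume "Ls = ys @ L # zs"
      then have L: "L \<in> set Ls" by simp
      have "cl d p_mem [e (f L x), enc l, Sym 0] = Some (sexp_bool (f L x \<in> set l))"
        using mem[OF l closed[OF L x] d] .
      then show "cl (d + 1) 25 [Pair (Pair (Pair flag prob) (e x)) (enc l), enc_syms L, enc (foldr ?F zs acc)] =
          Some (enc (?F L (foldr ?F zs acc)))"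
        by (intro run[where j = d]) (auto simp: prog_nth body_new1_def nxt[OF L x])
    qed (use Ls in \<open>simp_all add: prog_nth length_prog\<close>)
    then show "cl (d + 4) 27 [Pair (Pair (Pair flag prob) (enc_symss Ls)) (enc l), e x,
        enc (foldr (\<lambda>x acc. foldr (\<lambda>L acc. if f L x \<in> set l then acc else f L x # acc) Ls acc) zs [])] =
        Some (enc (foldr ?F Ls (foldr (\<lambda>x acc. foldr (\<lambda>L acc. if f L x \<in> set l then acc else f L x # acc) Ls acc) zs [])))"
      by (intro run[where j = "d + 3"]) (simp_all add: prog_nth body_new_def enc_symss_def)
  qed (use length_less[OF l] U(2) in \<open>simp_all add: prog_nth length_prog\<close>)
  then show ?thesis by (simp add: new_elems_def)
qed

lemma cl_union:
  assumes l: "distinct l" "set l \<subseteq> U" and xs: "set xs \<subseteq> U" "length xs < B"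
  shows "cl (d + 6) p_union [Sym 0, enc xs, enc l] = Some (enc (union_list xs l))"
  unfolding union_list_def
proof (rule cl_foldr[where g = 29 and j = "d + 1"])
  fix ys x zs assume "xs = ys @ x # zs"
  then have x: "x \<in> U" "set zs \<subseteq> U" using xs by auto
  let ?F = "\<lambda>x acc. if x \<in> set acc then acc else x # acc"
  have "cl d p_mem [e x, enc (union_list zs l), Sym 0] = Some (sexp_bool (x \<in> set (union_list zs l)))"
    using l x by (intro mem union_list(2) d) (auto simp: union_list(1))
  then show "cl (d + 1) 29 [Sym 0, e x, enc (foldr ?F zs l)] = Some (enc (?F x (foldr ?F zs l)))"
    unfolding union_list_def by (intro run[where j = d]) (auto simp: prog_nth body_union_def)
qed (use xs in \<open>simp_all add: prog_nth length_prog\<close>)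

text \<open>There may be doubly exponentially many rounds, so their costs have to be added up.\<close>

definition T :: nat where "T = 30 * Suc (B ^ (d + 6))"

text \<open>A round that does not stop enlarges a distinct list inside \<open>U\<close>. So at most
  \<open>card U - length l\<close> such rounds remain, and the \<open>Suc\<close> is for the last
  one, which finds nothing new.\<close>

lemma closure_aux:
  assumes "distinct l" "set l \<subseteq> U"
  shows "\<exists>r. cal prog (Suc (card U - length l) * T) p_closure [Pair (Pair flag prob) (enc_symss Ls), enc l] = Some (enc r) \<and>
    distinct r \<and> set r \<subseteq> U \<and> set l \<subseteq> set r \<and> (\<forall>L\<in>set Ls. \<forall>x\<in>set r. f L x \<in> set r)"
  using assms
proof (induction "card U - length l" arbitrary: l rule: less_induct)
  case less
  let ?E = "Pair (Pair flag prob) (enc_symss Ls)" and ?n = "new_elems f Ls l"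
  let ?\<rho> = "[?E, enc l]" and ?C = "B ^ (d + 6)"
  note l = less.prems
  have n: "set ?n \<subseteq> U" using l closed by (auto simp: set_new_elems)
  have "length l * length Ls \<le> card U * length Ls" using length_less[OF l] by simp
  then have len: "length ?n < B" using length_new_elems[of f Ls l] U(3) by linarith
  have "den (cl (d + 6)) ?C ?\<rho> (ECall p_new [ECons V0 V1, V1, nil]) = Some (enc ?n)"
    using cl_new[OF l] by simp
  from den_sound[OF this[unfolded cl_def]]
  obtain t1 where t1: "t1 \<le> 6 * Suc ?C" "eval prog ?\<rho> (ECall p_new [ECons V0 V1, V1, nil]) (enc ?n) t1"
    by (auto simp: eval_nat_numeral)
  have "den (cl (d + 6)) ?C (enc ?n # ?\<rho>) (EIsPair V0) = Some (sexp_bool (?n \<noteq> []))"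
    by (cases ?n) simp_all
  from den_sound[OF this[unfolded cl_def]]
  obtain t2 where t2: "t2 \<le> 2 * Suc ?C" "eval prog (enc ?n # ?\<rho>) (EIsPair V0) (sexp_bool (?n \<noteq> [])) t2"
    by (auto simp: eval_nat_numeral)
  show ?case
  proof (cases "?n = []")
    case True
    have "den (cl (d + 6)) ?C (enc ?n # ?\<rho>) V2 = Some (enc l)" by simp
    from den_sound[OF this[unfolded cl_def]]
    obtain t3 where t3: "t3 \<le> Suc ?C" "eval prog (enc ?n # ?\<rho>) V2 (enc l) t3" by auto
    have "eval prog ?\<rho> (prog ! p_closure) (enc l) (t1 + (t2 + t3 + 1) + 1)"
      unfolding prog_nth body_closure_def
      by (rule eval_evals.Let[OF t1(2)], rule eval_evals.If_false[OF t2(2) _ t3(2)]) (simp add: True)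
    moreover have "t1 + (t2 + t3 + 1) + 1 \<le> Suc (card U - length l) * T"
      using t1(1) t2(1) t3(1) unfolding T_def by (simp add: algebra_simps)
    ultimately have "cal prog (Suc (card U - length l) * T) p_closure ?\<rho> = Some (enc l)"
      unfolding cal_eq_Some length_prog by auto
    moreover have "\<forall>L\<in>set Ls. \<forall>x\<in>set l. f L x \<in> set l" using True set_new_elems[of f Ls l] by auto
    ultimately show ?thesis using l by blast
  next
    case False
    let ?l = "union_list ?n l"
    have l': "distinct ?l" "set ?l \<subseteq> U" using union_list(1)[of ?n l] union_list(2)[OF l(1), of ?n] l n by auto
    obtain y where "y \<in> set ?n" using False by (cases ?n) auto
    then have "y \<in> set ?l" "y \<notin> set l" by (auto simp: union_list(1) set_new_elems)
    then have "set l \<subset> set ?l" using union_list(1)[of ?n l] by auto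
    then have "length l < length ?l"
      using psubset_card_mono[of "set ?l" "set l"] l(1) l'(1) by (simp add: distinct_card)
    then have less': "card U - length ?l < card U - length l" using length_less[OF l'] by simp
    from less.hyps[OF this l'] obtain r where
      r: "cal prog (Suc (card U - length ?l) * T) p_closure [?E, enc ?l] = Some (enc r)" "distinct r" "set r \<subseteq> U"
        "set ?l \<subseteq> set r" "\<forall>L\<in>set Ls. \<forall>x\<in>set r. f L x \<in> set r" by blast
    from r(1) obtain t4 where t4: "t4 \<le> Suc (card U - length ?l) * T" "eval prog [?E, enc ?l] (prog ! p_closure) (enc r) t4"
      unfolding cal_eq_Some by blast
    have "den (cl (d + 6)) ?C (enc ?n # ?\<rho>) (ECall p_union [nil, V0, V2]) = Some (enc ?l)"
      "den (cl (d + 6)) ?C (enc ?n # ?\<rho>) V1 = Some ?E"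
      using cl_union[OF l n len] by simp_all
    from this[unfolded cl_def, THEN den_sound]
    obtain t3 t5 where t3: "t3 \<le> 4 * Suc ?C" "eval prog (enc ?n # ?\<rho>) (ECall p_union [nil, V0, V2]) (enc ?l) t3"
      and t5: "t5 \<le> Suc ?C" "eval prog (enc ?n # ?\<rho>) V1 ?E t5"
      by (auto simp: eval_nat_numeral)
    have "evals prog (enc ?n # ?\<rho>) [V1, ECall p_union [nil, V0, V2]] [?E, enc ?l] (t5 + (t3 + 0))"
      by (intro eval_evals.Args eval_evals.Nil t3 t5)
    note call = eval_evals.Call[OF this _ t4(2)]
    have "eval prog ?\<rho> (prog ! p_closure) (enc r) (t1 + (t2 + (t5 + (t3 + 0) + t4 + 1) + 1) + 1)"
      unfolding prog_nth(33) body_closure_def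
      by (rule eval_evals.Let[OF t1(2)], rule eval_evals.If_true[OF t2(2) _ call]) (simp_all add: False length_prog)
    moreover have "t1 + (t2 + (t5 + (t3 + 0) + t4 + 1) + 1) + 1 \<le> Suc (card U - length l) * T"
    proof -
      have "Suc (card U - length ?l) * T \<le> (card U - length l) * T" using less' by (intro mult_le_mono1) simp
      then show ?thesis using t1(1) t2(1) t3(1) t4(1) t5(1) unfolding T_def by simp
    qed
    ultimately have "cal prog (Suc (card U - length l) * T) p_closure ?\<rho> = Some (enc r)"
      unfolding cal_eq_Some length_prog by auto
    moreover have "set l \<subseteq> set r" using r(4) union_list(1)[of ?n l] by auto
    ultimately show ?thesis using r by blast
  qed
qed

lemma cl_closure:
  assumes "x \<in> U" "d + 8 \<le> k"
  obtains r where "cl k p_closure [Pair (Pair flag prob) (enc_symss Ls), Pair (e x) (Sym 0)] = Some (enc r)"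
    "distinct r" "set r \<subseteq> U" "x \<in> set r" "\<And>L y. L \<in> set Ls \<Longrightarrow> y \<in> set r \<Longrightarrow> f L y \<in> set r"
proof -
  from closure_aux[of "[x]"] assms(1) obtain r where
    r: "cal prog (Suc (card U - 1) * T) p_closure [Pair (Pair flag prob) (enc_symss Ls), Pair (e x) (Sym 0)] = Some (enc r)"
    "distinct r" "set r \<subseteq> U" "x \<in> set r" "\<forall>L\<in>set Ls. \<forall>y\<in>set r. f L y \<in> set r" by auto
  have "0 < card U" using assms(1) U(1) by (auto simp: card_gt_0_iff)
  then have "Suc (card U - 1) \<le> B" using U(2) by simp
  moreover have "T \<le> B ^ (d + 7)"
  proof -
    have "Suc (B ^ (d + 6)) \<le> 2 * B ^ (d + 6)" using B by (simp add: Suc_leI)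
    then have "T \<le> 60 * B ^ (d + 6)" unfolding T_def by simp
    also have "\<dots> \<le> B * B ^ (d + 6)" using B by (intro mult_le_mono1) simp
    also have "\<dots> = B ^ (d + 7)" by (simp add: eval_nat_numeral)
    finally show ?thesis .
  qed
  ultimately have "Suc (card U - 1) * T \<le> B * B ^ (d + 7)" by (rule mult_le_mono)
  also have "\<dots> = B ^ (d + 8)" by (simp add: eval_nat_numeral)
  also have "\<dots> \<le> B ^ k" using assms(2) B by (intro power_increasing) auto
  finally have "cl k p_closure [Pair (Pair flag prob) (enc_symss Ls), Pair (e x) (Sym 0)] = Some (enc r)"
    unfolding cl_def using r(1) by (rule cal_mono[rotated])
  with r that show ?thesis by blast
qed

end


section \<open>Correctness of the game procedures\<close>

definition enc_states :: "state list \<Rightarrow> sexp" where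
  "enc_states Z = sexp_list (map enc_state Z)"

fun enc_pick :: "(nat list \<times> state) option \<Rightarrow> sexp" where
  "enc_pick None = Sym 0"
| "enc_pick (Some (B, s)) = Pair (enc_syms B) (enc_state s)"

fun enc_num_option :: "real option \<Rightarrow> sexp" where
  "enc_num_option None = Sym 0"
| "enc_num_option (Some b) = Num b"

fun enc_row :: "entry \<Rightarrow> sexp" where
  "enc_row (q, A, B, e, q') = sexp_list [q, enc_syms A, enc_syms B, sexp_bool e, q']"

definition enc_rows :: "entry list \<Rightarrow> sexp" where
  "enc_rows es = sexp_list (map enc_row es)"

lemma enc_pick_eq_0: "enc_pick r = Sym 0 \<longleftrightarrow> r = None"
  by (cases r) auto

lemma foldr_after:
  "foldr (\<lambda>y acc. (y # fst acc, if s = y then fst acc else snd acc)) Z ([], []) = (Z, after s Z)"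
  by (induction Z) auto

locale lisp_game = lisp B M + game fs S for B M fs S +
  assumes wf: "\<And>c. c \<in> set fs \<Longrightarrow> wf_fm c" and fs_3: "length fs = 3"
    and len_fs: "2 * fms_len fs < M" "fms_len fs < B"
    and keys: "\<And>s p. s \<in> set S \<Longrightarrow> p \<in> set s \<Longrightarrow> list_all2 shape fs (fst p)"
    and info: "\<And>s. s \<in> set S \<Longrightarrow> list_all2 shape fs (lookup (ivec fs) s)"
    and small: "\<And>s. s \<in> set S \<Longrightarrow> length s < B \<and> size (enc_state s) < M"
    and \<delta>_in: "\<And>s A A'. s \<in> set S \<Longrightarrow> A \<in> set As \<Longrightarrow> A' \<in> set Bs \<Longrightarrow> \<delta> s A A' \<in> set S"
    and lens: "length S < B" "length As < B" "length Bs < B"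
      "\<And>A. A \<in> set As \<Longrightarrow> length A < B" "\<And>A. A \<in> set Bs \<Longrightarrow> length A < B"
begin

text \<open>The level of a transition according to \<open>cl_delta\<close>; the levels of all game
  procedures are counted from here.\<close>

definition D :: nat where "D = M + 3 * fms_len fs + 10"

definition G0 :: sexp where
  "G0 = Pair (enc_fms fs) (Pair (enc_vec (ivec fs)) (Pair (enc_symss As) (enc_symss Bs)))"

definition G :: "real \<Rightarrow> sexp" where "G b = Pair (Num b) G0"

lemma shape_ivec: "list_all2 shape fs (ivec fs)"
proof -
  obtain a b c where "fs = [a, b, c]" using fs_3 by (auto simp: eval_nat_numeral length_Suc_conv)
  then show ?thesis by (simp add: ivec_def shape_ini)
qed

lemma cl_mem_state:
  assumes "s \<in> set S" "length Z < B" "M + 3 \<le> k"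
  shows "cl k p_mem [enc_state s, enc_states Z, Sym 0] = Some (sexp_bool (s \<in> set Z))"
  unfolding enc_states_def using assms small by (intro cl_mem enc_state_inject) auto

lemma info_vec:
  assumes "s \<in> set S" "M + 3 \<le> k"
  obtains x y z where "lookup (ivec fs) s = [x, y, z]"
    "cl k p_assoc [enc_vec (ivec fs), enc_state s, Sym 0] = Some (enc_vec [x, y, z])"
proof -
  have "length (lookup (ivec fs) s) = 3" using info[OF assms(1)] fs_3 by (simp add: list_all2_lengthD[symmetric])
  then obtain x y z where "lookup (ivec fs) s = [x, y, z]" by (auto simp: eval_nat_numeral length_Suc_conv)
  moreover have "cl k p_assoc [enc_vec (ivec fs), enc_state s, Sym 0] = Some (enc_vec (lookup (ivec fs) s))"
    using size_enc_vec[OF shape_ivec] len_fs small[OF assms(1)] assms(2) by (intro cl_assoc) auto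
  ultimately show ?thesis using that by simp
qed

lemma enc_vt_root: "enc_vt t = Pair (Num (root t)) (enc_vec (subs t))"
  by (cases t) (simp add: enc_vec_def)

lemma cl_bad: "s \<in> set S \<Longrightarrow> M + 4 \<le> k \<Longrightarrow>
    cl k p_bad [enc_vec (ivec fs), enc_state s] = Some (sexp_bool (bad fs s))"
  by (rule info_vec[of s "k - 1"], assumption, simp, rule run[where j = "k - 1"])
    (simp_all add: prog_nth body_bad_def enc_vec_def[of "[_, _, _]"] enc_vt_root bad_def)

lemma cl_good: "s \<in> set S \<Longrightarrow> M + 4 \<le> k \<Longrightarrow>
    cl k p_good [enc_vec (ivec fs), enc_state s] = Some (sexp_bool (good fs s))"
  by (rule info_vec[of s "k - 1"], assumption, simp, rule run[where j = "k - 1"])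
    (simp_all add: prog_nth body_good_def enc_vec_def[of "[_, _, _]"] enc_vt_root good_def)

lemma cl_value: "s \<in> set S \<Longrightarrow> M + 4 \<le> k \<Longrightarrow>
    cl k p_value [enc_vec (ivec fs), enc_state s] = Some (Num (value_of fs s))"
  by (rule info_vec[of s "k - 1"], assumption, simp, rule run[where j = "k - 1"])
    (simp_all add: prog_nth body_value_def enc_vec_def[of "[_, _, _]"] enc_vt_root value_of_def)

lemma cl_delta_state:
  assumes "s \<in> set S" "A \<in> set As" "A' \<in> set Bs" "D \<le> k"
  shows "cl k p_delta [Pair (Pair (Pair (enc_syms A) (enc_syms A')) (enc_fms fs)) (enc_state s), enc_state s, Sym 0] =
    Some (enc_state (\<delta> s A A'))"
  unfolding \<delta>_def enc_letter_def[symmetric]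
  using assms wf keys len_fs lens small by (intro cl_delta) (auto simp: D_def)

definition pick_env :: "real \<Rightarrow> bool \<Rightarrow> state list \<Rightarrow> state \<Rightarrow> sexp" where
  "pick_env b p Z s = Pair (G b) (Pair (Pair (sexp_bool p) (enc_states Z)) (enc_state s))"

lemma cl_pick:
  assumes "s \<in> set S" "A \<in> set As" "length Z < B" "D + 4 \<le> k"
  shows "cl k p_pick [pick_env b p Z s, enc_syms A] = Some (enc_pick (pick b p Z s A))"
proof -
  let ?env = "Pair (G b) (Pair (Pair (sexp_bool p) (enc_states Z)) (Pair (enc_state s) (enc_syms A)))"
  let ?F = "\<lambda>A' acc. if b \<le> value_of fs (\<delta> s A A') \<or> (\<delta> s A A' \<in> set Z) = p then Some (A', \<delta> s A A') else acc"
  have "cl (D + 3) p_picks [?env, sexp_list (map enc_syms Bs), enc_pick None] = Some (enc_pick (foldr ?F Bs None))"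
  proof (rule cl_foldr[where g = 35 and j = "D + 1"])
    fix ys A' zs assume "Bs = ys @ A' # zs"
    then have A': "A' \<in> set Bs" by simp
    note s' = \<delta>_in[OF assms(1,2) A']
    have D: "M + 4 \<le> D" "M + 3 \<le> D" by (simp_all add: D_def)
    show "cl (D + 1) 35 [?env, enc_syms A', enc_pick (foldr ?F zs None)] = Some (enc_pick (?F A' (foldr ?F zs None)))"
      by (rule run[where j = D])
        (simp_all add: prog_nth body_picks_def g_prob_def g_init_def G_def G0_def
          cl_delta_state[OF assms(1,2) A' order_refl] cl_value[OF s' D(1)] cl_mem_state[OF s' assms(3) D(2)])
  qed (use lens in \<open>simp_all add: prog_nth length_prog\<close>)
  then have "cl (D + 3) p_picks [?env, enc_symss Bs, Sym 0] = Some (enc_pick (pick b p Z s A))"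
    by (simp add: enc_symss_def pick_def)
  then show ?thesis
    by (intro run[where j = "D + 3"])
      (use assms(4) in \<open>simp_all add: prog_nth body_pick_def g_Bs_def pick_env_def G_def G0_def\<close>)
qed

lemma cl_all:
  assumes "s \<in> set S" "length Z < B" "D + 7 \<le> k"
  shows "cl k p_all [pick_env b p Z s, enc_symss As, Sym 1] =
    Some (sexp_bool (\<forall>A\<in>set As. pick b p Z s A \<noteq> None))"
proof -
  let ?F = "\<lambda>A acc. if pick b p Z s A = None then False else acc"
  have "cl k p_all [pick_env b p Z s, sexp_list (map enc_syms As), sexp_bool True] = Some (sexp_bool (foldr ?F As True))"
  proof (rule cl_foldr[where g = 38 and j = "D + 5"])
    fix ys A zs assume "As = ys @ A # zs"
    then have A: "A \<in> set As" by simp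
    show "cl (D + 5) 38 [pick_env b p Z s, enc_syms A, sexp_bool (foldr ?F zs True)] = Some (sexp_bool (?F A (foldr ?F zs True)))"
      by (rule run[where j = "D + 4"])
        (simp_all add: prog_nth body_all_def cl_pick[OF assms(1) A assms(2)] enc_pick_eq_0 sexp_bool_consts)
  qed (use lens assms in \<open>simp_all add: prog_nth length_prog\<close>)
  moreover have "foldr ?F xs True \<longleftrightarrow> (\<forall>A\<in>set xs. pick b p Z s A \<noteq> None)" for xs by (induction xs) auto
  ultimately show ?thesis by (simp add: enc_symss_def sexp_bool_consts)
qed

lemma cl_ex:
  assumes "s \<in> set S" "length Z < B" "D + 7 \<le> k"
  shows "cl k p_ex [pick_env b p Z s, enc_symss As, Sym 0] =
    Some (sexp_bool (\<exists>A\<in>set As. pick b p Z s A \<noteq> None))"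
proof -
  let ?F = "\<lambda>A acc. if pick b p Z s A = None then acc else True"
  have "cl k p_ex [pick_env b p Z s, sexp_list (map enc_syms As), sexp_bool False] = Some (sexp_bool (foldr ?F As False))"
  proof (rule cl_foldr[where g = 40 and j = "D + 5"])
    fix ys A zs assume "As = ys @ A # zs"
    then have A: "A \<in> set As" by simp
    show "cl (D + 5) 40 [pick_env b p Z s, enc_syms A, sexp_bool (foldr ?F zs False)] = Some (sexp_bool (?F A (foldr ?F zs False)))"
      by (rule run[where j = "D + 4"])
        (simp_all add: prog_nth body_ex_def cl_pick[OF assms(1) A assms(2)] enc_pick_eq_0 sexp_bool_consts)
  qed (use lens assms in \<open>simp_all add: prog_nth length_prog\<close>)
  moreover have "foldr ?F xs False \<longleftrightarrow> (\<exists>A\<in>set xs. pick b p Z s A \<noteq> None)" for xs by (induction xs) auto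
  ultimately show ?thesis by (simp add: enc_symss_def sexp_bool_consts)
qed

definition cond_of :: "nat \<Rightarrow> real \<Rightarrow> state list \<Rightarrow> state \<Rightarrow> state list \<Rightarrow> bool" where
  "cond_of n b W = (if n = 0 then win_cond b else if n = 1 then lose_cond b W else live_cond b W)"

lemma cl_cond:
  assumes "s \<in> set S" "length Z < B" "length W < B" "D + 8 \<le> k"
  shows "cl k p_cond [Sym n, G b, enc_states W, enc_state s, enc_states Z] = Some (sexp_bool (cond_of n b W s Z))"
proof -
  have D: "M + 4 \<le> D + 7" "M + 3 \<le> D + 7" by (simp_all add: D_def)
  have env: "Pair (G b) (Pair (Pair (Sym 1) (enc_states Z)) (enc_state s)) = pick_env b True Z s"
    "Pair (G b) (Pair (Pair (Sym 0) (enc_states Z)) (enc_state s)) = pick_env b False Z s" for b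
    by (simp_all add: pick_env_def sexp_bool_consts)
  note all = cl_all[OF assms(1,2) order_refl, unfolded One_nat_def]
  note rules = prog_nth body_cond_def g_init_def g_As_def G_def G0_def
    env[unfolded G_def G0_def One_nat_def] cl_bad[OF assms(1) D(1)] cl_good[OF assms(1) D(1)]
    cl_mem_state[OF assms(1,3) D(2)] all cl_ex[OF assms(1,2) order_refl] sexp_bool_consts
    cond_of_def win_cond_def lose_cond_def live_cond_def
  consider "n = 0" | "n = 1" | "n \<noteq> 0" "n \<noteq> 1" by blast
  then show ?thesis
    by cases (rule run[where j = "D + 7"]; use assms(4) in \<open>simp add: rules del: not_None_eq\<close>)+
qed

text \<open>Being distinct and inside \<open>S\<close>, the intermediate lists of the iteration are
  shorter than \<open>B\<close>, as the loops over them require.\<close>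

lemma foldr_ins_inv:
  assumes "ranked c Z" "set Z \<subseteq> set S" "set xs \<subseteq> set S"
  shows "ranked c (foldr (ins c) xs Z) \<and> set (foldr (ins c) xs Z) \<subseteq> set S \<and> length (foldr (ins c) xs Z) < B"
proof -
  have r: "ranked c (foldr (ins c) xs Z)" by (rule ranked_foldr_ins[OF assms(1)])
  obtain ys where ys: "foldr (ins c) xs Z = ys @ Z" "set ys \<subseteq> set xs"
    using foldr_ins_append[of c xs Z] by blast
  have s: "set (foldr (ins c) xs Z) \<subseteq> set S"
    unfolding ys(1) set_append using ys(2) assms(2,3) by blast
  show ?thesis using r s length_le_of_distinct_subset[OF ranked_distinct[OF r] s] lens(1) by simp
qed

lemma cl_solve:
  assumes "length W < B" "D + 14 \<le> k"
  shows "cl k p_solve [Pair (Pair (Sym n) (G b)) (Pair (enc_states W) (enc_states S)), enc_states S, Sym 0] =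
    Some (enc_states (solve S (cond_of n b W)))"
proof -
  let ?c = "cond_of n b W"
  let ?env = "Pair (Pair (Sym n) (G b)) (Pair (enc_states W) (enc_states S))"
  have round: "cl (D + 11) p_round [?env, enc_states S, enc_states Z] = Some (enc_states (foldr (ins ?c) S Z))"
    if "ranked ?c Z" "set Z \<subseteq> set S" for Z
  proof -
    have "cl (D + 11) p_round [?env, sexp_list (map enc_state S), enc_states Z] = Some (enc_states (foldr (ins ?c) S Z))"
    proof (rule cl_foldr[where g = 43 and j = "D + 9"])
      fix ys s zs assume S: "S = ys @ s # zs"
      then have s: "s \<in> set S" "set zs \<subseteq> set S" by auto
      let ?Z = "foldr (ins ?c) zs Z"
      have Z: "length ?Z < B" using foldr_ins_inv[OF that s(2)] by simp
      have D: "M + 3 \<le> D + 8" by (simp add: D_def)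
      show "cl (D + 9) 43 [?env, enc_state s, enc_states ?Z] = Some (enc_states (ins ?c s ?Z))"
        by (rule run[where j = "D + 8"])
          (simp_all add: prog_nth body_round_def cl_mem_state[OF s(1) Z D] cl_cond[OF s(1) Z assms(1)] ins_def[of _ s]
            enc_states_def[of "s # _"] enc_states_def[of ?Z, symmetric])
    qed (use lens in \<open>simp_all add: prog_nth length_prog\<close>)
    then show ?thesis by (simp add: enc_states_def)
  qed
  have inv: "ranked ?c (foldr (\<lambda>_. foldr (ins ?c) S) zs []) \<and> set (foldr (\<lambda>_. foldr (ins ?c) S) zs []) \<subseteq> set S" for zs
  proof (induction zs)
    case (Cons z zs)
    then show ?case using foldr_ins_inv[of ?c "foldr (\<lambda>_. foldr (ins ?c) S) zs []" S] by simp
  qed (simp add: ranked.intros)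
  have "cl k p_solve [?env, sexp_list (map enc_state S), enc_states []] =
      Some (enc_states (foldr (\<lambda>_. foldr (ins ?c) S) S []))"
  proof (rule cl_foldr[where g = 45 and j = "D + 12"])
    fix ys s zs
    let ?Z = "foldr (\<lambda>_. foldr (ins ?c) S) zs []"
    show "cl (D + 12) 45 [?env, enc_state s, enc_states ?Z] = Some (enc_states (foldr (ins ?c) S ?Z))"
      using round[OF inv[THEN conjunct1] inv[THEN conjunct2], of zs]
      by (intro run[where j = "D + 11"]) (simp_all add: prog_nth body_solve_def)
  qed (use lens assms in \<open>simp_all add: prog_nth length_prog\<close>)
  then show ?thesis by (simp add: enc_states_def solve_def)
qed

definition regions :: "real \<Rightarrow> sexp" where
  "regions b = Pair (enc_states (win b)) (Pair (enc_states (lose b)) (enc_states (live b)))"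

lemma lens_regions: "length (win b) < B" "length (lose b) < B" "length (live b) < B"
  unfolding win_def lose_def live_def using length_solve lens(1) by (metis le_less_trans)+

lemma cl_regions:
  assumes "D + 15 \<le> k"
  shows "cl k p_regions [G b, enc_states S] = Some (regions b)"
proof -
  have s: "cl (D + 14) p_solve [Pair (Pair (Sym 0) (G b)) (Pair (Sym 0) (enc_states S)), enc_states S, Sym 0] = Some (enc_states (win b))"
    "cl (D + 14) p_solve [Pair (Pair (Sym 1) (G b)) (Pair (enc_states (win b)) (enc_states S)), enc_states S, Sym 0] = Some (enc_states (lose b))"
    "cl (D + 14) p_solve [Pair (Pair (Sym 2) (G b)) (Pair (enc_states (lose b)) (enc_states S)), enc_states S, Sym 0] = Some (enc_states (live b))"
    using cl_solve[of "[]" "D + 14" 0 b] cl_solve[of "win b" "D + 14" 1 b] cl_solve[of "lose b" "D + 14" 2 b] lens_regions B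
    by (simp_all add: cond_of_def enc_states_def[of "[]"] win_def[symmetric] lose_def[symmetric] live_def[symmetric])
  show ?thesis
    by (rule run[where j = "D + 14"])
      (use assms s in \<open>simp_all add: prog_nth body_regions_def call_solve_def regions_def\<close>)
qed

lemma cl_best:
  assumes "s0 \<in> set S" "D + 18 \<le> k"
  shows "cl k p_best [Pair G0 (Pair (enc_state s0) (enc_states S)), enc_states S, Sym 0] =
    Some (enc_num_option (best s0))"
proof -
  let ?env = "Pair G0 (Pair (enc_state s0) (enc_states S))"
  let ?F = "\<lambda>s acc. if s0 \<in> set (live (value_of fs s)) \<and> (case acc of None \<Rightarrow> True | Some b \<Rightarrow> b \<le> value_of fs s)
     then Some (value_of fs s) else acc"
  have "cl k p_best [?env, sexp_list (map enc_state S), enc_num_option None] = Some (enc_num_option (foldr ?F S None))"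
  proof (rule cl_foldr[where g = 48 and j = "D + 16"])
    fix ys s zs assume "S = ys @ s # zs"
    then have s: "s \<in> set S" by simp
    let ?acc = "foldr ?F zs None" and ?b = "value_of fs s"
    have v: "cl (D + 15) p_value [enc_vec (ivec fs), enc_state s] = Some (Num ?b)"
      by (rule cl_value[OF s]) (simp add: D_def)
    have m: "cl (D + 15) p_mem [enc_state s0, enc_states (live ?b), Sym 0] = Some (sexp_bool (s0 \<in> set (live ?b)))"
      by (rule cl_mem_state[OF assms(1) lens_regions(3)]) (simp add: D_def)
    have r: "cl (D + 15) p_regions [Pair (Num ?b) G0, enc_states S] = Some (regions ?b)"
      using cl_regions[of "D + 15" ?b] by (simp add: G_def)
    have G0: "G0 = Pair (enc_fms fs) (Pair (enc_vec (ivec fs)) (Pair (enc_symss As) (enc_symss Bs)))"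
      by (simp add: G0_def)
    show "cl (D + 16) 48 [?env, enc_state s, enc_num_option ?acc] = Some (enc_num_option (?F s ?acc))"
      by (rule run[where j = "D + 15"]; cases ?acc)
        (simp_all add: prog_nth body_best_def m r[unfolded G0] v regions_def G0 sexp_bool_consts)
  qed (use lens assms in \<open>simp_all add: prog_nth length_prog\<close>)
  then show ?thesis by (simp add: enc_states_def best_def)
qed

lemma cl_after:
  assumes "s \<in> set S" "length Z < B" "M + 3 \<le> k"
  shows "cl k p_after [enc_state s, enc_states Z, Pair (Sym 0) (Sym 0)] =
    Some (Pair (enc_states Z) (enc_states (after s Z)))"
proof -
  let ?ea = "\<lambda>p. Pair (enc_states (fst p)) (enc_states (snd p))"
  let ?F = "\<lambda>y acc. (y # fst acc, if s = y then fst acc else snd acc)"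
  have "cl k p_after [enc_state s, sexp_list (map enc_state Z), ?ea ([], [])] = Some (?ea (foldr ?F Z ([], [])))"
  proof (rule cl_foldr[where g = 50 and j = "M + 1"])
    fix ys y zs
    have "cl M p_eq [enc_state s, enc_state y] = Some (sexp_bool (s = y))"
      using cl_eq[of "enc_state s" "enc_state y" M] small[OF assms(1)] by (simp add: enc_state_inject)
    then show "cl (M + 1) 50 [enc_state s, enc_state y, ?ea (foldr ?F zs ([], []))] = Some (?ea (?F y (foldr ?F zs ([], []))))"
      by (intro run[where j = M]) (simp_all add: prog_nth body_after_def enc_states_def[of "_ # _"] enc_states_def[symmetric])
  qed (use assms in \<open>simp_all add: prog_nth length_prog\<close>)
  then show ?thesis by (simp add: foldr_after enc_states_def[of "[]"] enc_states_def[symmetric])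
qed

lemma cl_entries:
  assumes "s \<in> set S" "length Z < B" "D + 7 \<le> k"
  shows "cl k p_entries [Pair (Pair (G b) (Pair (sexp_bool p) (enc_states Z)))
      (Pair (Pair q (sexp_bool m)) (enc_state s)), enc_symss As, enc_rows acc] =
    Some (enc_rows (entries (value_of fs) As b q m (pick b p Z s) acc))"
proof -
  let ?env = "Pair (Pair (G b) (Pair (sexp_bool p) (enc_states Z))) (Pair (Pair q (sexp_bool m)) (enc_state s))"
  let ?F = "\<lambda>A acc.
     case pick b p Z s A of Some (B, s') \<Rightarrow> (q, A, B, b \<le> value_of fs s', done_or (b \<le> value_of fs s') (mode_state m s')) # acc
     | None \<Rightarrow> if m then acc else (q, A, [], False, Sym 0) # acc"
  have "cl k p_entries [?env, sexp_list (map enc_syms As), enc_rows acc] = Some (enc_rows (foldr ?F As acc))"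
  proof (rule cl_foldr[where g = 52 and j = "D + 5"])
    fix ys A zs assume "As = ys @ A # zs"
    then have A: "A \<in> set As" by simp
    let ?acc = "foldr ?F zs acc"
    have pk: "cl (D + 4) p_pick [Pair (G b) (Pair (Pair (sexp_bool p) (enc_states Z)) (enc_state s)), enc_syms A] =
        Some (enc_pick (pick b p Z s A))"
      using cl_pick[OF assms(1) A assms(2) order_refl, of b p] by (simp add: pick_env_def)
    show "cl (D + 5) 52 [?env, enc_syms A, enc_rows ?acc] = Some (enc_rows (?F A ?acc))"
    proof (cases "pick b p Z s A")
      case None
      then show ?thesis
        by (intro run[where j = "D + 4"])
          (simp_all add: prog_nth body_entries_def pk enc_rows_def[of "_ # _"] enc_rows_def[symmetric] enc_syms_def[of "[]"] sexp_bool_consts)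
    next
      case (Some r)
      then obtain A' s' where r: "pick b p Z s A = Some (A', s')" by (cases r) auto
      then have s': "s' \<in> set S" using pick_Some[OF r] \<delta>_in[OF assms(1) A] by auto
      have v: "cl (D + 4) p_value [enc_vec (ivec fs), enc_state s'] = Some (Num (value_of fs s'))"
        by (rule cl_value[OF s']) (simp add: D_def)
      show ?thesis
        by (intro run[where j = "D + 4"])
          (simp_all add: prog_nth body_entries_def pk[unfolded G_def G0_def] r G_def G0_def g_init_def v
            enc_rows_def[of "_ # _"] enc_rows_def[symmetric] mode_state_def)
    qed
  qed (use lens assms in \<open>simp_all add: prog_nth length_prog\<close>)
  then show ?thesis by (simp add: entries_def enc_symss_def)
qed

lemma cl_rows:
  assumes "D + 10 \<le> k"
  shows "cl k p_rows [Pair (G b) (regions b), enc_states S, Sym 0] = Some (enc_rows (rows b))"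
proof -
  let ?env = "Pair (G b) (regions b)"
  have "cl k p_rows [?env, sexp_list (map enc_state S), enc_rows []] = Some (enc_rows (foldr (add_rows b) S []))"
  proof (rule cl_foldr[where g = 55 and j = "D + 8"])
    fix ys s zs assume "S = ys @ s # zs"
    then have s: "s \<in> set S" by simp
    let ?acc = "foldr (add_rows b) zs []"
    \<comment> \<open>Both branches of \<open>move0\<close> become a single call of
      \<open>pick\<close>, with the flag and the list that \<open>p_target\<close> returns.\<close>
    define p where "p \<longleftrightarrow> s \<in> set (win b)"
    define Z where "Z = (if p then after s (win b) else lose b)"
    have Z: "length Z < B" "length (after s (live b)) < B"
      using le_less_trans[OF length_after lens_regions(1)] le_less_trans[OF length_after lens_regions(3)]
        lens_regions(2) by (simp_all add: Z_def)
    have mv: "move0 b s = pick b p Z s" "move1 b s = pick b True (after s (live b)) s"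
      by (auto simp: fun_eq_iff move0_def move1_def p_def Z_def)
    have m: "cl (D + 6) p_mem [enc_state s, enc_states (win b), Sym 0] = Some (sexp_bool p)"
      unfolding p_def by (rule cl_mem_state[OF s lens_regions(1)]) (simp add: D_def)
    have a: "cl j p_after [enc_state s, enc_states W, Pair (Sym 0) (Sym 0)] = Some (Pair (enc_states W) (enc_states (after s W)))"
      if "length W < B" "D \<le> j" for W j by (rule cl_after[OF s that(1)]) (use that in \<open>simp add: D_def\<close>)
    have t: "cl (D + 7) p_target [regions b, enc_state s] = Some (Pair (sexp_bool p) (enc_states Z))"
      by (rule run[where j = "D + 6"])
        (simp_all add: prog_nth body_target_def regions_def m a[OF lens_regions(1)] Z_def sexp_bool_def)
    note e = cl_entries[OF s Z(2) order_refl, of b True "Pair (Sym 1) (enc_state s)" True, unfolded sexp_bool_consts One_nat_def]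
      cl_entries[OF s Z(1) order_refl, of b p "Pair (Sym 1) (enc_state s)" False, unfolded sexp_bool_consts One_nat_def]
      cl_entries[OF s Z(1) order_refl, of b p "Pair (Sym 0) (enc_state s)" False, unfolded sexp_bool_consts One_nat_def]
    have G: "den c C (?env # \<rho>) (g_As (EFst V0)) = Some (enc_symss As)" for c C \<rho>
      by (simp add: g_As_def G_def G0_def)
    have R: "regions b = Pair (enc_states (win b)) (Pair (enc_states (lose b)) (enc_states (live b)))"
      by (simp add: regions_def)
    show "cl (D + 8) 55 [?env, enc_state s, enc_rows ?acc] = Some (enc_rows (add_rows b s ?acc))"
      unfolding add_rows_def mv mode_state_def
      by (rule run[where j = "D + 7"])
        (simp_all add: prog_nth body_rows_def call_entries_def G[unfolded R] t[unfolded R] a[OF lens_regions(3)] e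
          R sexp_bool_consts)
  qed (use lens assms in \<open>simp_all add: prog_nth length_prog\<close>)
  then show ?thesis by (simp add: enc_states_def rows_def enc_rows_def)
qed

end


section \<open>Counting vectors and states\<close>

lemma listset_Cons: "listset (A # As) = (\<lambda>(x, xs). x # xs) ` (A \<times> listset As)"
  by (auto simp: set_Cons_def)

lemma in_listset: "xs \<in> listset As \<longleftrightarrow> list_all2 (\<in>) xs As"
proof (induction As arbitrary: xs)
  case (Cons A As)
  then show ?case by (cases xs) (auto simp: set_Cons_def)
qed simp

lemma card_listset:
  "(\<And>A. A \<in> set As \<Longrightarrow> finite A) \<Longrightarrow> finite (listset As) \<and> card (listset As) \<le> prod_list (map card As)"
proof (induction As)
  case (Cons A As)
  then have IH: "finite (listset As)" "card (listset As) \<le> prod_list (map card As)" "finite A" by auto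
  have "card (listset (A # As)) \<le> card (A \<times> listset As)"
    unfolding listset_Cons using IH by (intro card_image_le) auto
  also have "\<dots> \<le> card A * prod_list (map card As)" using IH by (simp add: card_cartesian_product)
  finally show ?case using IH unfolding listset_Cons by auto
qed simp

text \<open>An over-approximation that looks at the syntax only: minima and maxima select among
  values of the arguments, while a function may produce a new value for each tuple. \<open>z\<close>
  is the value beyond the end.\<close>

fun vals :: "real \<Rightarrow> fm \<Rightarrow> real set" where
  "vals z (Fm q cs) = insert z
     (case q of ONeg \<Rightarrow> (\<lambda>x. 1 - x) ` \<Union> (set (map (vals z) cs))
      | OFun f \<Rightarrow> f ` listset (map (vals z) cs)
      | OTrue \<Rightarrow> {0, 1} | OFalse \<Rightarrow> {0, 1} | OProp b p \<Rightarrow> {0, 1}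
      | _ \<Rightarrow> \<Union> (set (map (vals z) cs)))"

lemma add_le_mult:
  assumes "2 \<le> a" "2 \<le> b"
  shows "a + b \<le> a * (b :: nat)"
proof -
  obtain x y where "a = 2 + x" "b = 2 + y" using assms le_Suc_ex by blast
  then show ?thesis by (simp add: algebra_simps)
qed

lemma sum_list_power_le: "(\<And>c. c \<in> set cs \<Longrightarrow> 1 \<le> g c) \<Longrightarrow>
    sum_list (map (\<lambda>c. 2 ^ g c) cs) \<le> (2 :: nat) ^ sum_list (map g cs)"
proof (induction cs)
  case (Cons c cs)
  show ?case
  proof (cases cs)
    case Nil
    then show ?thesis by simp
  next
    case (Cons c' cs')
    let ?s = "sum_list (map g cs)"
    have "1 \<le> g c'" "1 \<le> g c" using Cons.prems Cons by auto
    then have s: "1 \<le> ?s" "1 \<le> g c" using Cons by auto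
    have "2 ^ g c + sum_list (map (\<lambda>c. 2 ^ g c) cs) \<le> 2 ^ g c + (2 :: nat) ^ ?s"
      using Cons.IH Cons.prems by simp
    also have "\<dots> \<le> 2 ^ g c * 2 ^ ?s"
    proof -
      have "(2 :: nat) ^ 1 \<le> 2 ^ g c" "(2 :: nat) ^ 1 \<le> 2 ^ ?s" using s by (intro power_increasing; simp)+
      then show ?thesis by (intro add_le_mult) auto
    qed
    finally show ?thesis by (simp add: power_add)
  qed
qed simp

lemma prod_list_power: "prod_list (map (\<lambda>c. (2 :: nat) ^ g c) cs) = 2 ^ sum_list (map g cs)"
  by (induction cs) (auto simp: power_add)

lemma prod_list_mono: "(\<And>c. c \<in> set cs \<Longrightarrow> f c \<le> g c) \<Longrightarrow> prod_list (map f cs) \<le> prod_list (map (g :: _ \<Rightarrow> nat) cs)"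
  by (induction cs) (auto intro: mult_le_mono)

text \<open>Powers of two with positive exponents have a sum at most their product, so unions and
  products of the argument sets both stay below 2 to the sum of the lengths. The root's own unit of
  length pays for inserting \<open>z\<close>.\<close>

lemma card_vals:
  assumes "z \<in> {0, 1}"
  shows "finite (vals z c) \<and> card (vals z c) \<le> 2 ^ fm_len c"
proof (induction c)
  case (Fm q cs)
  let ?U = "\<Union> (set (map (vals z) cs))"
  have p1: "Suc (2 ^ m) \<le> (2 :: nat) ^ Suc m" for m by simp
  have fU: "finite ?U" using Fm by auto
  have "card ?U \<le> sum_list (map (\<lambda>c. card (vals z c)) cs)"
    using Fm
  proof (induction cs)
    case (Cons c cs)
    have "card (\<Union> (set (map (vals z) (c # cs)))) \<le> card (vals z c) + card (\<Union> (set (map (vals z) cs)))"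
      by (simp add: card_Un_le)
    also have "\<dots> \<le> card (vals z c) + sum_list (map (\<lambda>c. card (vals z c)) cs)" using Cons by simp
    finally show ?case by simp
  qed simp
  also have "\<dots> \<le> sum_list (map (\<lambda>c. 2 ^ fm_len c) cs)" using Fm by (intro sum_list_mono) auto
  also have "\<dots> \<le> 2 ^ sum_list (map fm_len cs)" using fm_len_pos by (rule sum_list_power_le)
  finally have U: "card ?U \<le> 2 ^ sum_list (map fm_len cs)" .
  have I: "card (insert z V) \<le> 2 ^ fm_len (Fm q cs) \<and> finite (insert z V)" if "card V \<le> 2 ^ sum_list (map fm_len cs)" "finite V" for V
  proof -
    have "card (insert z V) \<le> Suc (card V)" by (rule card_insert_le_m1) auto
    also have "\<dots> \<le> Suc (2 ^ sum_list (map fm_len cs))" using that(1) by simp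
    also have "\<dots> \<le> 2 ^ Suc (sum_list (map fm_len cs))" by (rule p1)
    also have "\<dots> = 2 ^ fm_len (Fm q cs)" by simp
    finally show ?thesis using that by simp
  qed
  have L: "finite (listset (map (vals z) cs))" "card (listset (map (vals z) cs)) \<le> 2 ^ sum_list (map fm_len cs)"
  proof -
    have *: "finite (listset (map (vals z) cs)) \<and> card (listset (map (vals z) cs)) \<le> prod_list (map card (map (vals z) cs))"
      using Fm by (intro card_listset) auto
    have "prod_list (map card (map (vals z) cs)) \<le> prod_list (map (\<lambda>c. 2 ^ fm_len c) cs)"
      unfolding map_map using Fm by (intro prod_list_mono) auto
    then show "finite (listset (map (vals z) cs))" "card (listset (map (vals z) cs)) \<le> 2 ^ sum_list (map fm_len cs)"
      using * by (auto simp: prod_list_power)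
  qed
  have two: "insert z {0, 1} = {0, 1}" using assms by auto
  have leaf: "card (insert z {0, 1}) \<le> 2 ^ fm_len (Fm q cs) \<and> finite (insert z {0, 1})"
  proof -
    have "card {0, 1 :: real} = 2 ^ 1" by simp
    also have "\<dots> \<le> 2 ^ fm_len (Fm q cs)" by (intro power_increasing) auto
    finally show ?thesis unfolding two by simp
  qed
  show ?case
  proof (cases q)
    case ONeg
    have "card ((\<lambda>x. 1 - x) ` ?U) \<le> 2 ^ sum_list (map fm_len cs)" using card_image_le[OF fU] U le_trans by blast
    then show ?thesis using I[of "(\<lambda>x. 1 - x) ` ?U"] fU ONeg by simp
  next
    case (OFun f)
    have "card (f ` listset (map (vals z) cs)) \<le> 2 ^ sum_list (map fm_len cs)"
      using card_image_le[OF L(1)] L(2) le_trans by blast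
    then show ?thesis using I[of "f ` listset (map (vals z) cs)"] L(1) OFun by simp
  qed (use I[OF U fU] leaf in simp_all)
qed

fun vts :: "real \<Rightarrow> fm \<Rightarrow> vt set" where
  "vts z (Fm q cs) = (\<lambda>(r, ts). VT r ts) ` (vals z (Fm q cs) \<times> listset (map (vts z) cs))"

lemma sum_list_squares: "sum_list (map (\<lambda>c. g c * g c) cs) \<le> sum_list (map g cs) * (sum_list (map g cs) :: nat)"
  by (induction cs) (auto simp: algebra_simps)

text \<open>The root contributes its length to the exponent, the arguments the squares of theirs.
  With m for the total length of the arguments, m + 1 + m^2 is at most (m + 1)^2.\<close>

lemma card_vts:
  assumes "z \<in> {0, 1}"
  shows "finite (vts z c) \<and> card (vts z c) \<le> 2 ^ (fm_len c * fm_len c)"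
proof (induction c)
  case (Fm q cs)
  let ?n = "sum_list (map fm_len cs)"
  have *: "finite (listset (map (vts z) cs)) \<and> card (listset (map (vts z) cs)) \<le> prod_list (map card (map (vts z) cs))"
    using Fm by (intro card_listset) auto
  have "prod_list (map card (map (vts z) cs)) \<le> prod_list (map (\<lambda>c. 2 ^ (fm_len c * fm_len c)) cs)"
    unfolding map_map using Fm by (intro prod_list_mono) auto
  also have "\<dots> = 2 ^ sum_list (map (\<lambda>c. fm_len c * fm_len c) cs)" by (rule prod_list_power)
  also have "\<dots> \<le> 2 ^ (?n * ?n)" by (intro power_increasing sum_list_squares) simp
  finally have L: "card (listset (map (vts z) cs)) \<le> 2 ^ (?n * ?n)" using * by simp
  note v = card_vals[OF assms, of "Fm q cs"]
  have "card (vts z (Fm q cs)) \<le> card (vals z (Fm q cs) \<times> listset (map (vts z) cs))"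
    unfolding vts.simps using * v by (intro card_image_le) (auto simp del: vals.simps)
  also have "\<dots> \<le> 2 ^ (Suc ?n) * 2 ^ (?n * ?n)"
    unfolding card_cartesian_product using v L by (intro mult_le_mono) (auto simp del: vals.simps)
  also have "\<dots> = 2 ^ (Suc ?n + ?n * ?n)" by (simp add: power_add)
  also have "\<dots> \<le> 2 ^ (fm_len (Fm q cs) * fm_len (Fm q cs))" by (intro power_increasing) auto
  finally show ?case using * v by (auto simp del: vals.simps)
qed

lemma root_vts: "t \<in> vts z c \<Longrightarrow> root t \<in> vals z c"
  by (cases c) (auto simp del: vals.simps)

lemma shape_vts: "t \<in> vts z c \<Longrightarrow> shape c t"
proof (induction c arbitrary: t)
  case (Fm q cs)
  then have "list_all2 (\<in>) (subs t) (map (vts z) cs)" by (auto simp: in_listset)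
  then show ?case using Fm by (auto simp: shape_iff list_all2_conv_all_nth)
qed

lemma ini_vts: "ini z c \<in> vts z c"
  by (induction c) (auto simp: in_listset list_all2_conv_all_nth image_iff)

lemma opval_vals:
  assumes "arity_ok q (length cs)" "list_all2 (\<in>) ws (map (vals z) cs)" "list_all2 (\<in>) us (map (vals z) cs)"
    "u \<in> vals z (Fm q cs)" "z \<in> {0, 1}"
  shows "opval q a ws us u \<in> vals z (Fm q cs)"
proof -
  have len: "length ws = length cs" "length us = length cs" using assms(2,3) by (auto dest: list_all2_lengthD)
  have nth: "ws ! i \<in> vals z (cs ! i)" "us ! i \<in> vals z (cs ! i)" if "i < length cs" for i
    using assms(2,3) that by (auto simp: list_all2_conv_all_nth)
  have in_U: "x \<in> \<Union> (set (map (vals z) cs))" if "x \<in> vals z (cs ! i)" "i < length cs" for x i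
    using that by auto
  show ?thesis
  proof (cases q)
    case ONeg
    then show ?thesis using assms(1) in_U[OF nth(1), of 0] by auto
  next
    case ONext
    then show ?thesis using assms(1) in_U[OF nth(2), of 0] by auto
  next
    case (OFun f)
    then show ?thesis using assms(2) by (auto simp: in_listset)
  next
    case OAnd
    then show ?thesis using assms(1) in_U[OF nth(1), of 0] in_U[OF nth(1), of 1] by (auto simp: min_def)
  next
    case OOr
    then show ?thesis using assms(1) in_U[OF nth(1), of 0] in_U[OF nth(1), of 1] by (auto simp: max_def)
  next
    case OUntil
    then show ?thesis using assms(1,4) in_U[OF nth(1), of 0] in_U[OF nth(1), of 1] by (auto simp: min_def max_def)
  next
    case ORelease
    then show ?thesis using assms(1,4) in_U[OF nth(1), of 0] in_U[OF nth(1), of 1] by (auto simp: min_def max_def)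
  qed (use assms(5) in auto)
qed

lemma step_vts:
  assumes "wf_fm c" "t \<in> vts z c" "z \<in> {0, 1}"
  shows "step a c t \<in> vts z c"
  using assms(1,2)
proof (induction c arbitrary: t)
  case (Fm q cs)
  let ?ws = "vstep a cs (subs t)"
  from Fm.prems(2) have u: "root t \<in> vals z (Fm q cs)" and ts: "list_all2 (\<in>) (subs t) (map (vts z) cs)"
    by (auto simp: in_listset simp del: vals.simps)
  have ws: "list_all2 (\<in>) ?ws (map (vts z) cs)"
    using Fm ts by (auto simp: list_all2_conv_all_nth vstep_def)
  have r: "list_all2 (\<in>) (map root xs) (map (vals z) cs)" if "list_all2 (\<in>) xs (map (vts z) cs)" for xs
    using that by (auto simp: list_all2_conv_all_nth intro: root_vts)
  have "opval q a (map root ?ws) (map root (subs t)) (root t) \<in> vals z (Fm q cs)"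
    using Fm.prems u by (intro opval_vals r ws ts assms(3)) auto
  then show ?case using ws
    by (auto simp: step.simps Let_def vstep_def[symmetric] in_listset image_iff simp del: vals.simps)
qed

definition vec_universe :: "fm list \<Rightarrow> vec set" where
  "vec_universe fs = listset (map2 vts [1, 0, 0] fs)"

lemma vec_universe:
  assumes "length fs = 3" "\<And>c. c \<in> set fs \<Longrightarrow> wf_fm c"
  shows "finite (vec_universe fs)" "card (vec_universe fs) \<le> 2 ^ (fms_len fs * fms_len fs)"
    "ivec fs \<in> vec_universe fs" "V \<in> vec_universe fs \<Longrightarrow> vstep a fs V \<in> vec_universe fs"
    "V \<in> vec_universe fs \<Longrightarrow> list_all2 shape fs V"
proof -
  obtain c0 c1 c2 where fs: "fs = [c0, c1, c2]" using assms(1) by (auto simp: eval_nat_numeral length_Suc_conv)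
  note c = card_vts[of 1 c0] card_vts[of 0 c1] card_vts[of 0 c2]
  have U: "vec_universe fs = listset [vts 1 c0, vts 0 c1, vts 0 c2]" by (simp add: vec_universe_def fs)
  have *: "finite (vec_universe fs) \<and> card (vec_universe fs) \<le> prod_list (map card [vts 1 c0, vts 0 c1, vts 0 c2])"
    unfolding U using c by (intro card_listset) auto
  then show "finite (vec_universe fs)" by simp
  have "prod_list (map card [vts 1 c0, vts 0 c1, vts 0 c2]) \<le> prod_list (map (\<lambda>c. 2 ^ (fm_len c * fm_len c)) fs)"
    using c by (simp add: fs mult_le_mono)
  also have "\<dots> = 2 ^ sum_list (map (\<lambda>c. fm_len c * fm_len c) fs)" by (rule prod_list_power)
  also have "\<dots> \<le> 2 ^ (fms_len fs * fms_len fs)"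
    unfolding fms_len_def by (intro power_increasing sum_list_squares) simp
  finally show "card (vec_universe fs) \<le> 2 ^ (fms_len fs * fms_len fs)" using * by simp
  show "ivec fs \<in> vec_universe fs" unfolding U in_listset by (simp add: ivec_def fs ini_vts)
  show "V \<in> vec_universe fs \<Longrightarrow> vstep a fs V \<in> vec_universe fs"
    unfolding U in_listset using assms(2)
    by (auto simp: fs vstep_def list_all2_Cons2 intro!: step_vts)
  show "V \<in> vec_universe fs \<Longrightarrow> list_all2 shape fs V"
    unfolding U in_listset by (auto simp: fs list_all2_Cons2 intro: shape_vts)
qed

text \<open>Keys and their order are fixed and only the images vary, which gives the count of maps
  from \<open>vs\<close> to itself.\<close>

definition state_universe :: "vec list \<Rightarrow> state set" where
  "state_universe vs = {s. map fst s = vs \<and> set (map snd s) \<subseteq> set vs}"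

lemma state_universe:
  "finite (state_universe vs)" "card (state_universe vs) \<le> length vs ^ length vs"
proof -
  have sub: "state_universe vs \<subseteq> zip vs ` {ws. set ws \<subseteq> set vs \<and> length ws = length vs}"
  proof
    fix s assume "s \<in> state_universe vs"
    then have "s = zip vs (map snd s)" "set (map snd s) \<subseteq> set vs" "length (map snd s) = length vs"
      by (auto simp: state_universe_def zip_map_fst_snd)
    then show "s \<in> zip vs ` {ws. set ws \<subseteq> set vs \<and> length ws = length vs}" by blast
  qed
  have fin: "finite {ws. set ws \<subseteq> set vs \<and> length ws = length vs}" by (rule finite_lists_length_eq) simp
  show "finite (state_universe vs)" using finite_subset[OF sub] fin by blast
  have "card (state_universe vs) \<le> card (zip vs ` {ws. set ws \<subseteq> set vs \<and> length ws = length vs})"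
    using sub fin by (intro card_mono) auto
  also have "\<dots> \<le> card {ws. set ws \<subseteq> set vs \<and> length ws = length vs}" using fin by (rule card_image_le)
  also have "\<dots> = card (set vs) ^ length vs" by (rule card_lists_length_eq) simp
  also have "\<dots> \<le> length vs ^ length vs" by (intro power_mono card_length) simp
  finally show "card (state_universe vs) \<le> length vs ^ length vs" .
qed

lemma size_enc_state:
  assumes "\<And>p. p \<in> set s \<Longrightarrow> size (enc_vec (fst p)) \<le> m \<and> size (enc_vec (snd p)) \<le> m"
  shows "size (enc_state s) \<le> (2 * m + 2) * length s"
  using assms
proof (induction s)
  case (Cons p s)
  then have "size (enc_vec (fst p)) \<le> m" "size (enc_vec (snd p)) \<le> m" "size (enc_state s) \<le> (2 * m + 2) * length s"
    by auto
  then show ?case by (simp add: enc_state_def enc_vv_def)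
qed (simp add: enc_state_def)


section \<open>The main procedure\<close>

lemma entries_cases:
  assumes "e \<in> set (entries vl As b q m f acc)"
  shows "e \<in> set acc \<or> (\<exists>A\<in>set As. e = (q, A, [], False, Sym 0) \<or>
    (\<exists>A' s' c. f A = Some (A', s') \<and> e = (q, A, A', c, done_or c (mode_state m s'))))"
proof -
  define Q where "Q A \<longleftrightarrow> e = (q, A, [], False, Sym 0) \<or>
    (\<exists>A' s' c. f A = Some (A', s') \<and> e = (q, A, A', c, done_or c (mode_state m s')))" for A
  have "e \<in> set acc \<or> (\<exists>A\<in>set As. Q A)"
    using assms unfolding entries_def
  proof (induction As)
    case (Cons A As)
    let ?t = "foldr (\<lambda>A acc.
     case f A of Some (B, s') \<Rightarrow> (q, A, B, b \<le> vl s', done_or (b \<le> vl s') (mode_state m s')) # acc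
     | None \<Rightarrow> if m then acc else (q, A, [], False, Sym 0) # acc) As acc"
    have "e \<in> set ?t \<or> Q A"
    proof (cases "f A")
      case None
      then show ?thesis using Cons.prems by (auto simp: Q_def split: if_splits)
    next
      case (Some r)
      then show ?thesis using Cons.prems by (cases r) (auto simp: Q_def simp del: done_or.simps)
    qed
    then show ?case using Cons.IH by auto
  qed simp
  then show ?thesis unfolding Q_def .
qed

lemma size_enc_syms [simp]: "size (enc_syms l) = length l"
  unfolding enc_syms_def by (induction l) auto

lemma length_entries: "length (entries vl As b q m f acc) \<le> length As + length acc"
  unfolding entries_def by (induction As) (auto split: option.splits)

context lisp_game
begin

lemma length_rows: "length (rows b) \<le> 3 * length As * length S"
proof -
  have "length (foldr (add_rows b) xs []) \<le> 3 * length As * length xs" for xs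
  proof (induction xs)
    case (Cons s xs)
    let ?r = "foldr (add_rows b) xs []"
    let ?e0 = "entries (value_of fs) As b (mode_state False s) False (move0 b s) ?r"
    let ?e1 = "entries (value_of fs) As b (mode_state True s) False (move0 b s) ?e0"
    let ?e2 = "entries (value_of fs) As b (mode_state True s) True (move1 b s) ?e1"
    have "length ?e0 \<le> length As + length ?r" "length ?e1 \<le> length As + length ?e0" "length ?e2 \<le> length As + length ?e1"
      by (rule length_entries)+
    then have "length ?e2 \<le> 3 * length As + 3 * length As * length xs" using Cons by linarith
    then show ?case by (simp add: algebra_simps add_rows_def[of b s])
  qed simp
  then show ?thesis unfolding rows_def .
qed

text \<open>Two transducer states and two moves take at most \<open>B\<close> each, and the five
  list cells fit into another \<open>B\<close>.\<close>

lemma size_rows: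
  assumes "M < B" "r \<in> set (rows b)"
  shows "size (enc_row r) \<le> 5 * B"
proof -
  have ms: "size (mode_state m s) \<le> B" if "s \<in> set S" for m s
    using small[OF that] assms(1) by (simp add: mode_state_def sexp_bool_def)
  have E: "r \<in> set acc \<or> size (enc_row r) \<le> 5 * B"
    if "r \<in> set (entries (value_of fs) As b (mode_state m' s) m f acc)" "s \<in> set S"
      "\<forall>A A' s'. A \<in> set As \<longrightarrow> f A = Some (A', s') \<longrightarrow> A' \<in> set Bs \<and> s' \<in> set S" for acc m m' s f
    using entries_cases[OF that(1)]
  proof (elim disjE bexE exE conjE)
    fix A assume A: "A \<in> set As" and "r = (mode_state m' s, A, [], False, Sym 0)"
    then show ?thesis using ms[OF that(2), of m'] lens(4)[OF A] B
      by (simp add: sexp_bool_def)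
  next
    fix A A' s' c assume A: "A \<in> set As" and f: "f A = Some (A', s')"
      and r: "r = (mode_state m' s, A, A', c, done_or c (mode_state m s'))"
    then have "A' \<in> set Bs" "s' \<in> set S" using that(3) by auto
    then show ?thesis using ms[OF that(2), of m'] ms[of s' m] lens(4)[OF A] lens(5)[of A'] B
      by (simp add: r sexp_bool_def)
  qed simp
  have pk: "A' \<in> set Bs \<and> s' \<in> set S" if "pick b p Z s A = Some (A', s')" "s \<in> set S" "A \<in> set As" for p Z s A A' s'
    using pick_Some[OF that(1)] \<delta>_in[OF that(2,3)] by auto
  then have f: "\<forall>A A' s'. A \<in> set As \<longrightarrow> move0 b s A = Some (A', s') \<longrightarrow> A' \<in> set Bs \<and> s' \<in> set S"
    "\<forall>A A' s'. A \<in> set As \<longrightarrow> move1 b s A = Some (A', s') \<longrightarrow> A' \<in> set Bs \<and> s' \<in> set S" if "s \<in> set S" for s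
    unfolding move0_def move1_def using that by (metis, metis)
  have "r \<in> set (foldr (add_rows b) xs []) \<Longrightarrow>
      set xs \<subseteq> set S \<Longrightarrow> size (enc_row r) \<le> 5 * B" for xs
  proof (induction xs)
    case (Cons s xs)
    then have s: "s \<in> set S" by simp
    from Cons show ?case unfolding foldr_Cons o_apply add_rows_def
      by (auto dest!: E[OF _ s f(1)[OF s]] E[OF _ s f(2)[OF s]])
  qed simp
  then show ?thesis using assms(2) unfolding rows_def by blast
qed

lemma encode_machine:
  "encode_transducer (machine s0 b) = sexp_list [mode_state True s0, enc_syms (props True fs), enc_rows (rows b)]"
proof -
  have "(\<lambda>(q, A, B, e, q'). sexp_list [q, sexp_list (map Sym A), sexp_list (map Sym B), sexp_bool e, q']) = enc_row"
    by (auto simp: fun_eq_iff enc_syms_def)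
  then show ?thesis by (simp add: encode_transducer_def machine_def enc_rows_def enc_syms_def)
qed

lemma size_machine:
  assumes "M < B" "s0 \<in> set S" "length (props True fs) < B"
  shows "size (encode_transducer (machine s0 b)) \<le> B ^ 5"
proof -
  have "sum_list (map (\<lambda>r. size (enc_row r)) (rows b)) \<le> sum_list (map (\<lambda>r. 5 * B) (rows b))"
    by (intro sum_list_mono size_rows assms(1))
  also have "\<dots> = length (rows b) * (5 * B)" by (simp add: sum_list_triv)
  finally have "sum_list (map (\<lambda>r. size (enc_row r)) (rows b)) \<le> length (rows b) * (5 * B)" .
  then have "size (enc_rows (rows b)) \<le> length (rows b) * (5 * B + 1)"
    by (simp add: enc_rows_def size_sexp_list algebra_simps o_def)
  also have "\<dots> \<le> (3 * B * B) * (6 * B)"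
  proof (rule mult_le_mono)
    have "3 * length As * length S \<le> 3 * B * B" using lens by (intro mult_le_mono) auto
    then show "length (rows b) \<le> 3 * B * B" using length_rows[of b] by linarith
  qed (use B in simp)
  also have "\<dots> = 18 * B ^ 3" by (simp add: power3_eq_cube)
  finally have r: "size (enc_rows (rows b)) \<le> 18 * B ^ 3" .
  have "size (mode_state True s0) \<le> B" using small[OF assms(2)] assms(1) by (simp add: mode_state_def sexp_bool_def)
  moreover have "size (enc_syms (props True fs)) \<le> B" using assms(3) by simp
  ultimately have "size (encode_transducer (machine s0 b)) \<le> 18 * B ^ 3 + 3 * B"
    using r B unfolding encode_machine by simp
  also have "\<dots> \<le> 18 * B ^ 3 + 3 * B ^ 3"
    using power_increasing[of 1 3 B] B by simp
  also have "\<dots> \<le> B * B ^ 3" using B by simp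
  also have "\<dots> = B ^ 4" by (simp add: numeral_eq_Suc)
  also have "\<dots> \<le> B ^ 5" using B by (intro power_increasing) auto
  finally show ?thesis .
qed

end

context lisp
begin

lemma cl_next_vec:
  assumes "\<And>c. c \<in> set fs \<Longrightarrow> wf_fm c" "list_all2 shape fs V" "M + 3 * fms_len fs + 11 \<le> k"
    "fms_len fs < B" "length L < B" "0 < M"
  shows "cl k p_next [Sym 0, enc_fms fs, Pair (enc_syms L) (Sym 0), enc_vec V] = Some (enc_vec (vstep (set L) fs V))"
proof -
  have "cl (M + 3 * fms_len fs + 10) p_steps [enc_letter L [], enc_fms fs, enc_vec V] = Some (enc_vec (vstep (set L \<union> set []) fs V))"
    using assms B by (intro cl_steps) auto
  then show ?thesis
    by (intro run[where j = "M + 3 * fms_len fs + 10"])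
      (use assms(3) in \<open>simp_all add: prog_nth body_next_def enc_letter_def enc_syms_def\<close>)
qed

lemma cl_next_state:
  assumes "\<And>c. c \<in> set fs \<Longrightarrow> wf_fm c" "\<And>p. p \<in> set s \<Longrightarrow> list_all2 shape fs (fst p)" "M + 3 * fms_len fs + 11 \<le> k"
    "fms_len fs < B" "length L < B" "2 * fms_len fs < M" "length s < B"
  shows "cl k p_next [Sym 1, enc_fms fs, Pair (enc_syms L) (Sym 0), enc_state s] = Some (enc_state (sstep (set L) fs s))"
proof -
  have "cl (M + 3 * fms_len fs + 10) p_delta [Pair (Pair (enc_letter L []) (enc_fms fs)) (enc_state s), enc_state s, Sym 0] =
      Some (enc_state (sstep (set L \<union> set []) fs s))"
    using assms B by (intro cl_delta) auto
  then show ?thesis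
    by (intro run[where j = "M + 3 * fms_len fs + 10"])
      (use assms(3) in \<open>simp_all add: prog_nth body_next_def enc_letter_def enc_syms_def\<close>)
qed

lemma cl_copy:
  assumes "length vs < B" "3 \<le> k"
  shows "cl k p_copy [Sym 0, sexp_list (map enc_vec vs), Sym 0] = Some (enc_state (map (\<lambda>V. (V, V)) vs))"
proof -
  have "cl k 58 [Sym 0, sexp_list (map enc_vec vs), enc_state []] = Some (enc_state (foldr (\<lambda>V acc. (V, V) # acc) vs []))"
    by (rule cl_foldr[where g = 57 and j = 1], use assms in \<open>simp_all add: prog_nth length_prog\<close>)
      (rule run[where j = 0], simp_all add: prog_nth body_copy_def enc_state_def enc_vv_def)
  then show ?thesis by (simp add: foldr_Cons_map enc_state_def)
qed

end

lemma length_props: "length (props True fs) + length (props False fs) \<le> fms_len fs"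
proof -
  let ?o = "concat (map occs fs)"
  have "length (props True fs) + length (props False fs) = length ?o"
  proof -
    have "filter (\<lambda>(c, p). c = False) ?o = filter (\<lambda>x. \<not> (case x of (c, p) \<Rightarrow> c = True)) ?o"
      by (rule filter_cong) auto
    then show ?thesis unfolding props_def length_map
      using sum_length_filter_compl[of "\<lambda>(c, p). c = True" ?o] by (simp only:)
  qed
  also have "\<dots> \<le> fms_len fs"
    unfolding fms_len_def length_concat map_map by (intro sum_list_mono) (simp add: length_occs)
  finally show ?thesis .
qed

section \<open>Concrete bounds and the assembled program\<close>

locale problem =
  fixes F :: "(nat \<times> (real list \<Rightarrow> real)) set" and X Y :: "nat set" and \<alpha>\<^sub>s \<alpha>\<^sub>c :: ltl and \<phi> :: qltl
  assumes unit: "unit_functions F" and disj: "X \<inter> Y = {}"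
    and safe: "safe \<alpha>\<^sub>s" "ltl_props \<alpha>\<^sub>s \<subseteq> X \<union> Y"
    and cosafe: "cosafe \<alpha>\<^sub>c" "ltl_props \<alpha>\<^sub>c \<subseteq> X \<union> Y"
    and over: "qltl_over F \<phi>" "qltl_props \<phi> \<subseteq> X \<union> Y"
begin

definition fs :: "fm list" where "fs = [fm_of_ltl X \<alpha>\<^sub>s, fm_of_ltl X \<alpha>\<^sub>c, fm_of_qltl X \<phi>]"
definition n :: nat where "n = fms_len fs"
text \<open>The bound on the number of vectors from \<open>vec_universe\<close>.\<close>

definition N :: nat where "N = 2 ^ (n * n)"
text \<open>A state has at most \<open>N\<close> entries, each with two vectors of size at most
  \<open>2 * n\<close>, a pair and a list cell. The summand \<open>2 * n + 1\<close> makes the bound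
  strict for states and vectors alike.\<close>

definition M :: nat where "M = (4 * n + 2) * N + 2 * n + 1"
text \<open>1000 covers the bodies of the program, \<open>2 ^ n\<close> the letters and
  \<open>N ^ N\<close> the states; as a product they also bound the list of successors of all states
  under all letters.\<close>

definition B :: nat where "B = 1000 * 2 ^ n * N ^ N"

lemma wf: "c \<in> set fs \<Longrightarrow> wf_fm c"
  by (auto simp: fs_def wf_fm_of_ltl wf_fm_of_qltl)

lemma fs_3: "length fs = 3"
  by (simp add: fs_def)

lemma N: "1 \<le> N" "N \<le> N ^ N" "1 \<le> N ^ N"
proof -
  show 1: "1 \<le> N" by (simp add: N_def)
  show "N \<le> N ^ N" using power_increasing[OF 1 1] by simp
  then show "1 \<le> N ^ N" using 1 by simp
qed

lemma bounds: "1000 \<le> B" "N ^ N * 2 ^ n < B" "N * 2 ^ n < B" "2 ^ n < B" "n < B" "N < B" "N ^ N < B" "M < B" "2 * n < M"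
proof -
  have n: "n < 2 ^ n" "(1 :: nat) \<le> 2 ^ n" by simp_all
  have p: "1 \<le> 2 ^ n * N ^ N" using mult_le_mono[OF n(2) N(3)] by simp
  have B: "B = 1000 * (2 ^ n * N ^ N)" by (simp add: B_def)
  show 1: "1000 \<le> B" using p unfolding B by linarith
  show 2: "N ^ N * 2 ^ n < B" unfolding B mult.commute[of "N ^ N"] using p by linarith
  have "N * 2 ^ n \<le> N ^ N * 2 ^ n" using N by simp
  then show 3: "N * 2 ^ n < B" using 2 by linarith
  have "1 * 2 ^ n \<le> N * 2 ^ n" using N by (intro mult_le_mono1)
  then show 4: "2 ^ n < B" using 3 by linarith
  then show "n < B" using n by linarith
  have "N * 1 \<le> N * 2 ^ n" using n by (intro mult_le_mono2)
  then show "N < B" using 3 by linarith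
  have "N ^ N * 1 \<le> N ^ N * 2 ^ n" using n by (intro mult_le_mono2)
  then show "N ^ N < B" using 2 by linarith
  have "(2 * n + 1) * 1 \<le> (2 * n + 1) * N" using N by (intro mult_le_mono2)
  then have "M \<le> (6 * n + 3) * N" unfolding M_def by (simp add: algebra_simps)
  also have "\<dots> \<le> (9 * 2 ^ n) * N ^ N"
  proof (rule mult_le_mono)
    show "6 * n + 3 \<le> 9 * 2 ^ n" using n by linarith
  qed (rule N)
  also have "\<dots> = 9 * (2 ^ n * N ^ N)" by simp
  also have "\<dots> < B" unfolding B using p by linarith
  finally show "M < B" .
  show "2 * n < M" unfolding M_def by simp
qed

sublocale lisp B M by unfold_locales (rule bounds)

lemma main:
  "\<exists>T. cl (M + 3 * n + 31) 0 [enc_fms fs] = Some (encode_transducer T) \<and>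
    bgv_optimal X Y (And \<alpha>\<^sub>s \<alpha>\<^sub>c) \<phi> (strategy_of T) \<and> size (encode_transducer T) \<le> B ^ 5"
proof -
  let ?ps = "props True fs @ props False fs"
  \<comment> \<open>\<open>?d\<close> is the level of one transition in a closure, \<open>?j\<close>
    a common level for all calls of the main body. The highest demand is that of
    \<open>p_best\<close>, which is \<open>lg.D + 18\<close> or
    \<open>M + 3 * n + 28\<close>.\<close>
  let ?Ls = "sublists ?ps" and ?d = "M + 3 * n + 11" and ?j = "M + 3 * n + 30"
  have ps: "length ?ps \<le> n" using length_props[of fs] by (simp add: n_def)
  have "(2 :: nat) ^ length ?ps \<le> 2 ^ n" using ps by (intro power_increasing) auto
  then have Ls: "length ?Ls \<le> 2 ^ n" by (simp add: length_sublists)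
  have LsB: "length ?Ls < B" using Ls bounds(4) by linarith
  have LB: "length L < B" if "L \<in> set ?Ls" for L using in_sublists[OF that] ps bounds(5) by linarith
  have V: "finite (vec_universe fs)" "card (vec_universe fs) \<le> 2 ^ (fms_len fs * fms_len fs)"
    "ivec fs \<in> vec_universe fs" "\<And>V a. V \<in> vec_universe fs \<Longrightarrow> vstep a fs V \<in> vec_universe fs"
    "\<And>V. V \<in> vec_universe fs \<Longrightarrow> list_all2 shape fs V"
    using vec_universe[OF fs_3] wf by blast+
  have cV: "card (vec_universe fs) \<le> N" using V(2) by (simp add: N_def n_def)
  have sV: "size (enc_vec V) \<le> 2 * n" if "V \<in> vec_universe fs" for V
    using size_enc_vec[OF V(5)[OF that]] by (simp add: n_def)
  \<comment> \<open>The second closure runs over the maps between the vectors that this one finds,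
    so its universe can be named only once \<open>vs\<close> is obtained.\<close>
  interpret c1: closure B M enc_vec "\<lambda>L. vstep (set L) fs" ?Ls "vec_universe fs" "Sym 0" "enc_fms fs" ?d
  proof
    show "card (vec_universe fs) < B" using cV bounds(6) by linarith
    have "card (vec_universe fs) * length ?Ls \<le> N * 2 ^ n" using cV Ls by (rule mult_le_mono)
    then show "card (vec_universe fs) * length ?Ls < B" using bounds(3) by linarith
    show "size (enc_vec V) < M" if "V \<in> vec_universe fs" for V using sV[OF that] bounds(9) by linarith
    show "cl ?d p_next [Sym 0, enc_fms fs, Pair (enc_syms L) (Sym 0), enc_vec V] = Some (enc_vec (vstep (set L) fs V))"
      if "L \<in> set ?Ls" "V \<in> vec_universe fs" for L V
      using wf V(5)[OF that(2)] bounds(5,9) LB[OF that(1)] by (intro cl_next_vec) (auto simp: n_def)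
  qed (use V LsB in \<open>auto simp: enc_vec_inject\<close>)
  obtain vs where vs: "cl ?j p_closure [Pair (Pair (Sym 0) (enc_fms fs)) (enc_symss ?Ls), Pair (enc_vec (ivec fs)) (Sym 0)] =
      Some (sexp_list (map enc_vec vs))" "distinct vs" "set vs \<subseteq> vec_universe fs" "ivec fs \<in> set vs"
      "\<And>L V. L \<in> set ?Ls \<Longrightarrow> V \<in> set vs \<Longrightarrow> vstep (set L) fs V \<in> set vs"
    using c1.cl_closure[OF V(3), of ?j] by auto
  have vs_len: "length vs \<le> N" using c1.length_less[OF vs(2,3)] cV by linarith
  let ?s0 = "map (\<lambda>V. (V, V)) vs" and ?U = "state_universe vs"
  have "length vs ^ length vs \<le> N ^ length vs" using vs_len by (intro power_mono) auto
  also have "\<dots> \<le> N ^ N" using vs_len N by (intro power_increasing) auto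
  finally have cU: "card ?U \<le> N ^ N" using state_universe(2)[of vs] by linarith
  have closed: "sstep (set L) fs s \<in> ?U" if "L \<in> set ?Ls" "s \<in> ?U" for L s
  proof -
    have "lookup V s \<in> set vs" if "V \<in> set vs" for V
    proof -
      have "lookup V s \<in> set (map snd s)" if "V \<in> set (map fst s)" for s :: state
        using that unfolding lookup_def by (induction s) auto
      then show ?thesis using \<open>s \<in> ?U\<close> that unfolding state_universe_def by blast
    qed
    note lk = this
    have "map fst (sstep (set L) fs s) = vs"
      using that(2) by (simp add: sstep_map state_universe_def o_def)
    moreover have "set (map snd (sstep (set L) fs s)) \<subseteq> set vs"
    proof
      fix W assume "W \<in> set (map snd (sstep (set L) fs s))"
      then obtain p where p: "p \<in> set s" "W = lookup (vstep (set L) fs (fst p)) s" by (auto simp: sstep_map)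
      have "fst p \<in> set vs" using that(2) p(1) by (auto simp: state_universe_def intro: rev_image_eqI)
      from lk[OF vs(5)[OF that(1) this]] show "W \<in> set vs" using p(2) by simp
    qed
    ultimately show ?thesis by (simp add: state_universe_def)
  qed
  have U: "length s = length vs \<and> (\<forall>p\<in>set s. fst p \<in> set vs \<and> snd p \<in> set vs)" if "s \<in> ?U" for s
  proof -
    have s: "map fst s = vs" "set (map snd s) \<subseteq> set vs" using that unfolding state_universe_def by blast+
    have "fst p \<in> set (map fst s)" "snd p \<in> set (map snd s)" if "p \<in> set s" for p using that by simp_all
    then show ?thesis using s by (auto simp only: length_map[of fst s, symmetric])
  qed
  have sU: "size (enc_state s) < M" if "s \<in> ?U" for s
  proof -
    have "size (enc_state s) \<le> (2 * (2 * n) + 2) * length s"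
      using U[OF that] vs(3) by (intro size_enc_state conjI sV) auto
    also have "\<dots> \<le> (4 * n + 2) * N" using U[OF that] vs_len by (intro mult_le_mono) auto
    finally show ?thesis unfolding M_def by linarith
  qed
  have keys: "list_all2 shape fs (fst p)" if "s \<in> ?U" "p \<in> set s" for s p
    using U[OF that(1)] that(2) vs(3) V(5) by blast
  have lenU: "length s < B" if "s \<in> ?U" for s using U[OF that] vs_len bounds(6) by linarith
  interpret c2: closure B M enc_state "\<lambda>L. sstep (set L) fs" ?Ls ?U "Sym 1" "enc_fms fs" ?d
  proof
    show "card ?U < B" using cU bounds(7) by linarith
    have "card ?U * length ?Ls \<le> N ^ N * 2 ^ n" using cU Ls by (rule mult_le_mono)
    then show "card ?U * length ?Ls < B" using bounds(2) by linarith
    show "cl ?d p_next [Sym 1, enc_fms fs, Pair (enc_syms L) (Sym 0), enc_state s] = Some (enc_state (sstep (set L) fs s))"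
      if "L \<in> set ?Ls" "s \<in> ?U" for L s
      using wf keys[OF that(2)] bounds(5,9) LB[OF that(1)] lenU[OF that(2)]
      by (intro cl_next_state) (auto simp: n_def)
  qed (use state_universe(1) LsB closed sU in \<open>auto simp: enc_state_inject\<close>)
  have s0: "?s0 \<in> ?U" by (auto simp: state_universe_def o_def)
  obtain S where S: "cl ?j p_closure [Pair (Pair (Sym 1) (enc_fms fs)) (enc_symss ?Ls), Pair (enc_state ?s0) (Sym 0)] =
      Some (sexp_list (map enc_state S))" "distinct S" "set S \<subseteq> ?U" "?s0 \<in> set S"
      "\<And>L s. L \<in> set ?Ls \<Longrightarrow> s \<in> set S \<Longrightarrow> sstep (set L) fs s \<in> set S"
    using c2.cl_closure[OF s0, of ?j] by auto
  have S_len: "length S < B" using c2.length_less[OF S(2,3)] cU bounds(7) by linarith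
  have ex_L: "\<exists>L\<in>set ?Ls. set L = D" if "D \<subseteq> set (props True fs) \<union> set (props False fs)" for D
    using that by (intro ex_sublists) simp
  interpret sy: synthesis F X Y \<alpha>\<^sub>s \<alpha>\<^sub>c \<phi> vs S fs
  proof
    show "vstep D fs V \<in> set vs"
      if "V \<in> set vs" "D \<subseteq> set (props True fs) \<union> set (props False fs)" for V D
      using ex_L[OF that(2)] vs(5) that(1) by blast
    show "sstep D fs s \<in> set S"
      if "s \<in> set S" "D \<subseteq> set (props True fs) \<union> set (props False fs)" for s D
      using ex_L[OF that(2)] S(5) that(1) by blast
  qed (rule unit disj safe cosafe over fs_def vs(4) S(4))+
  have pl: "length (props True fs) \<le> n" "length (props False fs) \<le> n" using ps by auto
  have "(2 :: nat) ^ length (props True fs) \<le> 2 ^ n" "(2 :: nat) ^ length (props False fs) \<le> 2 ^ n"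
    using pl by (auto intro: power_increasing)
  then have AB: "length sy.As < B" "length sy.Bs < B"
    unfolding sy.As_def sy.Bs_def length_sublists using bounds(4) by linarith+
  interpret lg: lisp_game B M fs S
  proof
    show "list_all2 shape fs (lookup (ivec fs) s)" if "s \<in> set S" for s
    proof -
      have "lookup V s \<in> set (map snd s)" if "V \<in> set (map fst s)" for V and s :: state
        using that unfolding lookup_def by (induction s) auto
      then have "lookup (ivec fs) s \<in> set vs"
        using S(3) that vs(4) unfolding state_universe_def by blast
      then show ?thesis using vs(3) V(5) by blast
    qed
    show "length s < B \<and> size (enc_state s) < M" if "s \<in> set S" for s using that S(3) lenU sU by blast
    show "length A < B" if "A \<in> set sy.As" for A
      using in_sublists[OF that[unfolded sy.As_def]] pl bounds(5) by linarith
    show "length A < B" if "A \<in> set sy.Bs" for A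
      using in_sublists[OF that[unfolded sy.Bs_def]] pl bounds(5) by linarith
  qed (use wf fs_3 bounds keys S(3) sy.\<delta>_closed S_len AB in \<open>auto simp: n_def\<close>)
  obtain b where b: "sy.best ?s0 = Some b"
    and opt: "bgv_optimal X Y (And \<alpha>\<^sub>s \<alpha>\<^sub>c) \<phi> (strategy_of (sy.machine ?s0 b))"
    using sy.machine_optimal unfolding sy.sg_Nil by blast
  have size: "size (encode_transducer (sy.machine ?s0 b)) \<le> B ^ 5"
    using lg.size_machine[OF bounds(8) S(4)] pl bounds(5) by simp
  have D: "lg.D = M + 3 * n + 10" by (simp add: lg.D_def n_def)
  have colls: "cl ?j p_colls [sexp_bool c, enc_fms fs, enc_syms l] = Some (enc_syms (props c fs @ l))" for c l
    unfolding props_def using wf bounds(5) by (intro cl_colls) (auto simp: n_def)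
  obtain f0 f1 f2 where f: "fs = [f0, f1, f2]" by (simp add: fs_def)
  have fl: "fm_len c \<le> n" if "c \<in> set fs" for c using fm_len_le[OF that] by (simp add: n_def)
  have ini: "cl ?j p_ini [Num z, enc_fm c, enc_vec ts] = Some (enc_vec (ini z c # ts))" if "c \<in> set fs" for z c ts
    using wf[OF that] fl[OF that] bounds(5) by (intro cl_ini) auto
  have ini2: "cl ?j p_ini [Num 0, enc_fm f2, Sym 0] = Some (enc_vec [ini 0 f2])"
    using ini[of f2 0 "[]"] f by (simp add: enc_vec_def)
  have iv: "ivec fs = [ini 1 f0, ini 0 f1, ini 0 f2]" by (simp add: ivec_def f)
  have subs: "cl ?j p_subs [Sym 0, enc_syms l, Pair (Sym 0) (Sym 0)] = Some (enc_symss (sublists l))" if "length l \<le> n" for l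
  proof -
    have "(2 :: nat) ^ length l \<le> 2 ^ n" using that by (intro power_increasing) auto
    then have "2 ^ length l < B" using bounds(4) by linarith
    then show ?thesis by (intro cl_subs) auto
  qed
  have copy: "cl ?j p_copy [Sym 0, sexp_list (map enc_vec vs), Sym 0] = Some (enc_state ?s0)"
    using vs_len bounds(6) by (intro cl_copy) auto
  have best: "cl ?j p_best [Pair lg.G0 (Pair (enc_state ?s0) (enc_states S)), enc_states S, Sym 0] = Some (Num b)"
    using lg.cl_best[OF S(4), of ?j] b by (simp add: D)
  have regions: "cl ?j p_regions [lg.G b, enc_states S] = Some (lg.regions b)"
    by (rule lg.cl_regions) (simp add: D)
  have rows: "cl ?j p_rows [Pair (lg.G b) (lg.regions b), enc_states S, Sym 0] = Some (enc_rows (sy.rows b))"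
    by (rule lg.cl_rows) (simp add: D)
  have fms: "enc_fms fs = Pair (enc_fm f0) (Pair (enc_fm f1) (Pair (enc_fm f2) (Sym 0)))"
    by (simp add: enc_fms_def f)
  note colls' = colls[of True "[]", unfolded sexp_bool_consts One_nat_def enc_syms_def[of "[]"], simplified]
    colls[of False "[]", unfolded sexp_bool_consts One_nat_def enc_syms_def[of "[]"], simplified]
    colls[of True "props False fs", unfolded sexp_bool_consts One_nat_def]
  have ini1: "cl ?j p_ini [Num 0, enc_fm f1, enc_vec [ini 0 f2]] = Some (enc_vec [ini 0 f1, ini 0 f2])"
    "cl ?j p_ini [Num 1, enc_fm f0, enc_vec [ini 0 f1, ini 0 f2]] = Some (enc_vec (ivec fs))"
    using ini f iv by simp_all
  have G: "Pair (enc_fms fs) (Pair (enc_vec (ivec fs)) (Pair (enc_symss (sublists (props True fs)))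
      (enc_symss (sublists (props False fs))))) = lg.G0" "Pair (Num b) lg.G0 = lg.G b"
    by (simp_all add: lg.G0_def lg.G_def sy.As_def sy.Bs_def)
  note rules = colls' ini1 ini2 subs[OF ps] subs[OF pl(1)] subs[OF pl(2)] vs(1) copy
    S(1)[folded enc_states_def, unfolded One_nat_def] G(1) best
  have "cl (M + 3 * n + 31) 0 [enc_fms fs] = Some (encode_transducer (sy.machine ?s0 b))"
    unfolding lg.encode_machine
    by (rule run[where j = ?j])
      (simp_all add: prog_nth body_main_def rules[unfolded fms] fms
        G(2) regions rows mode_state_def sexp_bool_consts)
  then show ?thesis using opt size by blast
qed

end


context problem
begin

lemma n_eq: "n = ltl_length \<alpha>\<^sub>s + ltl_length \<alpha>\<^sub>c + qltl_length \<phi>"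
  by (simp add: n_def fs_def fm_len_of_ltl fm_len_of_qltl)

lemma encode_problem_eq: "encode_problem X \<alpha>\<^sub>s \<alpha>\<^sub>c \<phi> = enc_fms fs"
  by (simp add: encode_problem_def enc_fms_def fs_def encode_ltl_eq encode_qltl_eq)

text \<open>The binary logarithm of \<open>B\<close> is at most
  \<open>2 ^ (4 + n + 2 * n * n)\<close> and the exponent at most
  \<open>2 ^ (35 + 9 * n + n * n)\<close>. The logarithm of the power is bounded by their product,
  so these two polynomials add up to the final one.\<close>

lemma time_bound: "B ^ (M + 3 * n + 32) \<le> 2 ^ 2 ^ (39 + 10 * n + 3 * (n * n))"
proof -
  have "B = 1000 * 2 ^ n * 2 ^ (n * n * N)" by (simp add: B_def N_def power_mult)
  also have "\<dots> \<le> 2 ^ 10 * 2 ^ n * 2 ^ (n * n * N)" by (intro mult_le_mono) auto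
  also have "\<dots> = 2 ^ (10 + n + n * n * N)" by (simp add: power_add)
  finally have B: "B \<le> 2 ^ (10 + n + n * n * N)" .
  let ?x = "n + n * n"
  have "10 + n + n * n * N \<le> (10 + ?x) * N"
  proof -
    have "(10 + n) * 1 \<le> (10 + n) * N" using N(1) by (intro mult_le_mono2)
    then show ?thesis by (simp add: algebra_simps)
  qed
  also have "\<dots> \<le> (2 ^ 4 * 2 ^ ?x) * N"
  proof (rule mult_le_mono1)
    define p :: nat where "p = 2 ^ ?x"
    have "?x < p" unfolding p_def by (rule less_exp)
    then show "10 + ?x \<le> 2 ^ 4 * 2 ^ ?x" unfolding p_def[symmetric] by simp
  qed
  also have "\<dots> = 2 ^ (4 + ?x + n * n)" by (simp only: N_def power_add)
  finally have e: "10 + n + n * n * N \<le> 2 ^ (4 + ?x + n * n)" .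
  have "M + 3 * n + 32 \<le> (9 * n + 35) * N"
  proof -
    have "(5 * n + 33) * 1 \<le> (5 * n + 33) * N" using N(1) by (intro mult_le_mono2)
    then show ?thesis by (simp add: M_def algebra_simps)
  qed
  also have "\<dots> \<le> 2 ^ (9 * n + 35) * N" by (intro mult_le_mono1 less_imp_le less_exp)
  also have "\<dots> = 2 ^ (9 * n + 35 + n * n)" by (simp add: N_def power_add)
  finally have k: "M + 3 * n + 32 \<le> 2 ^ (9 * n + 35 + n * n)" .
  have "B ^ (M + 3 * n + 32) \<le> (2 ^ (10 + n + n * n * N)) ^ (M + 3 * n + 32)"
    using B by (rule power_mono) simp
  also have "\<dots> = 2 ^ ((10 + n + n * n * N) * (M + 3 * n + 32))" by (rule power_mult[symmetric])
  also have "\<dots> \<le> 2 ^ (2 ^ (4 + ?x + n * n) * 2 ^ (9 * n + 35 + n * n))"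
    using mult_le_mono[OF e k] by (rule power_increasing) simp
  also have "\<dots> = 2 ^ 2 ^ (39 + 10 * n + 3 * (n * n))"
  proof -
    have "4 + ?x + n * n + (9 * n + 35 + n * n) = 39 + 10 * n + 3 * (n * n)" by simp
    then show ?thesis by (simp only: power_add[symmetric])
  qed
  finally show ?thesis .
qed

lemma synthesis_in_time:
  "\<exists>T. computes_in_time prog (encode_problem X \<alpha>\<^sub>s \<alpha>\<^sub>c \<phi>) (encode_transducer T)
      (2 ^ 2 ^ poly [:39, 10, 3:] (ltl_length \<alpha>\<^sub>s + ltl_length \<alpha>\<^sub>c + qltl_length \<phi>)) \<and>
    bgv_optimal X Y (And \<alpha>\<^sub>s \<alpha>\<^sub>c) \<phi> (strategy_of T)"
proof -
  let ?x = "encode_problem X \<alpha>\<^sub>s \<alpha>\<^sub>c \<phi>" and ?k = "M + 3 * n + 31"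
  obtain T where T: "cl ?k 0 [?x] = Some (encode_transducer T)"
    "bgv_optimal X Y (And \<alpha>\<^sub>s \<alpha>\<^sub>c) \<phi> (strategy_of T)" "size (encode_transducer T) \<le> B ^ 5"
    using main unfolding encode_problem_eq by blast
  then obtain t where t: "t \<le> B ^ ?k" "eval prog [?x] (prog ! 0) (encode_transducer T) t"
    unfolding cl_def cal_eq_Some by blast
  have "evals prog [?x] [EVar 0] [[?x] ! 0] (1 + 0)"
    by (intro eval_evals.Args eval_evals.Var eval_evals.Nil) simp
  then have args: "evals prog [?x] [EVar 0] [?x] (1 + 0)" by simp
  have "eval prog [?x] (ECall 0 [EVar 0]) (encode_transducer T) (1 + 0 + t + 1)"
    by (rule eval_evals.Call[OF args _ t(2)]) (simp add: length_prog)
  moreover have "1 + 0 + t + 1 + size (encode_transducer T) \<le> 2 ^ 2 ^ poly [:39, 10, 3:] n"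
  proof -
    have "B ^ 5 \<le> B ^ ?k" "1 \<le> B ^ ?k" using bounds(1) by (auto intro: power_increasing)
    \<comment> \<open>The outer call, the running time and the output size take at most four times
      \<open>B ^ ?k\<close>; one more factor \<open>B\<close> absorbs the 4.\<close>
    then have "1 + 0 + t + 1 + size (encode_transducer T) \<le> 4 * B ^ ?k" using t(1) T(3) by linarith
    also have "\<dots> \<le> B * B ^ ?k" using bounds(1) by (intro mult_le_mono1) simp
    also have "\<dots> = B ^ (M + 3 * n + 32)" by (simp add: numeral_eq_Suc)
    also have "\<dots> \<le> 2 ^ 2 ^ (39 + 10 * n + 3 * (n * n))" by (rule time_bound)
    also have "39 + 10 * n + 3 * (n * n) = poly [:39, 10, 3:] n" by (simp add: algebra_simps)
    finally show ?thesis .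
  qed
  ultimately show ?thesis using T(2) unfolding computes_in_time_def n_eq by blast
qed

end

text \<open>Both witnesses are closed terms that do not mention \<open>F\<close>: its members reach
  the program only inside the encoded formula.\<close>

theorem theorem11:
  fixes F :: "(nat \<times> (real list \<Rightarrow> real)) set"
  assumes "unit_functions F"
  shows "\<exists>(P :: expr list) (p :: nat poly).
    \<forall>(X :: nat set) (Y :: nat set) \<alpha>\<^sub>s \<alpha>\<^sub>c \<phi>.
      X \<inter> Y = {} \<and>
      safe \<alpha>\<^sub>s \<and> ltl_props \<alpha>\<^sub>s \<subseteq> X \<union> Y \<and>
      cosafe \<alpha>\<^sub>c \<and> ltl_props \<alpha>\<^sub>c \<subseteq> X \<union> Y \<and>
      qltl_over F \<phi> \<and> qltl_props \<phi> \<subseteq> X \<union> Y \<longrightarrow>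
      (\<exists>M. computes_in_time P (encode_problem X \<alpha>\<^sub>s \<alpha>\<^sub>c \<phi>) (encode_transducer M)
             (2 ^ 2 ^ poly p (ltl_length \<alpha>\<^sub>s + ltl_length \<alpha>\<^sub>c + qltl_length \<phi>)) \<and>
           bgv_optimal X Y (And \<alpha>\<^sub>s \<alpha>\<^sub>c) \<phi> (strategy_of M))"
proof (rule exI[of _ prog], rule exI[of _ "[:39, 10, 3:]"], intro allI impI)
  fix X Y \<alpha>\<^sub>s \<alpha>\<^sub>c \<phi>
  assume "X \<inter> Y = {} \<and>
      safe \<alpha>\<^sub>s \<and> ltl_props \<alpha>\<^sub>s \<subseteq> X \<union> Y \<and>
      cosafe \<alpha>\<^sub>c \<and> ltl_props \<alpha>\<^sub>c \<subseteq> X \<union> Y \<and>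
      qltl_over F \<phi> \<and> qltl_props \<phi> \<subseteq> X \<union> Y"
  with assms interpret problem F X Y \<alpha>\<^sub>s \<alpha>\<^sub>c \<phi> by unfold_locales auto
  show "\<exists>M. computes_in_time prog (encode_problem X \<alpha>\<^sub>s \<alpha>\<^sub>c \<phi>) (encode_transducer M)
             (2 ^ 2 ^ poly [:39, 10, 3:] (ltl_length \<alpha>\<^sub>s + ltl_length \<alpha>\<^sub>c + qltl_length \<phi>)) \<and>
           bgv_optimal X Y (And \<alpha>\<^sub>s \<alpha>\<^sub>c) \<phi> (strategy_of M)"
    by (rule synthesis_in_time)
qed

end
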